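(* Let $X_1,\dots,X_n$ be a piecewise locally stationary process, let $H:\mathbb{R}^2\to\mathbb{R}$ and $W_n:[0,1]^2\to\mathbb{R}$ be symmetric Borel functions, and let $$V_n=\sum_{k=1}^n\sum_{j=1}^nW_n(t_k,t_j)H(X_k,X_j).$$ With $N_n$, $W_{j,\cdot}$, $W^{(n)}$, $W_{(n)}$, $\delta_X$ as defined in the context, assume: (1) For some $\eta\in(0,1]$ and some function $L:\mathbb{R}\to\mathbb{R}$, the function $H^*(t,s):=H(t,s)/[L(t)L(s)]$ belongs to $W_0^{\eta}(\mathbb{R}^2)$. (2) $L$ is differentiable with derivative $L'$; there is a finite constant $C$ such that $\max_{a\le t\le b}|L'(t)|\le C(|L'(a)|+|L'(b)|+1)$ for all $a\le b$; and $\sup_n\max_{1\le j\le n}\|L(X_j)\|_{8}<\infty$, $\sup_n\max_{1\le j\le n}\|L'(X_j)\|_{8}<\infty$. (3) There exist sequences $l_n,m_n$ of positive integers with $m_n/\log n\to\infty$, $l_n/n\to0$ and $m_n/l_n\to0$ such that, with $s_n=l_n+m_n$ and, for $j=1,\dots,\lceil n/s_n\rceil$, $$A_j=\sum_{k=1}^{l_n}W^2_{s_n(j-1)+k,\cdot},\qquad a_j=\sum_{k=l_n+1}^{s_n}W^2_{s_n(j-1)+k,\cdot},$$ one has $\sum_j a_j/W^{(n)}\to0$ and $\max_jA_j/W^{(n)}\to0$. (4) There is $c>0$ such that $\operatorname{Var}(N_n)/W^{(n)}\ge c$ for all sufficiently large $n$. (5) For some $\rho\in[0,1)$, $\delta_X(k,8)=O(\rho^k)$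 as $k\to\infty$. (6) There exist functions $f_n$ and a $p\in(0,\infty)$ such that $|W_n(t_l,t_m)-W_n(t_k,t_j)|\le f_n(t_k,t_j)|(l,m)-(k,j)|^p$ for all integers $k,j,l,m\in\{1,\dots,n\}$. (7) $W^{(n)}/[W_{(n)}+\Delta_n]\to\infty$, where $\Delta_n=\sum_{k=1}^n\sum_{j=1}^n|W_n(t_k,t_j)|f_n(t_k,t_j)$. Then $(V_n-E V_n)/\sqrt{\operatorname{Var}(V_n)}\Rightarrow N(0,1)$ as $n\to\infty$.
   Context: Notation: $t_k=k/n$; $\|Y\|_p=(E|Y|^p)^{1/p}$; $|\cdot|$ is the Euclidean norm; $\Rightarrow$ denotes weak convergence. Piecewise locally stationary model: there are a fixed integer $r\ge0$ and fixed points $0=d_0<d_1<\dots<d_r<d_{r+1}=1$ such that, for each $n$, $$X_k=\sum_{j=0}^rG_j(t_k,\mathcal F_k)\mathbf 1\{d_j<t_k\le d_{j+1}\},\qquad k=1,\dots,n,$$ where $\mathcal F_k=(\dots,\varepsilon_{k-1},\varepsilon_k)$, $(\varepsilon_k)_{k\in\mathbb Z}$ are i.i.d. random variables and $G_j:(d_j,d_{j+1}]\times\mathbb{R}^{\mathbb N}\to\mathbb{R}$ are measurable. Dependence measures: $\delta_X(k,p)=\max_{0\le l\le r}\sup_{t\in(d_l,d_{l+1}]}\|G_l(t,\mathcal F_0)-G_l(t,\mathcal F_{0,-k})\|_p$, where $\mathcal F_{0,-k}$ is $\mathcal F_0$ with $\varepsilon_{-k}$ replaced by $\varepsilon'_{-k}$,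 and $(\varepsilon'_j)$ is an independent i.i.d. copy of $(\varepsilon_j)$. Wiener ring: for $\eta\ge0$, $f:\mathbb{R}^2\to\mathbb{R}$ belongs to $W_0^\eta(\mathbb{R}^2)$ if there is $g\in L^1(\mathbb{R}^2)$, complex valued, with $f(x,y)=\int_{\mathbb{R}^2}g(t,s)e^{itx+isy}\,dt\,ds$ and $\int_{\mathbb{R}^2}|(t,s)|^{\eta}|g(t,s)|\,dt\,ds<\infty$. Definitions: $H_j(x)=E[H(x,X_j)]$ for non-random $x$; $N_n=\sum_{k=1}^n\sum_{j=1}^nW_n(t_k,t_j)\{H_j(X_k)-E[H_j(X_k)]\}$; $W_{j,\cdot}=\sum_{r=1}^n|W_n(t_j,t_r)|$ for $1\le j\le n$, $W_{j,\cdot}=0$ for $j>n$; $W^{(n)}=\sum_{j=1}^nW_{j,\cdot}^2$; $W_{(n)}=\sum_{k=1}^n\sum_{j=1}^nW_n^2(t_k,t_j)$. *)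

theory Defs
  imports "HOL-Probability.Probability"
begin

(* Extended-valued, so that finiteness of a norm is never lost to the convention that the
   integral of a non-integrable function is 0. *)
definition Lp_norm :: "'a measure \<Rightarrow> real \<Rightarrow> ('a \<Rightarrow> real) \<Rightarrow> ennreal" where
  "Lp_norm M p Y =
     (let I = (\<integral>\<^sup>+ \<omega>. ennreal (\<bar>Y \<omega>\<bar> powr p) \<partial>M)
      in if I = \<infinity> then \<infinity> else ennreal (enn2real I powr (1 / p)))"

(* Joint independence of all eps_i and eps'_i together makes eps' an i.i.d. copy of eps that is
   independent of eps. *)
definition iid_with_copy :: "'a measure \<Rightarrow> (int \<Rightarrow> 'a \<Rightarrow> real) \<Rightarrow> (int \<Rightarrow> 'a \<Rightarrow> real) \<Rightarrow> bool" where
  "iid_with_copy M eps eps' \<longleftrightarrow>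
     prob_space.indep_vars M (\<lambda>_. borel) (case_sum eps eps') (UNIV :: (int + int) set) \<and>
     (\<forall>i. distr M borel (eps i) = distr M borel (eps 0)) \<and>
     (\<forall>i. distr M borel (eps' i) = distr M borel (eps 0))"

(* The history up to time k as a point of R^N, most recent innovation first. *)
definition past :: "(int \<Rightarrow> 'a \<Rightarrow> real) \<Rightarrow> int \<Rightarrow> 'a \<Rightarrow> (nat \<Rightarrow> real)" where
  "past eps k \<omega> = (\<lambda>i. eps (k - int i) \<omega>)"

(* X n k is the k-th observation of the n-th row; it is constrained for 1 \<le> k \<le> n only. *)
definition piecewise_locally_stationary ::
  "'a measure \<Rightarrow> (int \<Rightarrow> 'a \<Rightarrow> real) \<Rightarrow> nat \<Rightarrow> (nat \<Rightarrow> real) \<Rightarrow>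
   (nat \<Rightarrow> real \<Rightarrow> (nat \<Rightarrow> real) \<Rightarrow> real) \<Rightarrow> (nat \<Rightarrow> nat \<Rightarrow> 'a \<Rightarrow> real) \<Rightarrow> bool" where
  "piecewise_locally_stationary M eps r d G X \<longleftrightarrow>
     d 0 = 0 \<and> d (Suc r) = 1 \<and> (\<forall>j\<le>r. d j < d (Suc j)) \<and>
     (\<forall>j\<le>r. (\<lambda>(t, x). G j t x) \<in>
        borel_measurable (restrict_space borel {d j<..d (Suc j)} \<Otimes>\<^sub>M (\<Pi>\<^sub>M i\<in>UNIV. borel))) \<and>
     (\<forall>n\<ge>1. \<forall>k\<in>{1..n}. \<forall>\<omega>\<in>space M.
        X n k \<omega> = (\<Sum>j=0..r. G j (real k / real n) (past eps (int k) \<omega>)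
                               * indicator {d j<..d (Suc j)} (real k / real n)))"

definition dep_measure ::
  "'a measure \<Rightarrow> (int \<Rightarrow> 'a \<Rightarrow> real) \<Rightarrow> (int \<Rightarrow> 'a \<Rightarrow> real) \<Rightarrow> nat \<Rightarrow> (nat \<Rightarrow> real) \<Rightarrow>
   (nat \<Rightarrow> real \<Rightarrow> (nat \<Rightarrow> real) \<Rightarrow> real) \<Rightarrow> nat \<Rightarrow> real \<Rightarrow> ennreal" where
  "dep_measure M eps eps' r d G k p =
     (MAX l\<in>{0..r}. SUP t\<in>{d l<..d (Suc l)}.
        Lp_norm M p (\<lambda>\<omega>. G l t (past eps 0 \<omega>)
                          - G l t (past (eps(- int k := eps' (- int k))) 0 \<omega>)))"

(* The norm on real \<times> real is the Euclidean one. *)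
definition wiener_ring :: "real \<Rightarrow> (real \<Rightarrow> real \<Rightarrow> real) set" where
  "wiener_ring \<eta> = {f. \<exists>g :: real \<times> real \<Rightarrow> complex.
     integrable lborel g \<and>
     (\<forall>x y. complex_of_real (f x y)
        = (\<integral>(t, s). g (t, s) * exp (\<i> * complex_of_real (t * x + s * y)) \<partial>lborel)) \<and>
     integrable lborel (\<lambda>z. norm z powr \<eta> * norm (g z))}"

definition V_stat ::
  "(nat \<Rightarrow> real \<Rightarrow> real \<Rightarrow> real) \<Rightarrow> (real \<Rightarrow> real \<Rightarrow> real) \<Rightarrow> (nat \<Rightarrow> nat \<Rightarrow> 'a \<Rightarrow> real) \<Rightarrow>
   nat \<Rightarrow> 'a \<Rightarrow> real" where
  "V_stat W H X n \<omega> =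
     (\<Sum>k=1..n. \<Sum>j=1..n. W n (real k / real n) (real j / real n) * H (X n k \<omega>) (X n j \<omega>))"

definition H_proj ::
  "'a measure \<Rightarrow> (real \<Rightarrow> real \<Rightarrow> real) \<Rightarrow> (nat \<Rightarrow> nat \<Rightarrow> 'a \<Rightarrow> real) \<Rightarrow> nat \<Rightarrow> nat \<Rightarrow> real \<Rightarrow> real" where
  "H_proj M H X n j x = (\<integral>\<omega>. H x (X n j \<omega>) \<partial>M)"

definition N_stat ::
  "'a measure \<Rightarrow> (nat \<Rightarrow> real \<Rightarrow> real \<Rightarrow> real) \<Rightarrow> (real \<Rightarrow> real \<Rightarrow> real) \<Rightarrow> (nat \<Rightarrow> nat \<Rightarrow> 'a \<Rightarrow> real) \<Rightarrow>
   nat \<Rightarrow> 'a \<Rightarrow> real" where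
  "N_stat M W H X n \<omega> =
     (\<Sum>k=1..n. \<Sum>j=1..n. W n (real k / real n) (real j / real n) *
        (H_proj M H X n j (X n k \<omega>) - (\<integral>\<omega>'. H_proj M H X n j (X n k \<omega>') \<partial>M)))"

definition W_row :: "(nat \<Rightarrow> real \<Rightarrow> real \<Rightarrow> real) \<Rightarrow> nat \<Rightarrow> nat \<Rightarrow> real" where
  "W_row W n j =
     (if 1 \<le> j \<and> j \<le> n then \<Sum>i=1..n. \<bar>W n (real j / real n) (real i / real n)\<bar> else 0)"

definition W_upper :: "(nat \<Rightarrow> real \<Rightarrow> real \<Rightarrow> real) \<Rightarrow> nat \<Rightarrow> real" where
  "W_upper W n = (\<Sum>j=1..n. (W_row W n j)\<^sup>2)"

definition W_lower :: "(nat \<Rightarrow> real \<Rightarrow> real \<Rightarrow> real) \<Rightarrow> nat \<Rightarrow> real" where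
  "W_lower W n = (\<Sum>k=1..n. \<Sum>j=1..n. (W n (real k / real n) (real j / real n))\<^sup>2)"

definition W_Delta ::
  "(nat \<Rightarrow> real \<Rightarrow> real \<Rightarrow> real) \<Rightarrow> (nat \<Rightarrow> real \<Rightarrow> real \<Rightarrow> real) \<Rightarrow> nat \<Rightarrow> real" where
  "W_Delta W f n =
     (\<Sum>k=1..n. \<Sum>j=1..n. \<bar>W n (real k / real n) (real j / real n)\<bar>
                           * f n (real k / real n) (real j / real n))"

definition big_block ::
  "(nat \<Rightarrow> real \<Rightarrow> real \<Rightarrow> real) \<Rightarrow> (nat \<Rightarrow> nat) \<Rightarrow> (nat \<Rightarrow> nat) \<Rightarrow> nat \<Rightarrow> nat \<Rightarrow> real" where
  "big_block W l m n j = (\<Sum>k=1..l n. (W_row W n ((l n + m n) * (j - 1) + k))\<^sup>2)"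

definition small_block ::
  "(nat \<Rightarrow> real \<Rightarrow> real \<Rightarrow> real) \<Rightarrow> (nat \<Rightarrow> nat) \<Rightarrow> (nat \<Rightarrow> nat) \<Rightarrow> nat \<Rightarrow> nat \<Rightarrow> real" where
  "small_block W l m n j = (\<Sum>k=l n + 1..l n + m n. (W_row W n ((l n + m n) * (j - 1) + k))\<^sup>2)"

definition num_blocks :: "(nat \<Rightarrow> nat) \<Rightarrow> (nat \<Rightarrow> nat) \<Rightarrow> nat \<Rightarrow> nat" where
  "num_blocks l m n = nat \<lceil>real n / real (l n + m n)\<rceil>"

end

theory Submission
  imports Defs
begin

text \<open>
Up to its mean, the statistic is twice the linear statistic N plus a centred quadratic form whose kernel
integrates to zero in each variable (V_decomposition). The variance of this quadratic form is at most of the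
order of the sum of the squared weights, which by assumption is negligible against the sum of the squared row
sums, and so against the variance of N. So N carries the limit law.

Everything rests on one coupling: replace all innovations up to a time a by their independent copies. The
variables after time a that arise in this way are independent of the process up to a, jointly have the law
of the original ones (splice_noise_law), and are close to them at a geometric rate in the distance from a
(ky_fan_mix_past). Hence the mean of a product of kernels hardly changes if the process is spliced in a gap
between the times involved (splice_error), and for the spliced process a degenerate kernel with an isolated
time integrates to zero, while kernels on either side of the gap are independent. This bounds all
covariances of degenerate kernels (cov_le), and a Schur test sums them up to the variance of the quadratic
form (Q_variance_le). Applied to products of two linear terms, the same estimate yields the fourth moments
of linear statistics.

Of the kernel H only two inequalities are used: it grows at most like a product of the weights 1 + |L|, and
its increments in one variable are bounded by a modulus (wiener_ring_holder, weighted_wiener_kernel) whose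
fourth moment is small for coupled variables (kernel_modulus_fourth_moment).

The linear statistic is cut into big blocks, separated by gaps whose length exceeds every multiple of log n.
By the coupling, the characteristic function of the sum over the big blocks nearly factors (chf_blocks), with
an error that a power of n cannot outweigh. Each factor is nearly Gaussian (chf_gaussian), the error being
controlled by the share of the largest block. The gaps contribute a negligible variance by assumption, so
that the variances of the blocks add up to the variance of the statistic (chf_error_le), and Levy's
continuity theorem concludes.
\<close>

section \<open>Functionals of a path and convergence in probability\<close>

abbreviation paths :: "('i \<Rightarrow> real) measure" where
  "paths \<equiv> PiM UNIV (\<lambda>_. borel)"

text \<open>A metric for convergence in probability. Unlike an L^p distance it needs no moments, and the
  process itself is not assumed to have any: the one-lag changes may have infinite norm for finitely
  many lags.\<close>

definition ky_fan :: "'a measure \<Rightarrow> ('a \<Rightarrow> real) \<Rightarrow> ('a \<Rightarrow> real) \<Rightarrow> real" where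
  "ky_fan M X Y = (\<integral>\<omega>. min 1 \<bar>X \<omega> - Y \<omega>\<bar> \<partial>M)"

context prob_space
begin

lemma integrable_min_1:
  assumes [measurable]: "X \<in> borel_measurable M" "Y \<in> borel_measurable M"
  shows "integrable M (\<lambda>\<omega>. min 1 \<bar>X \<omega> - Y \<omega>\<bar> :: real)"
  by (rule integrable_const_bound[where B = 1]) auto

lemma ky_fan_nonneg: "0 \<le> ky_fan M X Y"
  unfolding ky_fan_def by (rule integral_nonneg_AE) auto

lemma ky_fan_le_1:
  assumes [measurable]: "X \<in> borel_measurable M" "Y \<in> borel_measurable M"
  shows "ky_fan M X Y \<le> 1"
proof -
  have "ky_fan M X Y \<le> (\<integral>\<omega>. 1 \<partial>M)"
    unfolding ky_fan_def by (intro integral_mono integrable_min_1 assms) auto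
  then show ?thesis by (simp add: prob_space)
qed

lemma ky_fan_triangle:
  assumes "X \<in> borel_measurable M" "Y \<in> borel_measurable M" "Z \<in> borel_measurable M"
  shows "ky_fan M X Z \<le> ky_fan M X Y + ky_fan M Y Z"
proof -
  have "ky_fan M X Z \<le> (\<integral>\<omega>. min 1 \<bar>X \<omega> - Y \<omega>\<bar> + min 1 \<bar>Y \<omega> - Z \<omega>\<bar> \<partial>M)"
    unfolding ky_fan_def
    by (intro integral_mono Bochner_Integration.integrable_add integrable_min_1 assms) auto
  also have "\<dots> = ky_fan M X Y + ky_fan M Y Z"
    unfolding ky_fan_def by (intro Bochner_Integration.integral_add integrable_min_1 assms)
  finally show ?thesis .
qed

lemma ky_fan_commute: "ky_fan M X Y = ky_fan M Y X"
  unfolding ky_fan_def by (simp add: abs_minus_commute)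

lemma ky_fan_tendsto_0:
  assumes [measurable]: "\<And>n. F n \<in> borel_measurable M" "f \<in> borel_measurable M"
    and lim: "\<And>x. x \<in> space M \<Longrightarrow> (\<lambda>n. F n x) \<longlonglongrightarrow> f x"
  shows "(\<lambda>n. ky_fan M (F n) f) \<longlonglongrightarrow> 0"
proof -
  have "(\<lambda>n. \<integral>x. min 1 \<bar>F n x - f x\<bar> \<partial>M) \<longlonglongrightarrow> (\<integral>x. 0 \<partial>M)"
  proof (rule integral_dominated_convergence[where w = "\<lambda>_. 1"])
    show "AE x in M. (\<lambda>n. min 1 \<bar>F n x - f x\<bar>) \<longlonglongrightarrow> 0"
    proof (rule AE_I2)
      fix x assume "x \<in> space M"
      then have "(\<lambda>n. \<bar>F n x - f x\<bar>) \<longlonglongrightarrow> 0"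
        using lim tendsto_rabs_zero LIM_zero by blast
      then show "(\<lambda>n. min 1 \<bar>F n x - f x\<bar>) \<longlonglongrightarrow> 0"
        by (rule Lim_null_comparison[rotated]) auto
    qed
  qed auto
  then show ?thesis by (simp add: ky_fan_def)
qed

lemma ky_fan_distr:
  assumes [measurable]: "U \<in> measurable M N" "F \<in> borel_measurable N" "G \<in> borel_measurable N"
  shows "ky_fan (distr M N U) F G = ky_fan M (\<lambda>\<omega>. F (U \<omega>)) (\<lambda>\<omega>. G (U \<omega>))"
  unfolding ky_fan_def by (rule integral_distr) measurable

text \<open>The indicator of a cylinder set is eventually constant along the sequence. Since all paths have the
  same law, approximating a functional by simpler ones is equally good for every term of the sequence,
  so the functionals with this property are closed under pointwise limits.\<close>

lemma ky_fan_coordinatewise_limit: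
  fixes U :: "nat \<Rightarrow> 'a \<Rightarrow> 'i \<Rightarrow> real"
  assumes U[measurable]: "\<And>N. U N \<in> measurable M paths" and V[measurable]: "V \<in> measurable M paths"
    and law: "\<And>N. distr M paths (U N) = distr M paths V"
    and coord: "\<And>i. \<forall>\<^sub>F N in sequentially. \<forall>\<omega>. U N \<omega> i = V \<omega> i"
    and F: "F \<in> borel_measurable paths"
  shows "(\<lambda>N. ky_fan M (\<lambda>\<omega>. F (U N \<omega>)) (\<lambda>\<omega>. F (V \<omega>))) \<longlonglongrightarrow> 0"
proof -
  define D where "D F N = ky_fan M (\<lambda>\<omega>. F (U N \<omega>)) (\<lambda>\<omega>. F (V \<omega>))" for F N
  define Good where "Good F \<longleftrightarrow> F \<in> borel_measurable paths \<and> D F \<longlonglongrightarrow> 0" for F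
  interpret Q: prob_space "distr M paths V" by (rule prob_space_distr) simp
  \<comment> \<open>Truncation at 1 costs no more than an additional unit in the Lipschitz constant.\<close>
  have Good_lip: "Good (\<lambda>x. \<phi> (F x) (G x))"
    if FG: "Good F" "Good G" and m: "(\<lambda>x. \<phi> (F x) (G x)) \<in> borel_measurable paths" and c: "c \<ge> 0"
      and lip: "\<And>a b a' b'. \<bar>\<phi> a b - \<phi> a' b'\<bar> \<le> c * (\<bar>a - a'\<bar> + \<bar>b - b'\<bar>)" for F G \<phi> c
  proof -
    have [measurable]: "F \<in> borel_measurable paths" "G \<in> borel_measurable paths"
      using FG by (auto simp: Good_def)
    note [measurable] = m
    have le: "D (\<lambda>x. \<phi> (F x) (G x)) N \<le> (1 + c) * (D F N + D G N)" for N
    proof -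
      have pt: "min 1 \<bar>\<phi> a b - \<phi> a' b'\<bar> \<le> (1 + c) * (min 1 \<bar>a - a'\<bar> + min 1 \<bar>b - b'\<bar>)" for a b a' b'
      proof (cases "\<bar>a - a'\<bar> \<le> 1 \<and> \<bar>b - b'\<bar> \<le> 1")
        case True
        then have "min 1 \<bar>\<phi> a b - \<phi> a' b'\<bar> \<le> c * (min 1 \<bar>a - a'\<bar> + min 1 \<bar>b - b'\<bar>)"
          using lip[of a b a' b'] by auto
        also have "\<dots> \<le> (1 + c) * (min 1 \<bar>a - a'\<bar> + min 1 \<bar>b - b'\<bar>)"
          by (intro mult_right_mono) auto
        finally show ?thesis .
      next
        case False
        then have "1 \<le> min 1 \<bar>a - a'\<bar> + min 1 \<bar>b - b'\<bar>" by auto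
        then have "1 * 1 \<le> (1 + c) * (min 1 \<bar>a - a'\<bar> + min 1 \<bar>b - b'\<bar>)"
          using c by (intro mult_mono) auto
        then show ?thesis by (intro order_trans[OF min.cobounded1]) simp
      qed
      have "D (\<lambda>x. \<phi> (F x) (G x)) N
          \<le> (\<integral>\<omega>. (1 + c) * (min 1 \<bar>F (U N \<omega>) - F (V \<omega>)\<bar> + min 1 \<bar>G (U N \<omega>) - G (V \<omega>)\<bar>) \<partial>M)"
        unfolding D_def ky_fan_def
        by (intro integral_mono integrable_min_1 integrable_mult_right
             Bochner_Integration.integrable_add pt) measurable
      also have "\<dots> = (1 + c) * (D F N + D G N)"
        unfolding D_def ky_fan_def
        by (subst integral_mult_right_zero, subst Bochner_Integration.integral_add)
           (auto intro!: integrable_min_1)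
      finally show ?thesis .
    qed
    have "(\<lambda>N. (1 + c) * (D F N + D G N)) \<longlonglongrightarrow> (1 + c) * (0 + 0)"
      using FG unfolding Good_def by (intro tendsto_intros) auto
    then have "(\<lambda>N. (1 + c) * (D F N + D G N)) \<longlonglongrightarrow> 0" by simp
    moreover have "norm (D (\<lambda>x. \<phi> (F x) (G x)) N) \<le> (1 + c) * (D F N + D G N)" for N
      using le[of N] by (simp add: D_def ky_fan_nonneg)
    ultimately have "D (\<lambda>x. \<phi> (F x) (G x)) \<longlonglongrightarrow> 0"
      by (rule Lim_null_comparison[OF always_eventually[OF allI], rotated])
    with m show ?thesis by (simp add: Good_def)
  qed
  have Good_lim: "Good f"
    if Gd: "\<And>i. Good (Fs i)" and m: "f \<in> borel_measurable paths"
      and lim: "\<And>x. (\<lambda>i. Fs i x) \<longlonglongrightarrow> f x" for Fs f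
  proof -
    have [measurable]: "Fs i \<in> borel_measurable paths" for i using Gd by (auto simp: Good_def)
    note [measurable] = m
    \<comment> \<open>The approximation error is a distance under the common law, hence independent of N.\<close>
    have e: "(\<lambda>i. ky_fan (distr M paths V) (Fs i) f) \<longlonglongrightarrow> 0"
      by (rule Q.ky_fan_tendsto_0) (auto simp: lim)
    have "D f \<longlonglongrightarrow> 0"
    proof (rule LIMSEQ_I)
      fix r :: real assume "r > 0"
      then have "r / 3 > 0" by simp
      from LIMSEQ_D[OF e this] obtain i where "norm (ky_fan (distr M paths V) (Fs i) f - 0) < r / 3"
        by blast
      then have i: "ky_fan (distr M paths V) (Fs i) f < r / 3" by simp
      have "D (Fs i) \<longlonglongrightarrow> 0" using Gd by (auto simp: Good_def)
      from LIMSEQ_D[OF this, of "r/3"] \<open>r > 0\<close>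
      obtain N0 where N0: "\<And>N. N \<ge> N0 \<Longrightarrow> \<bar>D (Fs i) N\<bar> < r/3" by auto
      have "norm (D f N - 0) < r" if "N \<ge> N0" for N
      proof -
        have 1: "ky_fan M (\<lambda>\<omega>. f (U N \<omega>)) (\<lambda>\<omega>. Fs i (U N \<omega>)) = ky_fan (distr M paths V) (Fs i) f"
          by (subst law[of N, symmetric], subst ky_fan_distr) (auto intro: ky_fan_commute)
        have 2: "ky_fan M (\<lambda>\<omega>. Fs i (V \<omega>)) (\<lambda>\<omega>. f (V \<omega>)) = ky_fan (distr M paths V) (Fs i) f"
          by (subst ky_fan_distr) auto
        have "D f N \<le> ky_fan M (\<lambda>\<omega>. f (U N \<omega>)) (\<lambda>\<omega>. Fs i (U N \<omega>))
            + ky_fan M (\<lambda>\<omega>. Fs i (U N \<omega>)) (\<lambda>\<omega>. f (V \<omega>))"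
          unfolding D_def by (rule ky_fan_triangle) measurable
        also have "ky_fan M (\<lambda>\<omega>. Fs i (U N \<omega>)) (\<lambda>\<omega>. f (V \<omega>))
           \<le> D (Fs i) N + ky_fan M (\<lambda>\<omega>. Fs i (V \<omega>)) (\<lambda>\<omega>. f (V \<omega>))"
          unfolding D_def by (rule ky_fan_triangle) measurable
        finally have "D f N < r" using 1 2 i N0[OF that] by auto
        then show ?thesis using ky_fan_nonneg by (simp add: D_def)
      qed
      then show "\<exists>no. \<forall>n\<ge>no. norm (D f n - 0) < r" by blast
    qed
    with m show ?thesis by (simp add: Good_def)
  qed
  have Good_const: "Good (\<lambda>_. c)" for c by (simp add: Good_def D_def[abs_def] ky_fan_def)
  have ind: "Good (indicator A)" if "A \<in> sets paths" for A :: "('i \<Rightarrow> real) set"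
  proof -
    from that have "A \<in> sigma_sets UNIV {{f. f i \<in> B} | i B. B \<in> sets (borel :: real measure)}"
      by (simp add: sets_PiM_single)
    then show ?thesis
    proof (induction A rule: sigma_sets.induct)
      case (Basic A)
      then obtain i B where A: "A = {f. f i \<in> B}" and B[measurable]: "B \<in> sets (borel :: real measure)" by auto
      have "{f. f i \<in> B} = (\<lambda>f. f i) -` B \<inter> space (paths :: ('i \<Rightarrow> real) measure)"
        by (auto simp: space_PiM)
      also have "\<dots> \<in> sets paths" by measurable
      finally have "A \<in> sets paths" using A by simp
      moreover have "\<forall>\<^sub>F N in sequentially. D (indicator A) N = 0"
        using coord[of i] by eventually_elim (simp add: D_def ky_fan_def A indicator_def)
      ultimately show ?case
        by (auto simp: Good_def intro: tendsto_eventually)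
    next
      case Empty
      show ?case using Good_const[of 0] by (simp add: indicator_def[abs_def] of_bool_def)
    next
      case (Compl A)
      have "(\<lambda>x. 1 - indicator A x :: real) = indicator (UNIV - A)"
        by (auto simp: indicator_def)
      moreover have "Good (\<lambda>x. 1 - indicator A x)"
        using Compl.IH
        by (intro Good_lip[of "indicator A" "indicator A" "\<lambda>a b. 1 - a" 1])
           (auto simp: Good_def)
      ultimately show ?case by simp
    next
      case (Union A)
      have fin: "Good (indicator (\<Union>i<n. A i))" for n
      proof (induction n)
        case 0
        show ?case using Good_const[of 0] by (simp add: indicator_def[abs_def] of_bool_def)
      next
        case (Suc n)
        have "(indicator (\<Union>i<Suc n. A i) :: _ \<Rightarrow> real)
           = (\<lambda>x. max (indicator (\<Union>i<n. A i) x) (indicator (A n) x))"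
          by (auto simp: indicator_def fun_eq_iff less_Suc_eq)
        moreover have "Good (\<lambda>x. max (indicator (\<Union>i<n. A i) x) (indicator (A n) x :: real))"
        proof (rule Good_lip[of "indicator (\<Union>i<n. A i)" "indicator (A n)" max 1, OF Suc Union.IH])
          show "(\<lambda>x. max (indicator (\<Union>i<n. A i) x) (indicator (A n) x :: real)) \<in> borel_measurable paths"
            using Suc Union.IH[of n] unfolding Good_def by (intro borel_measurable_max) auto
        qed auto
        ultimately show ?case by simp
      qed
      have lim: "(\<lambda>n. indicator (\<Union>i<n. A i) x :: real) \<longlonglongrightarrow> indicator (\<Union>i. A i) x" for x
        by (rule LIMSEQ_indicator_UN)
      have "(\<lambda>x. indicator (\<Union>i. A i) x :: real) \<in> borel_measurable paths"
        by (rule borel_measurable_LIMSEQ_real[OF lim]) (use fin in \<open>auto simp: Good_def\<close>)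
      then show ?case by (intro Good_lim[OF fin _ lim]) simp
    qed
  qed
  have nonneg: "Good G" if "G \<in> borel_measurable paths" "\<And>x. 0 \<le> G x" for G :: "('i \<Rightarrow> real) \<Rightarrow> real"
    using that
  proof (induction G rule: borel_measurable_induct_real)
    case (set A) then show ?case by (rule ind)
  next
    case (mult u c)
    then show ?case
      by (intro Good_lip[of u u "\<lambda>a b. c * a" c])
         (auto simp flip: right_diff_distrib simp: abs_mult intro!: mult_left_mono)
  next
    case (add u v)
    then show ?case
      by (intro Good_lip[of v u "\<lambda>a b. a + b" 1]) auto
  next
    case (seq U)
    have m: "u' \<in> borel_measurable paths" if "\<And>x. (\<lambda>i. U i x) \<longlonglongrightarrow> u' x" for u'
      by (rule borel_measurable_LIMSEQ_real[OF that seq(1)])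
    show ?case
      by (rule Good_lim[of U]) (use seq m in \<open>auto simp: space_PiM\<close>)
  qed
  have 1: "Good (\<lambda>x. max 0 (F x))" "Good (\<lambda>x. max 0 (- F x))"
    using F by (auto intro!: nonneg)
  have "Good (\<lambda>x. max 0 (F x) - max 0 (- F x))"
    by (rule Good_lip[OF 1, of "\<lambda>a b. a - b" 1]) (use F in auto)
  moreover have "(\<lambda>x. max 0 (F x) - max 0 (- F x)) = F" by (auto simp: fun_eq_iff max_def)
  ultimately show ?thesis by (simp add: Good_def D_def[abs_def])
qed

end

section \<open>Replacing innovations by independent copies\<close>

definition mix :: "(int \<Rightarrow> 'a \<Rightarrow> real) \<Rightarrow> (int \<Rightarrow> 'a \<Rightarrow> real) \<Rightarrow> int set \<Rightarrow> int \<Rightarrow> 'a \<Rightarrow> real" where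
  "mix eps eps' S i = (if i \<in> S then eps' i else eps i)"

locale iid_copies = prob_space M for M :: "'a measure" +
  fixes eps eps' :: "int \<Rightarrow> 'a \<Rightarrow> real"
  assumes iid: "iid_with_copy M eps eps'"
begin

abbreviation "noise \<equiv> case_sum eps eps'"

lemma noise_indep: "indep_vars (\<lambda>_. borel) noise UNIV"
  using iid by (simp add: iid_with_copy_def)

lemma noise_measurable [measurable]: "noise i \<in> borel_measurable M"
  using noise_indep by (simp add: indep_vars_def)

lemma eps_measurable [measurable]: "eps i \<in> borel_measurable M" "eps' i \<in> borel_measurable M"
  using noise_measurable[of "Inl i"] noise_measurable[of "Inr i"] by auto

lemma noise_law: "distr M borel (noise i) = distr M borel (eps 0)"
  using iid by (cases i) (auto simp: iid_with_copy_def)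

text \<open>Originals and copies together are i.i.d., so only the injectivity of the selection matters. Hence
  every mixture of innovations and copies drives a version of the same process.\<close>

lemma noise_reindex_law:
  fixes \<pi> :: "'j \<Rightarrow> int + int"
  assumes "inj \<pi>"
  shows "distr M paths (\<lambda>\<omega> j. noise (\<pi> j) \<omega>) = PiM UNIV (\<lambda>_. distr M borel (eps 0))"
proof -
  let ?\<nu> = "distr M borel (eps 0)"
  have P: "distr M paths (\<lambda>\<omega> i. noise i \<omega>) = PiM UNIV (\<lambda>_. ?\<nu>)"
    using indep_vars_iff_distr_eq_PiM'[of UNIV noise "\<lambda>_. borel"] noise_indep
    by (simp add: noise_law restrict_UNIV)
  have "distr M paths (\<lambda>\<omega> j. noise (\<pi> j) \<omega>)
      = distr (distr M paths (\<lambda>\<omega> i. noise i \<omega>)) paths (\<lambda>x j. x (\<pi> j))"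
    by (subst distr_distr) (auto simp: comp_def intro!: measurable_PiM_single')
  also have "\<dots> = distr (PiM UNIV (\<lambda>_. ?\<nu>)) (PiM UNIV (\<lambda>_. ?\<nu>)) (\<lambda>x. \<lambda>j\<in>UNIV. x (\<pi> j))"
    unfolding P by (intro distr_cong sets_PiM_cong) (auto simp: restrict_UNIV)
  also have "\<dots> = PiM UNIV (\<lambda>_. ?\<nu>)"
    using distr_PiM_reindex[of UNIV "\<lambda>_. ?\<nu>" \<pi> UNIV] assms prob_space_distr[OF eps_measurable(1)[of 0]]
    by auto
  finally show ?thesis .
qed

lemma integral_noise_reindex:
  fixes \<pi> :: "'j \<Rightarrow> int + int" and f :: "('j \<Rightarrow> real) \<Rightarrow> real"
  assumes "inj \<pi>" "inj \<sigma>" and [measurable]: "f \<in> borel_measurable paths"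
  shows "(\<integral>\<omega>. f (\<lambda>j. noise (\<pi> j) \<omega>) \<partial>M) = (\<integral>\<omega>. f (\<lambda>j. noise (\<sigma> j) \<omega>) \<partial>M)"
proof -
  have "(\<integral>\<omega>. f (\<lambda>j. noise (\<pi> j) \<omega>) \<partial>M) = (\<integral>x. f x \<partial>distr M paths (\<lambda>\<omega> j. noise (\<pi> j) \<omega>))" for \<pi> :: "'j \<Rightarrow> int + int"
    by (subst integral_distr) (auto intro!: measurable_PiM_single')
  then show ?thesis by (simp add: noise_reindex_law assms)
qed

lemma mix_eq_noise: "mix eps eps' S i = noise (if i \<in> S then Inr i else Inl i)"
  by (simp add: mix_def)

lemma mix_measurable [measurable]: "(\<lambda>\<omega> i. mix eps eps' S i \<omega>) \<in> measurable M paths"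
  by (auto intro!: measurable_PiM_single' simp: mix_eq_noise)

lemma mix_law: "distr M paths (\<lambda>\<omega> i. mix eps eps' S i \<omega>) = distr M paths (\<lambda>\<omega> i. eps i \<omega>)"
proof -
  have "inj (\<lambda>i. if i \<in> S then Inr i else Inl i :: int + int)" by (auto simp: inj_def split: if_splits)
  from noise_reindex_law[OF this] noise_reindex_law[of Inl] show ?thesis by (simp add: mix_eq_noise)
qed

lemma past_eq: "past e k \<omega> = (\<lambda>x i. x (k - int i)) (\<lambda>i. e i \<omega>)"
  by (simp add: past_def)

lemma shift_measurable [measurable]: "(\<lambda>x i. x (k - int i)) \<in> measurable paths paths"
  by (auto intro!: measurable_PiM_single')

lemma past_mix_measurable [measurable]: "(\<lambda>\<omega>. past (mix eps eps' S) k \<omega>) \<in> measurable M paths"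
  unfolding past_eq by measurable

text \<open>By stationarity, replacing one innovation changes a functional of the past by an amount whose law
  depends only on the lag of the replaced innovation, and not on which of the others have been replaced
  before.\<close>

lemma ky_fan_mix_insert:
  fixes F :: "(nat \<Rightarrow> real) \<Rightarrow> real"
  assumes "i \<notin> S" and [measurable]: "F \<in> borel_measurable paths"
  shows "ky_fan M (\<lambda>\<omega>. F (past (mix eps eps' S) k \<omega>)) (\<lambda>\<omega>. F (past (mix eps eps' (insert i S)) k \<omega>))
       = ky_fan M (\<lambda>\<omega>. F (past eps 0 \<omega>)) (\<lambda>\<omega>. F (past (eps(i - k := eps' (i - k))) 0 \<omega>))"
proof -
  define f where "f x = min 1 \<bar>F (\<lambda>n. x (Inl (- int n)))
     - F (\<lambda>n. if - int n = i - k then x (Inr (i - k)) else x (Inl (- int n)))\<bar>" for x :: "int + int \<Rightarrow> real"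
  have [measurable]: "(\<lambda>x n. x (Inl (- int n))) \<in> measurable (paths :: (int + int \<Rightarrow> real) measure) paths"
    "(\<lambda>x n. if - int n = i - k then x (Inr (i - k)) else x (Inl (- int n))) \<in> measurable (paths :: (int + int \<Rightarrow> real) measure) paths"
    by (auto intro!: measurable_PiM_single')
  have f: "f \<in> borel_measurable paths" unfolding f_def by measurable
  \<comment> \<open>Shift time by k, and exchange the original and the copy at the times in S.\<close>
  define \<pi> :: "int + int \<Rightarrow> int + int" where "\<pi> = (\<lambda>q. case q of
     Inl j \<Rightarrow> (if j + k \<in> S then Inr (j + k) else Inl (j + k))
   | Inr j \<Rightarrow> (if j + k \<in> S then Inl (j + k) else Inr (j + k)))"
  have inj: "inj \<pi>"
    by (auto simp: inj_def \<pi>_def split: sum.splits if_splits)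
  have 1: "f (\<lambda>j. noise (\<pi> j) \<omega>) = min 1 \<bar>F (past (mix eps eps' S) k \<omega>) - F (past (mix eps eps' (insert i S)) k \<omega>)\<bar>" for \<omega>
  proof -
    have "(\<lambda>n. noise (\<pi> (Inl (- int n))) \<omega>) = past (mix eps eps' S) k \<omega>"
      by (auto simp: past_def \<pi>_def mix_def fun_eq_iff algebra_simps)
    moreover have "(\<lambda>n. if - int n = i - k then noise (\<pi> (Inr (i - k))) \<omega> else noise (\<pi> (Inl (- int n))) \<omega>)
        = past (mix eps eps' (insert i S)) k \<omega>"
    proof
      fix n
      have "- int n + k = k - int n" by simp
      moreover have "(- int n = i - k) = (k - int n = i)" by auto
      ultimately show "(if - int n = i - k then noise (\<pi> (Inr (i - k))) \<omega> else noise (\<pi> (Inl (- int n))) \<omega>)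
        = past (mix eps eps' (insert i S)) k \<omega> n"
        using \<open>i \<notin> S\<close> by (auto simp: past_def \<pi>_def mix_def)
    qed
    ultimately show ?thesis by (simp add: f_def)
  qed
  have 2: "f (\<lambda>j. noise (id j) \<omega>) = min 1 \<bar>F (past eps 0 \<omega>) - F (past (eps(i - k := eps' (i - k))) 0 \<omega>)\<bar>" for \<omega>
  proof -
    have "(\<lambda>n. if - int n = i - k then noise (Inr (i - k)) \<omega> else noise (Inl (- int n)) \<omega>)
        = past (eps(i - k := eps' (i - k))) 0 \<omega>"
      by (auto simp: past_def fun_eq_iff)
    then show ?thesis by (simp add: f_def past_def)
  qed
  show ?thesis
    unfolding ky_fan_def 1[symmetric] 2[symmetric]
    by (rule integral_noise_reindex[OF inj inj_on_id f])
qed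

text \<open>Replacing the innovations at times a, a-1, ... one after the other costs a geometric series.
  Finitely many replacements never exhaust the past; the remaining ones are negligible because the path
  with finitely many replacements converges coordinatewise to the one with all of them.\<close>

lemma ky_fan_mix_past:
  fixes F :: "(nat \<Rightarrow> real) \<Rightarrow> real"
  assumes F[measurable]: "F \<in> borel_measurable paths"
    and B: "\<And>i. ky_fan M (\<lambda>\<omega>. F (past eps 0 \<omega>)) (\<lambda>\<omega>. F (past (eps(- int i := eps' (- int i))) 0 \<omega>)) \<le> B * r ^ i"
    and r: "0 < r" "r < 1" and B0: "0 \<le> B"
  shows "ky_fan M (\<lambda>\<omega>. F (past eps (a + int g) \<omega>)) (\<lambda>\<omega>. F (past (mix eps eps' {..a}) (a + int g) \<omega>))
     \<le> B / (1 - r) * r ^ g"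
proof -
  let ?k = "a + int g"
  let ?m = "mix eps eps'"
  define S where "S N = {a - int N<..a}" for N :: nat
  have [measurable]: "past eps k \<in> measurable M paths" for k
    using past_mix_measurable[of "{}" k] by (simp add: mix_def[abs_def])
  have [measurable]: "past (?m S) k \<in> measurable M paths" for S k
    using past_mix_measurable[of S k] by simp
  have fin: "ky_fan M (\<lambda>\<omega>. F (past eps ?k \<omega>)) (\<lambda>\<omega>. F (past (?m (S N)) ?k \<omega>))
      \<le> (\<Sum>n<N. B * r ^ (g + n))" for N
  proof (induction N)
    case 0
    have "?m (S 0) = eps" by (auto simp: S_def mix_def fun_eq_iff)
    then show ?case by (simp add: ky_fan_def)
  next
    case (Suc N)
    have S: "S (Suc N) = insert (a - int N) (S N)" "a - int N \<notin> S N" by (auto simp: S_def)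
    have "ky_fan M (\<lambda>\<omega>. F (past (?m (S N)) ?k \<omega>)) (\<lambda>\<omega>. F (past (?m (S (Suc N))) ?k \<omega>))
       = ky_fan M (\<lambda>\<omega>. F (past eps 0 \<omega>)) (\<lambda>\<omega>. F (past (eps(- int (g + N) := eps' (- int (g + N)))) 0 \<omega>))"
      unfolding S(1) by (subst ky_fan_mix_insert[OF S(2) F]) (simp add: algebra_simps)
    also have "\<dots> \<le> B * r ^ (g + N)" by (rule B)
    finally show ?case
      using Suc ky_fan_triangle[of "\<lambda>\<omega>. F (past eps ?k \<omega>)" "\<lambda>\<omega>. F (past (?m (S N)) ?k \<omega>)" "\<lambda>\<omega>. F (past (?m (S (Suc N))) ?k \<omega>)"]
      by simp
  qed
  have geo: "(\<Sum>n<N. B * r ^ (g + n)) \<le> B / (1 - r) * r ^ g" for N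
  proof -
    have "(\<Sum>n<N. r ^ n) \<le> (\<Sum>n. r ^ n)"
      using r by (intro sum_le_suminf summable_geometric) auto
    also have "\<dots> = 1 / (1 - r)" using r by (intro suminf_geometric) auto
    finally have "B * r ^ g * (\<Sum>n<N. r ^ n) \<le> B * r ^ g * (1 / (1 - r))"
      using B0 r by (intro mult_left_mono) auto
    then show ?thesis by (simp add: sum_distrib_left power_add mult.assoc)
  qed
  have lim: "(\<lambda>N. ky_fan M (\<lambda>\<omega>. F (past (?m (S N)) ?k \<omega>)) (\<lambda>\<omega>. F (past (?m {..a}) ?k \<omega>))) \<longlonglongrightarrow> 0"
  proof -
    have m: "(\<lambda>x. F (\<lambda>i. x (?k - int i))) \<in> borel_measurable paths"
      by (rule measurable_compose[OF shift_measurable F])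
    have "\<forall>\<^sub>F N in sequentially. \<forall>\<omega>. ?m (S N) i \<omega> = ?m {..a} i \<omega>" for i
      using eventually_gt_at_top[of "nat (a - i)"]
      by eventually_elim (auto simp: mix_def S_def)
    from ky_fan_coordinatewise_limit[OF mix_measurable mix_measurable _ this m]
    have "(\<lambda>N. ky_fan M (\<lambda>\<omega>. F (\<lambda>i. ?m (S N) (?k - int i) \<omega>)) (\<lambda>\<omega>. F (\<lambda>i. ?m {..a} (?k - int i) \<omega>))) \<longlonglongrightarrow> 0"
      by (simp add: mix_law)
    then show ?thesis by (simp add: past_def)
  qed
  have "ky_fan M (\<lambda>\<omega>. F (past eps ?k \<omega>)) (\<lambda>\<omega>. F (past (?m {..a}) ?k \<omega>)) \<le> B / (1 - r) * r ^ g + 0"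
  proof (rule LIMSEQ_le_const[OF tendsto_add[OF tendsto_const lim]])
    show "\<exists>N. \<forall>n\<ge>N. ky_fan M (\<lambda>\<omega>. F (past eps ?k \<omega>)) (\<lambda>\<omega>. F (past (?m {..a}) ?k \<omega>))
       \<le> B / (1 - r) * r ^ g + ky_fan M (\<lambda>\<omega>. F (past (?m (S n)) ?k \<omega>)) (\<lambda>\<omega>. F (past (?m {..a}) ?k \<omega>))"
    proof (intro exI allI impI)
      fix N
      have "ky_fan M (\<lambda>\<omega>. F (past eps ?k \<omega>)) (\<lambda>\<omega>. F (past (?m {..a}) ?k \<omega>))
        \<le> ky_fan M (\<lambda>\<omega>. F (past eps ?k \<omega>)) (\<lambda>\<omega>. F (past (?m (S N)) ?k \<omega>))
         + ky_fan M (\<lambda>\<omega>. F (past (?m (S N)) ?k \<omega>)) (\<lambda>\<omega>. F (past (?m {..a}) ?k \<omega>))"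
        by (rule ky_fan_triangle) measurable
      then show "ky_fan M (\<lambda>\<omega>. F (past eps ?k \<omega>)) (\<lambda>\<omega>. F (past (?m {..a}) ?k \<omega>))
       \<le> B / (1 - r) * r ^ g + ky_fan M (\<lambda>\<omega>. F (past (?m (S N)) ?k \<omega>)) (\<lambda>\<omega>. F (past (?m {..a}) ?k \<omega>))"
        using fin[of N] geo[of N] by linarith
    qed
  qed
  then show ?thesis by simp
qed

text \<open>The history up to time a, and the path whose innovations up to a have been replaced, are built from
  disjoint sets of noise variables.\<close>

lemma splice_noise_law:
  fixes \<Phi> :: "(int \<Rightarrow> real) \<times> (int \<Rightarrow> real) \<Rightarrow> 'b \<Rightarrow> real"
  assumes \<Phi>: "\<Phi> \<in> measurable (paths \<Otimes>\<^sub>M paths) paths"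
    and dep: "\<And>x x' y. (\<And>i. i \<le> a \<Longrightarrow> x i = x' i) \<Longrightarrow> \<Phi> (x, y) = \<Phi> (x', y)"
  shows "distr M paths (\<lambda>\<omega>. \<Phi> (\<lambda>i. eps i \<omega>, \<lambda>i. mix eps eps' {..a} i \<omega>))
     = distr (M \<Otimes>\<^sub>M M) paths (\<lambda>(\<omega>, \<omega>'). \<Phi> (\<lambda>i. eps i \<omega>, \<lambda>i. eps i \<omega>'))"
proof -
  let ?P = "paths :: (int \<Rightarrow> real) measure"
  let ?m = "\<lambda>\<omega> i. mix eps eps' {..a} i \<omega>" and ?e = "\<lambda>\<omega> i. eps i \<omega>"
  \<comment> \<open>The history up to a, made a total function by a default value that the functional ignores.\<close>
  let ?c = "\<lambda>\<omega> i. if i \<le> a then eps i \<omega> else 0"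
  note \<Phi>[measurable]
  have [measurable]: "?e \<in> measurable M ?P" "?c \<in> measurable M ?P"
    by (auto intro!: measurable_PiM_single')
  let ?A = "Inl ` {..a} :: (int + int) set" and ?B = "Inl ` {a<..} \<union> Inr ` {..a} :: (int + int) set"
  have "indep_var (PiM ?A (\<lambda>_. borel)) (\<lambda>\<omega>. restrict (\<lambda>i. noise i \<omega>) ?A)
                  (PiM ?B (\<lambda>_. borel)) (\<lambda>\<omega>. restrict (\<lambda>i. noise i \<omega>) ?B)"
    by (rule indep_var_restrict[OF noise_indep]) auto
  then have "indep_var ?P ((\<lambda>x i. if i \<le> a then x (Inl i) else 0) \<circ> (\<lambda>\<omega>. restrict (\<lambda>i. noise i \<omega>) ?A))
     ?P ((\<lambda>x i. if i \<le> a then x (Inr i) else x (Inl i)) \<circ> (\<lambda>\<omega>. restrict (\<lambda>i. noise i \<omega>) ?B))"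
  proof (rule indep_var_compose)
    show "(\<lambda>x i. if i \<le> a then x (Inl i) else 0) \<in> measurable (PiM ?A (\<lambda>_. borel)) ?P"
    proof (rule measurable_PiM_single')
      fix i :: int
      show "(\<lambda>x. if i \<le> a then x (Inl i) else 0 :: real) \<in> borel_measurable (PiM ?A (\<lambda>_. borel))"
        by (cases "i \<le> a") auto
    qed auto
    show "(\<lambda>x i. if i \<le> a then x (Inr i) else x (Inl i)) \<in> measurable (PiM ?B (\<lambda>_. borel)) ?P"
    proof (rule measurable_PiM_single')
      fix i :: int
      show "(\<lambda>x. if i \<le> a then x (Inr i) else x (Inl i) :: real) \<in> borel_measurable (PiM ?B (\<lambda>_. borel))"
        by (cases "i \<le> a") auto
    qed auto
  qed
  also have "(\<lambda>x i. if i \<le> a then x (Inl i) else 0) \<circ> (\<lambda>\<omega>. restrict (\<lambda>i. noise i \<omega>) ?A) = ?c"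
    by (auto simp: fun_eq_iff)
  also have "(\<lambda>x i. if i \<le> a then x (Inr i) else x (Inl i)) \<circ> (\<lambda>\<omega>. restrict (\<lambda>i. noise i \<omega>) ?B) = ?m"
    by (auto simp: fun_eq_iff mix_def)
  finally have ind: "distr M ?P ?c \<Otimes>\<^sub>M distr M ?P ?m = distr M (?P \<Otimes>\<^sub>M ?P) (\<lambda>\<omega>. (?c \<omega>, ?m \<omega>))"
    by (simp add: indep_var_distribution_eq)
  have "distr M paths (\<lambda>\<omega>. \<Phi> (?e \<omega>, ?m \<omega>)) = distr M paths (\<lambda>\<omega>. \<Phi> (?c \<omega>, ?m \<omega>))"
    by (intro distr_cong refl dep) auto
  also have "\<dots> = distr (distr M (?P \<Otimes>\<^sub>M ?P) (\<lambda>\<omega>. (?c \<omega>, ?m \<omega>))) paths \<Phi>"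
    by (subst distr_distr) (auto simp: comp_def)
  also have "\<dots> = distr (distr M ?P ?c \<Otimes>\<^sub>M distr M ?P ?e) paths \<Phi>"
    by (simp add: ind[symmetric] mix_law)
  also have "distr M ?P ?c \<Otimes>\<^sub>M distr M ?P ?e = distr (M \<Otimes>\<^sub>M M) (?P \<Otimes>\<^sub>M ?P) (\<lambda>(\<omega>, \<omega>'). (?c \<omega>, ?e \<omega>'))"
  proof (rule pair_measure_distr)
    interpret D: prob_space "distr M ?P ?e" by (rule prob_space_distr) simp
    show "sigma_finite_measure (distr M ?P ?e)" ..
  qed auto
  also have "distr \<dots> paths \<Phi> = distr (M \<Otimes>\<^sub>M M) paths (\<lambda>(\<omega>, \<omega>'). \<Phi> (?c \<omega>, ?e \<omega>'))"
    by (subst distr_distr) (auto simp: comp_def split_def)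
  also have "\<dots> = distr (M \<Otimes>\<^sub>M M) paths (\<lambda>(\<omega>, \<omega>'). \<Phi> (?e \<omega>, ?e \<omega>'))"
    by (intro distr_cong refl) (auto intro!: dep)
  finally show ?thesis .
qed

end

section \<open>Kernels in the weighted Wiener ring\<close>

lemma norm_iexp_diff_le:
  fixes u v :: real
  shows "norm (iexp u - iexp v) \<le> min 2 \<bar>u - v\<bar>"
proof -
  have "exp (\<i> * complex_of_real u) - exp (\<i> * complex_of_real v)
      = exp (\<i> * complex_of_real v) * (exp (\<i> * complex_of_real (u - v)) - 1)"
    by (simp add: algebra_simps flip: exp_add)
  then have 1: "norm (exp (\<i> * complex_of_real u) - exp (\<i> * complex_of_real v)) = norm (exp (\<i> * complex_of_real (u - v)) - 1)"
    by (simp add: norm_mult)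
  have "norm (exp (\<i> * complex_of_real u) - exp (\<i> * complex_of_real v)) \<le> norm (exp (\<i> * complex_of_real u)) + norm (exp (\<i> * complex_of_real v))"
    by (rule norm_triangle_ineq4)
  moreover have "norm (exp (\<i> * complex_of_real (u - v)) - 1) \<le> \<bar>u - v\<bar>"
    using iexp_approx1[of "u - v" 0] by simp
  ultimately show ?thesis using 1 by simp
qed

text \<open>Interpolates between the Lipschitz estimate for short and the trivial estimate for long increments.
  The factor 1 + |(t,s)|^\<eta> is the weight in the definition of the Wiener ring.\<close>

lemma norm_exp_diff_holder:
  fixes t s x x' y \<eta> :: real
  assumes "0 < \<eta>" "\<eta> \<le> 1"
  shows "norm (exp (\<i> * complex_of_real (t * x + s * y)) - exp (\<i> * complex_of_real (t * x' + s * y)))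
     \<le> 2 * (1 + norm (t, s) powr \<eta>) * min 1 (\<bar>x - x'\<bar> powr \<eta>)" (is "?n \<le> _")
proof -
  have n: "?n \<le> 2" "?n \<le> \<bar>t * (x - x')\<bar>"
    using norm_iexp_diff_le[of "t * x + s * y" "t * x' + s * y"] by (simp_all add: algebra_simps)
  have t: "\<bar>t\<bar> powr \<eta> \<le> norm (t, s) powr \<eta>"
    using assms by (intro powr_mono2) (auto simp: norm_Pair real_sqrt_sum_squares_ge1 intro: order_trans[OF abs_ge_self])
  show ?thesis
  proof (cases "1 \<le> \<bar>x - x'\<bar> powr \<eta>")
    case True
    have "2 \<le> 2 * (1 + norm (t, s) powr \<eta>) * 1" by simp
    then have "?n \<le> 2 * (1 + norm (t, s) powr \<eta>) * 1" using n(1) by (rule order_trans[rotated])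
    with True show ?thesis by (simp only: min_def if_True)
  next
    case False
    have "?n \<le> 2 * \<bar>t * (x - x')\<bar> powr \<eta>"
    proof (cases "\<bar>t * (x - x')\<bar> \<le> 1")
      case True
      have "\<bar>t * (x - x')\<bar> \<le> \<bar>t * (x - x')\<bar> powr \<eta>"
      proof (cases "\<bar>t * (x - x')\<bar> = 0")
        case False
        then have "\<bar>t * (x - x')\<bar> powr 1 \<le> \<bar>t * (x - x')\<bar> powr \<eta>"
          using True assms by (intro powr_mono') auto
        then show ?thesis by simp
      qed (simp only: powr_ge_zero)
      then show ?thesis using n(2) powr_ge_zero[of "\<bar>t * (x - x')\<bar>" \<eta>] by linarith
    next
      case False
      then have "1 \<le> \<bar>t * (x - x')\<bar> powr \<eta>" using assms by (intro ge_one_powr_ge_zero) auto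
      then show ?thesis using n(1) by linarith
    qed
    also have "\<dots> = 2 * \<bar>t\<bar> powr \<eta> * \<bar>x - x'\<bar> powr \<eta>" by (simp add: abs_mult powr_mult)
    also have "\<dots> \<le> 2 * (1 + norm (t, s) powr \<eta>) * \<bar>x - x'\<bar> powr \<eta>"
      using t by (intro mult_right_mono) auto
    finally show ?thesis using False by (simp add: min_def)
  qed
qed

text \<open>Boundedness and uniform Hoelder continuity are all that is used of the Fourier representation. Both
  follow by estimating under the integral sign.\<close>

lemma wiener_ring_holder:
  assumes f: "f \<in> wiener_ring \<eta>" and eta: "0 < \<eta>" "\<eta> \<le> 1"
  obtains C where "0 \<le> C" "\<And>x y. \<bar>f x y\<bar> \<le> C"
    "\<And>x x' y. \<bar>f x y - f x' y\<bar> \<le> C * min 1 (\<bar>x - x'\<bar> powr \<eta>)"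
proof -
  from f obtain g :: "real \<times> real \<Rightarrow> complex" where g: "integrable lborel g"
    and rep: "\<And>x y. complex_of_real (f x y) = (\<integral>(t, s). g (t, s) * exp (\<i> * complex_of_real (t * x + s * y)) \<partial>lborel)"
    and gw: "integrable lborel (\<lambda>z. norm z powr \<eta> * norm (g z))"
    unfolding wiener_ring_def by blast
  define e where "e x y z = g z * exp (\<i> * complex_of_real (fst z * x + snd z * y))" for x y z
  have rep': "complex_of_real (f x y) = (\<integral>z. e x y z \<partial>lborel)" for x y
    by (simp add: rep e_def split_def)
  have [measurable]: "g \<in> borel_measurable borel" using borel_measurable_integrable[OF g] by simp
  have fst_snd [measurable]: "(fst :: real \<times> real \<Rightarrow> real) \<in> borel_measurable borel" "(snd :: real \<times> real \<Rightarrow> real) \<in> borel_measurable borel"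
    by (auto intro!: borel_measurable_continuous_onI continuous_intros)
  have norm_e: "norm (e x y z) = norm (g z)" for x y z by (simp add: e_def norm_mult)
  have e_meas: "e x y \<in> borel_measurable lborel" for x y
  proof -
    have "(\<lambda>z. exp (\<i> * complex_of_real (fst z * x + snd z * y))) \<in> borel_measurable borel"
      by (intro borel_measurable_continuous_onI continuous_intros)
    then show ?thesis unfolding e_def[abs_def] by simp
  qed
  have e_int: "integrable lborel (e x y)" for x y
    by (rule Bochner_Integration.integrable_bound[OF g e_meas]) (simp add: norm_e)
  define Gn where "Gn = (\<integral>z. norm (g z) \<partial>lborel)"
  define Wn where "Wn = (\<integral>z. norm z powr \<eta> * norm (g z) \<partial>lborel)"
  have nn: "0 \<le> Gn" "0 \<le> Wn" unfolding Gn_def Wn_def by (auto intro!: integral_nonneg_AE)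
  have bnd: "\<bar>f x y\<bar> \<le> 2 * (Gn + Wn)" for x y
  proof -
    have "\<bar>f x y\<bar> = norm (complex_of_real (f x y))" by simp
    also have "\<dots> \<le> (\<integral>z. norm (e x y z) \<partial>lborel)" unfolding rep' by (rule integral_norm_bound)
    also have "\<dots> = Gn" by (simp add: norm_e Gn_def)
    also have "\<dots> \<le> 2 * (Gn + Wn)" using nn(1) nn(2) by argo
    finally show ?thesis .
  qed
  have hol: "\<bar>f x y - f x' y\<bar> \<le> 2 * (Gn + Wn) * min 1 (\<bar>x - x'\<bar> powr \<eta>)" for x x' y
  proof -
    let ?m = "min 1 (\<bar>x - x'\<bar> powr \<eta>)"
    have int: "integrable lborel (\<lambda>z. 2 * (norm (g z) + norm z powr \<eta> * norm (g z)) * ?m)"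
      using g gw by (intro integrable_mult_left integrable_mult_right Bochner_Integration.integrable_add integrable_norm) auto
    have "\<bar>f x y - f x' y\<bar> = norm (complex_of_real (f x y) - complex_of_real (f x' y))"
      by (metis norm_of_real of_real_diff)
    also have "\<dots> = norm (\<integral>z. e x y z - e x' y z \<partial>lborel)" unfolding rep' using e_int by simp
    also have "\<dots> \<le> (\<integral>z. norm (e x y z - e x' y z) \<partial>lborel)" by (rule integral_norm_bound)
    also have "\<dots> \<le> (\<integral>z. 2 * (norm (g z) + norm z powr \<eta> * norm (g z)) * ?m \<partial>lborel)"
    proof (rule integral_mono[OF _ int])
      show "integrable lborel (\<lambda>z. norm (e x y z - e x' y z))" using e_int by (intro integrable_norm Bochner_Integration.integrable_diff)
      fix z :: "real \<times> real"
      obtain t s where z: "z = (t, s)" by (cases z)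
      have "norm (e x y z - e x' y z) = norm (g z) * norm (exp (\<i> * complex_of_real (t * x + s * y)) - exp (\<i> * complex_of_real (t * x' + s * y)))"
        by (simp add: e_def z norm_mult flip: right_diff_distrib)
      also have "\<dots> \<le> norm (g z) * (2 * (1 + norm z powr \<eta>) * ?m)"
        unfolding z using eta by (intro mult_left_mono norm_exp_diff_holder) auto
      finally show "norm (e x y z - e x' y z) \<le> 2 * (norm (g z) + norm z powr \<eta> * norm (g z)) * ?m"
        by (simp add: algebra_simps)
    qed
    also have "\<dots> = 2 * (Gn + Wn) * ?m"
      using g gw by (simp add: Gn_def Wn_def)
    finally show ?thesis .
  qed
  show thesis by (rule that[of "2 * (Gn + Wn)"]) (use nn bnd hol in auto)
qed

section \<open>Moments of the modulus of continuity\<close>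

lemma Lp_norm_8_le:
  assumes [measurable]: "Y \<in> borel_measurable M" and le: "Lp_norm M 8 Y \<le> ennreal c" and c: "0 \<le> c"
  shows "integrable M (\<lambda>\<omega>. Y \<omega> ^ 8)" "(\<integral>\<omega>. Y \<omega> ^ 8 \<partial>M) \<le> c ^ 8"
proof -
  define I where "I = (\<integral>\<^sup>+ \<omega>. ennreal (\<bar>Y \<omega>\<bar> powr 8) \<partial>M)"
  have fin: "I < \<infinity>" and le': "enn2real I powr (1 / 8) \<le> c"
    using le c unfolding Lp_norm_def I_def[symmetric] Let_def
    by (auto simp: top_unique less_top split: if_splits)
  have eq: "\<bar>y\<bar> powr 8 = y ^ 8" for y :: real
  proof -
    have "\<bar>y\<bar> powr 8 = \<bar>y\<bar> ^ 8" by (cases "y = 0") (auto simp flip: powr_numeral)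
    then show ?thesis by simp
  qed
  have I: "I = (\<integral>\<^sup>+ \<omega>. ennreal (Y \<omega> ^ 8) \<partial>M)" by (simp add: I_def eq)
  show int: "integrable M (\<lambda>\<omega>. Y \<omega> ^ 8)"
    by (rule integrableI_nonneg) (use fin I in \<open>auto simp: less_top\<close>)
  have "(\<integral>\<omega>. Y \<omega> ^ 8 \<partial>M) = enn2real I"
    unfolding I by (rule integral_eq_nn_integral) auto
  also have "\<dots> = (enn2real I powr (1 / 8)) ^ 8"
    by (cases "enn2real I = 0") (auto simp: powr_power)
  also have "\<dots> \<le> c ^ 8" using le' by (intro power_mono) auto
  finally show "(\<integral>\<omega>. Y \<omega> ^ 8 \<partial>M) \<le> c ^ 8" .
qed

text \<open>Taken from |z| \<le> c + z^8 / c^7, which is clear on either side of |z| = c.\<close>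

lemma (in prob_space) ky_fan_le_Lp_norm_8:
  assumes [measurable]: "X \<in> borel_measurable M" "Y \<in> borel_measurable M"
    and le: "Lp_norm M 8 (\<lambda>\<omega>. X \<omega> - Y \<omega>) \<le> ennreal c" and c: "0 < c"
  shows "ky_fan M X Y \<le> 2 * c"
proof -
  let ?Z = "\<lambda>\<omega>. X \<omega> - Y \<omega>"
  have Z: "integrable M (\<lambda>\<omega>. ?Z \<omega> ^ 8)" "(\<integral>\<omega>. ?Z \<omega> ^ 8 \<partial>M) \<le> c ^ 8"
    using Lp_norm_8_le[OF _ le] c by auto
  have "ky_fan M X Y \<le> (\<integral>\<omega>. c + ?Z \<omega> ^ 8 / c ^ 7 \<partial>M)"
    unfolding ky_fan_def
  proof (intro integral_mono integrable_min_1)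
    fix \<omega>
    show "min 1 \<bar>X \<omega> - Y \<omega>\<bar> \<le> c + ?Z \<omega> ^ 8 / c ^ 7"
    proof (cases "\<bar>?Z \<omega>\<bar> \<le> c")
      case True
      have "0 \<le> ?Z \<omega> ^ 8 / c ^ 7" using c by simp
      then show ?thesis using True by linarith
    next
      case False
      then have "c ^ 7 * \<bar>?Z \<omega>\<bar> \<le> \<bar>?Z \<omega>\<bar> ^ 7 * \<bar>?Z \<omega>\<bar>"
        using c by (intro mult_right_mono power_mono) auto
      also have "\<dots> = \<bar>?Z \<omega>\<bar> ^ 8" by (simp add: eval_nat_numeral mult_ac)
      also have "\<dots> = ?Z \<omega> ^ 8" by simp
      finally have "\<bar>?Z \<omega>\<bar> \<le> ?Z \<omega> ^ 8 / c ^ 7"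
        using c by (simp add: pos_le_divide_eq mult.commute)
      then show ?thesis using c by linarith
    qed
  qed (use Z in auto)
  also have "\<dots> = c + (\<integral>\<omega>. ?Z \<omega> ^ 8 \<partial>M) / c ^ 7"
    using Z by (simp add: prob_space)
  also have "\<dots> \<le> c + c ^ 8 / c ^ 7" using Z c by (intro add_left_mono divide_right_mono) auto
  also have "c ^ 8 / c ^ 7 = c" using c by (simp add: field_simps eval_nat_numeral)
  finally show ?thesis by simp
qed

text \<open>The increment in one variable of a kernel L(x) L(y) f(x,y), with f bounded and \<eta>-Hoelder,
  is bounded by this modulus times |L(y)|.\<close>

definition kernel_modulus :: "(real \<Rightarrow> real) \<Rightarrow> real \<Rightarrow> real \<Rightarrow> real \<Rightarrow> real" where
  "kernel_modulus L \<eta> x y = \<bar>L x - L y\<bar> + (1 + \<bar>L x\<bar>) * min 1 (\<bar>x - y\<bar> powr \<eta>)"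

lemma derivative_increment_le:
  assumes d: "\<And>x. (L has_real_derivative L' x) (at x)"
    and b: "\<And>a b t. a \<le> t \<Longrightarrow> t \<le> b \<Longrightarrow> \<bar>L' t\<bar> \<le> C * (\<bar>L' a\<bar> + \<bar>L' b\<bar> + 1)"
  shows "\<bar>L x - L y\<bar> \<le> \<bar>x - y\<bar> * (\<bar>C\<bar> * (\<bar>L' x\<bar> + \<bar>L' y\<bar> + 1))"
proof -
  have *: "\<bar>L y - L x\<bar> \<le> (y - x) * (\<bar>C\<bar> * (\<bar>L' x\<bar> + \<bar>L' y\<bar> + 1))" if "x < y" for x y
  proof -
    from MVT2[OF that, of L L'] d obtain z where z: "x < z" "z < y" "L y - L x = (y - x) * L' z" by auto
    have "\<bar>L' z\<bar> \<le> C * (\<bar>L' x\<bar> + \<bar>L' y\<bar> + 1)" using b z by simp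
    also have "\<dots> \<le> \<bar>C\<bar> * (\<bar>L' x\<bar> + \<bar>L' y\<bar> + 1)" by (intro mult_right_mono) auto
    finally show ?thesis using z that by (simp add: abs_mult mult_left_mono)
  qed
  consider "x < y" | "y < x" | "x = y" by linarith
  then show ?thesis
  proof cases
    case 1 then show ?thesis using *[OF 1] by (simp add: abs_minus_commute)
  next
    case 2 then show ?thesis using *[OF 2] by (simp add: add.commute)
  qed auto
qed

text \<open>If X and Y are within u of each other, the derivative bound and the Hoelder term make the
  modulus of order u^\<eta>. By Markov's inequality the complementary event has probability of order
  u, and there the eighth moments of L leave a factor sqrt u by Cauchy-Schwarz. The mean value
  theorem is usable because L' between two points is bounded by its values at these points.\<close>

lemma (in prob_space) kernel_modulus_fourth_moment:
  fixes L L' :: "real \<Rightarrow> real" and C \<eta> u B :: real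
  assumes d: "\<And>x. (L has_real_derivative L' x) (at x)"
    and b: "\<And>a b t. a \<le> t \<Longrightarrow> t \<le> b \<Longrightarrow> \<bar>L' t\<bar> \<le> C * (\<bar>L' a\<bar> + \<bar>L' b\<bar> + 1)"
    and Lm[measurable]: "L \<in> borel_measurable borel" "L' \<in> borel_measurable borel"
    and XY[measurable]: "X \<in> borel_measurable M" "Y \<in> borel_measurable M"
    and mom: "integrable M (\<lambda>\<omega>. L (X \<omega>) ^ 8)" "integrable M (\<lambda>\<omega>. L (Y \<omega>) ^ 8)"
      "integrable M (\<lambda>\<omega>. L' (X \<omega>) ^ 8)" "integrable M (\<lambda>\<omega>. L' (Y \<omega>) ^ 8)"
      "(\<integral>\<omega>. L (X \<omega>) ^ 8 \<partial>M) \<le> A" "(\<integral>\<omega>. L (Y \<omega>) ^ 8 \<partial>M) \<le> A"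
      "(\<integral>\<omega>. L' (X \<omega>) ^ 8 \<partial>M) \<le> A" "(\<integral>\<omega>. L' (Y \<omega>) ^ 8 \<partial>M) \<le> A"
    and kf: "ky_fan M X Y \<le> B * u\<^sup>2" and u: "0 < u" "u \<le> 1" and eta: "0 < \<eta>" "\<eta> \<le> 1"
  defines "e \<equiv> min (4 * \<eta>) (1 / 2)"
  shows "integrable M (\<lambda>\<omega>. kernel_modulus L \<eta> (X \<omega>) (Y \<omega>) ^ 4)"
    and "(\<integral>\<omega>. kernel_modulus L \<eta> (X \<omega>) (Y \<omega>) ^ 4 \<partial>M) \<le> ((3 * \<bar>C\<bar> + 256) ^ 4 * (1 + 4 * A + B)) * u powr e"
proof -
  let ?D = "\<lambda>\<omega>. kernel_modulus L \<eta> (X \<omega>) (Y \<omega>)"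
  \<comment> \<open>Dominates the eighth power of the largest of the values of L and its derivative.\<close>
  define T where "T \<omega> = 1 + L (X \<omega>) ^ 8 + L (Y \<omega>) ^ 8 + L' (X \<omega>) ^ 8 + L' (Y \<omega>) ^ 8" for \<omega>
  \<comment> \<open>Dominates 1 on the event that X and Y are more than u apart, and has mean of order u.\<close>
  define b1 where "b1 \<omega> = min 1 \<bar>X \<omega> - Y \<omega>\<bar> / u" for \<omega>
  have [measurable]: "(\<lambda>\<omega>. ?D \<omega>) \<in> borel_measurable M" unfolding kernel_modulus_def by measurable
  let ?c = "(3 * \<bar>C\<bar> + 256) ^ 4"
  have c1: "1 \<le> ?c" by (rule one_le_power) simp
  have Tint: "integrable M T" unfolding T_def[abs_def] using mom by (intro Bochner_Integration.integrable_add) auto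
  have b1int: "integrable M b1" unfolding b1_def[abs_def] by (intro integrable_divide integrable_min_1) auto
  have ue: "u powr (4 * \<eta>) \<le> u powr e" "sqrt u \<le> u powr e"
    using u unfolding e_def by (auto intro!: powr_mono' simp flip: powr_half_sqrt)
  have sq: "sqrt u * sqrt u = u" "0 < sqrt u" using u by auto
  have pt: "?D \<omega> ^ 4 \<le> ?c * (u powr e * T \<omega> + b1 \<omega> / sqrt u)" for \<omega>
  proof -
    define m where "m = Max {1, \<bar>L (X \<omega>)\<bar>, \<bar>L (Y \<omega>)\<bar>, \<bar>L' (X \<omega>)\<bar>, \<bar>L' (Y \<omega>)\<bar>}"
    have m: "1 \<le> m" "\<bar>L (X \<omega>)\<bar> \<le> m" "\<bar>L (Y \<omega>)\<bar> \<le> m" "\<bar>L' (X \<omega>)\<bar> \<le> m" "\<bar>L' (Y \<omega>)\<bar> \<le> m"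
      unfolding m_def by (rule Max_ge; simp)+
    have mT: "m ^ 8 \<le> T \<omega>"
    proof -
      have "m \<in> {1, \<bar>L (X \<omega>)\<bar>, \<bar>L (Y \<omega>)\<bar>, \<bar>L' (X \<omega>)\<bar>, \<bar>L' (Y \<omega>)\<bar>}"
        unfolding m_def by (rule Max_in) auto
      then have "m ^ 8 \<in> {1, L (X \<omega>) ^ 8, L (Y \<omega>) ^ 8, L' (X \<omega>) ^ 8, L' (Y \<omega>) ^ 8}"
        by (elim insertE emptyE) (simp_all add: power_even_abs)
      moreover have ev: "0 \<le> z ^ 8" for z :: real by simp
      ultimately show ?thesis
        unfolding T_def using ev[of "L (X \<omega>)"] ev[of "L (Y \<omega>)"] ev[of "L' (X \<omega>)"] ev[of "L' (Y \<omega>)"]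
        by (elim insertE emptyE) linarith+
    qed
    have T0: "0 \<le> T \<omega>" unfolding T_def by simp
    have m48: "m ^ 4 \<le> m ^ 8" using m(1) by (intro power_increasing) auto
    have D0: "0 \<le> ?D \<omega>" by (simp add: kernel_modulus_def)
    have bn: "0 \<le> b1 \<omega>" unfolding b1_def using u by simp
    show ?thesis
    proof (cases "\<bar>X \<omega> - Y \<omega>\<bar> \<le> u")
      case True
      have 1: "\<bar>L (X \<omega>) - L (Y \<omega>)\<bar> \<le> u powr \<eta> * (\<bar>C\<bar> * (3 * m))"
      proof -
        have "u powr 1 \<le> u powr \<eta>" using u eta by (intro powr_mono') auto
        then have "\<bar>X \<omega> - Y \<omega>\<bar> \<le> u powr \<eta>" using True u by simp
        then show ?thesis
          using m by (intro order_trans[OF derivative_increment_le[OF d b]] mult_mono mult_left_mono) auto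
      qed
      have 2: "(1 + \<bar>L (X \<omega>)\<bar>) * min 1 (\<bar>X \<omega> - Y \<omega>\<bar> powr \<eta>) \<le> (2 * m) * u powr \<eta>"
        using m True eta by (intro mult_mono) (auto intro!: min.coboundedI2 powr_mono2)
      have "?D \<omega> \<le> (3 * \<bar>C\<bar> + 2) * m * u powr \<eta>"
        using 1 2 unfolding kernel_modulus_def by (simp add: algebra_simps)
      also have "\<dots> \<le> (3 * \<bar>C\<bar> + 256) * m * u powr \<eta>" using m by (intro mult_right_mono) auto
      finally have "?D \<omega> ^ 4 \<le> ((3 * \<bar>C\<bar> + 256) * m * u powr \<eta>) ^ 4" using D0 by (rule power_mono)
      also have "\<dots> = ?c * (m ^ 4 * u powr (4 * \<eta>))"
        using u by (simp add: power_mult_distrib powr_power mult.commute)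
      also have "\<dots> \<le> ?c * (T \<omega> * u powr e)"
        using m48 mT ue m T0 by (intro mult_left_mono mult_mono) auto
      also have "\<dots> \<le> ?c * (u powr e * T \<omega> + b1 \<omega> / sqrt u)"
        using bn sq by (intro mult_left_mono) auto
      finally show ?thesis .
    next
      case False
      have b11: "1 \<le> b1 \<omega>" unfolding b1_def using False u by (simp add: pos_le_divide_eq)
      have "?D \<omega> \<le> 2 * m + (2 * m) * 1"
        unfolding kernel_modulus_def using m by (intro add_mono mult_mono) auto
      then have "?D \<omega> ^ 4 \<le> (4 * m) ^ 4" using D0 by (intro power_mono) auto
      also have "\<dots> = 256 * m ^ 4" by (simp add: power_mult_distrib)
      also have "m ^ 4 \<le> sqrt u * m ^ 8 + 1 / sqrt u"
      proof -
        have "2 * (sqrt u * m ^ 4 * 1) \<le> (sqrt u * m ^ 4)\<^sup>2 + 1\<^sup>2"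
          using sum_squares_bound[of "sqrt u * m ^ 4" 1] by simp
        then have "sqrt u * m ^ 4 \<le> (sqrt u * m ^ 4)\<^sup>2 + 1" 
          using sq m by (smt (verit) mult_nonneg_nonneg zero_le_power one_power2)
        also have "(sqrt u * m ^ 4)\<^sup>2 = u * m ^ 8" using u by (simp add: power_mult_distrib flip: power_mult)
        finally have "m ^ 4 \<le> (u * m ^ 8 + 1) / sqrt u" using sq by (simp add: pos_le_divide_eq mult.commute)
        also have "\<dots> = sqrt u * m ^ 8 + 1 / sqrt u"
        proof -
          have "u * m ^ 8 / sqrt u = (u / sqrt u) * m ^ 8" by simp
          then show ?thesis using u by (simp only: add_divide_distrib real_div_sqrt less_imp_le)
        qed
        finally show ?thesis .
      qed
      also have "256 * (sqrt u * m ^ 8 + 1 / sqrt u) \<le> ?c * (u powr e * T \<omega> + b1 \<omega> / sqrt u)"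
      proof (rule mult_mono)
        have "256 \<le> (3 * \<bar>C\<bar> + 256) ^ 1" by simp
        also have "\<dots> \<le> ?c" by (intro power_increasing) auto
        finally show "256 \<le> ?c" .
        show "sqrt u * m ^ 8 + 1 / sqrt u \<le> u powr e * T \<omega> + b1 \<omega> / sqrt u"
          using ue mT b11 sq m T0 by (intro add_mono mult_mono divide_right_mono) auto
      qed (use sq m in auto)
      finally show ?thesis by simp
    qed
  qed
  have Qint: "integrable M (\<lambda>\<omega>. ?c * (u powr e * T \<omega> + b1 \<omega> / sqrt u))"
    using Tint b1int by (intro integrable_mult_right Bochner_Integration.integrable_add integrable_divide) auto
  show Dint: "integrable M (\<lambda>\<omega>. ?D \<omega> ^ 4)"
    by (rule Bochner_Integration.integrable_bound[OF Qint]) (use pt in \<open>auto intro!: AE_I2 order_trans[OF _ abs_ge_self]\<close>)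
  have "(\<integral>\<omega>. ?D \<omega> ^ 4 \<partial>M) \<le> (\<integral>\<omega>. ?c * (u powr e * T \<omega> + b1 \<omega> / sqrt u) \<partial>M)"
    by (intro integral_mono Dint Qint pt)
  also have "\<dots> = ?c * (u powr e * (\<integral>\<omega>. T \<omega> \<partial>M) + (\<integral>\<omega>. b1 \<omega> \<partial>M) / sqrt u)"
    using Tint b1int by simp
  also have "\<dots> \<le> ?c * (u powr e * (1 + 4 * A) + B * u powr e)"
  proof (intro mult_left_mono add_mono)
    show "(\<integral>\<omega>. T \<omega> \<partial>M) \<le> 1 + 4 * A" unfolding T_def using mom by (simp add: prob_space)
    have "(\<integral>\<omega>. b1 \<omega> \<partial>M) = ky_fan M X Y / u" unfolding b1_def ky_fan_def by simp
    also have "\<dots> \<le> B * u" using kf u by (simp add: pos_divide_le_eq power2_eq_square mult.assoc)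
    finally have 1: "(\<integral>\<omega>. b1 \<omega> \<partial>M) / sqrt u \<le> B * u / sqrt u" using sq by (intro divide_right_mono) auto
    have "B * u / sqrt u = B * sqrt u" using sq by (metis (no_types) less_irrefl mult.assoc nonzero_mult_div_cancel_right)
    moreover have "0 \<le> B" using kf ky_fan_nonneg[of X Y] u
      by (smt (verit, best) mult_neg_pos zero_less_power)
    ultimately show "(\<integral>\<omega>. b1 \<omega> \<partial>M) / sqrt u \<le> B * u powr e" using 1 ue(2) by (smt (verit) mult_left_mono)
  qed auto
  also have "\<dots> = (?c * (1 + 4 * A + B)) * u powr e" by (simp add: algebra_simps)
  finally show "(\<integral>\<omega>. ?D \<omega> ^ 4 \<partial>M) \<le> (?c * (1 + 4 * A + B)) * u powr e" .
qed

section \<open>Processes that can be spliced\<close>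

text \<open>Y_a agrees with X up to time a; after a it is a version of X that is independent of the past.
  The joint law of the whole path is therefore that of X up to a continued by an independent
  replica of X. The function lw measures growth, D measures increments, and r is the rate at which
  Y_a approaches X as time moves away from a. A fourth power of the rate in the moment bound
  of D leaves the rate itself after Hoelder's inequality for four factors.\<close>

locale spliced_process = prob_space M for M :: "'a measure" +
  fixes X :: "nat \<Rightarrow> 'a \<Rightarrow> real" and Y :: "nat \<Rightarrow> nat \<Rightarrow> 'a \<Rightarrow> real"
    and lw :: "real \<Rightarrow> real" and D :: "real \<Rightarrow> real \<Rightarrow> real" and K r :: real
  assumes X_measurable [measurable]: "\<And>k. X k \<in> borel_measurable M"
    and Y_measurable [measurable]: "\<And>a k. Y a k \<in> borel_measurable M"
    and Y_past: "\<And>a k \<omega>. k \<le> a \<Longrightarrow> \<omega> \<in> space M \<Longrightarrow> Y a k \<omega> = X k \<omega>"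
    and Y_law: "\<And>a. distr M paths (\<lambda>\<omega> k. Y a k \<omega>)
        = distr (M \<Otimes>\<^sub>M M) paths (\<lambda>(\<omega>, \<omega>') k. if k \<le> a then X k \<omega> else X k \<omega>')"
    and lw_measurable [measurable]: "lw \<in> borel_measurable borel"
    and D_measurable: "(\<lambda>(x, y). D x y) \<in> borel_measurable (borel \<Otimes>\<^sub>M borel)"
    and lw_ge_1: "\<And>x. 1 \<le> lw x"
    and D_nonneg: "\<And>x y. 0 \<le> D x y" and D_self: "\<And>x. D x x = 0"
    and lw_moment: "\<And>k. integrable M (\<lambda>\<omega>. lw (X k \<omega>) ^ 4)" "\<And>k. (\<integral>\<omega>. lw (X k \<omega>) ^ 4 \<partial>M) \<le> K"
    and D_moment: "\<And>a k. integrable M (\<lambda>\<omega>. D (X k \<omega>) (Y a k \<omega>) ^ 4)"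
      "\<And>a k. a \<le> k \<Longrightarrow> (\<integral>\<omega>. D (X k \<omega>) (Y a k \<omega>) ^ 4 \<partial>M) \<le> K * (r ^ (k - a)) ^ 4"
    and r: "0 < r" "r < 1"
begin

lemma D_measurable2 [measurable (raw)]:
  assumes "f \<in> borel_measurable N" "g \<in> borel_measurable N"
  shows "(\<lambda>x. D (f x) (g x)) \<in> borel_measurable N"
  using measurable_compose[OF measurable_Pair[OF assms] D_measurable] by simp

lemma lw_nonneg: "0 \<le> lw x" using lw_ge_1[of x] by simp

lemma K_ge_1: "1 \<le> K"
proof -
  have "1 = (\<integral>\<omega>. (1 :: real) \<partial>M)" by (simp add: prob_space)
  also have "\<dots> \<le> (\<integral>\<omega>. lw (X 0 \<omega>) ^ 4 \<partial>M)"
    by (intro integral_mono lw_moment one_le_power lw_ge_1) auto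
  also have "\<dots> \<le> K" by (rule lw_moment)
  finally show ?thesis .
qed

lemma Y_marginal: "distr M borel (Y a k) = distr M borel (X k)"
proof -
  interpret P: pair_prob_space M M ..
  have "distr M borel (Y a k) = distr (distr M paths (\<lambda>\<omega> k. Y a k \<omega>)) borel (\<lambda>x. x k)"
    by (subst distr_distr) (auto simp: comp_def intro!: measurable_PiM_single')
  also have "\<dots> = distr (M \<Otimes>\<^sub>M M) borel (\<lambda>(\<omega>, \<omega>'). if k \<le> a then X k \<omega> else X k \<omega>')"
    unfolding Y_law
    by (subst distr_distr) (auto simp: comp_def split_def intro!: measurable_PiM_single')
  also have "\<dots> = distr M borel (X k)"
  proof (cases "k \<le> a")
    case True
    have "distr (M \<Otimes>\<^sub>M M) borel (X k \<circ> fst) = distr (distr (M \<Otimes>\<^sub>M M) M fst) borel (X k)"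
      by (rule distr_distr[symmetric]) auto
    then show ?thesis using True by (simp add: distr_pair_fst comp_def split_def)
  next
    case False
    have "distr (M \<Otimes>\<^sub>M M) M snd = M"
    proof (rule measure_eqI)
      fix A assume A: "A \<in> sets (distr (M \<Otimes>\<^sub>M M) M snd)"
      then have "snd -` A \<inter> space (M \<Otimes>\<^sub>M M) = space M \<times> A"
        using sets.sets_into_space[of A M] by (auto simp: space_pair_measure)
      then show "emeasure (distr (M \<Otimes>\<^sub>M M) M snd) A = emeasure M A"
        using A by (simp add: emeasure_distr emeasure_pair_measure_Times emeasure_space_1)
    qed simp
    moreover have "distr (M \<Otimes>\<^sub>M M) borel (X k \<circ> snd) = distr (distr (M \<Otimes>\<^sub>M M) M snd) borel (X k)"
      by (rule distr_distr[symmetric]) auto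
    ultimately show ?thesis using False by (simp add: comp_def split_def)
  qed
  finally show ?thesis .
qed

lemma lw_Y_moment: "integrable M (\<lambda>\<omega>. lw (Y a k \<omega>) ^ 4)" "(\<integral>\<omega>. lw (Y a k \<omega>) ^ 4 \<partial>M) \<le> K"
proof -
  have "integrable (distr M borel (X k)) (\<lambda>x. lw x ^ 4)"
    by (subst integrable_distr_eq) (auto intro: lw_moment)
  then show "integrable M (\<lambda>\<omega>. lw (Y a k \<omega>) ^ 4)"
    unfolding Y_marginal[of a, symmetric] by (subst (asm) integrable_distr_eq) auto
  have "(\<integral>\<omega>. lw (Y a k \<omega>) ^ 4 \<partial>M) = (\<integral>x. lw x ^ 4 \<partial>distr M borel (Y a k))"
    by (subst integral_distr) auto
  also have "\<dots> = (\<integral>\<omega>. lw (X k \<omega>) ^ 4 \<partial>M)"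
    unfolding Y_marginal by (subst integral_distr) auto
  finally show "(\<integral>\<omega>. lw (Y a k \<omega>) ^ 4 \<partial>M) \<le> K" using lw_moment(2)[of k] by simp
qed

lemma D_moment_gap:
  assumes "t \<le> a \<or> a + G \<le> t"
  shows "(\<integral>\<omega>. D (X t \<omega>) (Y a t \<omega>) ^ 4 \<partial>M) \<le> K * (r ^ G) ^ 4"
proof (cases "t \<le> a")
  case True
  then have "(\<integral>\<omega>. D (X t \<omega>) (Y a t \<omega>) ^ 4 \<partial>M) = (\<integral>\<omega>. 0 \<partial>M)"
    by (intro Bochner_Integration.integral_cong) (auto simp: Y_past D_self)
  then show ?thesis using K_ge_1 r by simp
next
  case False
  then have t: "a + G \<le> t" using assms by auto
  have "(\<integral>\<omega>. D (X t \<omega>) (Y a t \<omega>) ^ 4 \<partial>M) \<le> K * (r ^ (t - a)) ^ 4"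
    using t by (intro D_moment) auto
  also have "\<dots> \<le> K * (r ^ G) ^ 4"
    using t r K_ge_1 by (intro mult_left_mono power_mono power_decreasing) auto
  finally show ?thesis .
qed

end

text \<open>The powers of s are balanced so that a first factor with fourth moment of order s^4 makes the
  product of order s.\<close>

lemma young_four:
  fixes x y z v s :: real
  assumes "s > 0"
  shows "x * y * z * v \<le> (x ^ 4 / s ^ 3 + s * (y ^ 4 + z ^ 4 + v ^ 4)) / 4"
proof -
  have *: "a * b \<le> (a\<^sup>2 + b\<^sup>2) / 2" for a b :: real
    using zero_le_power2[of "a - b"] by (simp add: power2_diff)
  have "x * y * z * v = s * ((x * y / s) * (z * v))" using assms by simp
  also have "\<dots> \<le> s * (((x * y / s)\<^sup>2 + (z * v)\<^sup>2) / 2)"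
    using assms by (intro mult_left_mono *) auto
  also have "(x * y / s)\<^sup>2 = (x / s)\<^sup>2 * y\<^sup>2" by (simp add: power_mult_distrib power_divide)
  also have "\<dots> \<le> (((x / s)\<^sup>2)\<^sup>2 + (y\<^sup>2)\<^sup>2) / 2" by (rule *)
  also have "(z * v)\<^sup>2 \<le> ((z\<^sup>2)\<^sup>2 + (v\<^sup>2)\<^sup>2) / 2" unfolding power_mult_distrib by (rule *)
  finally have "x * y * z * v \<le> s * (((((x / s)\<^sup>2)\<^sup>2 + (y\<^sup>2)\<^sup>2) / 2 + ((z\<^sup>2)\<^sup>2 + (v\<^sup>2)\<^sup>2) / 2) / 2)"
    using assms by (simp add: mult_left_mono)
  also have "\<dots> = (x ^ 4 / s ^ 3 + s * (y ^ 4 + z ^ 4 + v ^ 4)) / 4"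
    using assms by (simp add: power_divide field_simps power4_eq_xxxx power3_eq_cube power2_eq_square)
  finally show ?thesis .
qed

lemma (in prob_space) expectation_product_four:
  fixes A B C E :: "'a \<Rightarrow> real"
  assumes [measurable]: "A \<in> borel_measurable M" "B \<in> borel_measurable M" "C \<in> borel_measurable M" "E \<in> borel_measurable M"
    and nonneg: "\<And>\<omega>. 0 \<le> A \<omega>" "\<And>\<omega>. 0 \<le> B \<omega>" "\<And>\<omega>. 0 \<le> C \<omega>" "\<And>\<omega>. 0 \<le> E \<omega>"
    and int: "integrable M (\<lambda>\<omega>. A \<omega> ^ 4)" "integrable M (\<lambda>\<omega>. B \<omega> ^ 4)"
      "integrable M (\<lambda>\<omega>. C \<omega> ^ 4)" "integrable M (\<lambda>\<omega>. E \<omega> ^ 4)"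
    and bound: "(\<integral>\<omega>. A \<omega> ^ 4 \<partial>M) \<le> K * s ^ 4" "(\<integral>\<omega>. B \<omega> ^ 4 \<partial>M) \<le> K"
      "(\<integral>\<omega>. C \<omega> ^ 4 \<partial>M) \<le> K" "(\<integral>\<omega>. E \<omega> ^ 4 \<partial>M) \<le> K"
    and s: "0 < s"
  shows "integrable M (\<lambda>\<omega>. A \<omega> * B \<omega> * C \<omega> * E \<omega>)" "(\<integral>\<omega>. A \<omega> * B \<omega> * C \<omega> * E \<omega> \<partial>M) \<le> K * s"
proof -
  let ?Q = "\<lambda>\<omega>. (A \<omega> ^ 4 / s ^ 3 + s * (B \<omega> ^ 4 + C \<omega> ^ 4 + E \<omega> ^ 4)) / 4"
  have Q: "integrable M ?Q"
    using int by (intro integrable_divide Bochner_Integration.integrable_add integrable_mult_right) auto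
  have pt: "A \<omega> * B \<omega> * C \<omega> * E \<omega> \<le> ?Q \<omega>" for \<omega> by (rule young_four[OF s])
  show 1: "integrable M (\<lambda>\<omega>. A \<omega> * B \<omega> * C \<omega> * E \<omega>)"
  proof (rule Bochner_Integration.integrable_bound[OF Q])
    show "AE \<omega> in M. norm (A \<omega> * B \<omega> * C \<omega> * E \<omega>) \<le> norm (?Q \<omega>)"
      using pt nonneg by (intro AE_I2) (smt (verit) mult_nonneg_nonneg real_norm_def)
  qed measurable
  have "(\<integral>\<omega>. A \<omega> * B \<omega> * C \<omega> * E \<omega> \<partial>M) \<le> (\<integral>\<omega>. ?Q \<omega> \<partial>M)"
    by (intro integral_mono 1 Q pt)
  also have "\<dots> = ((\<integral>\<omega>. A \<omega> ^ 4 \<partial>M) / s ^ 3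
      + s * ((\<integral>\<omega>. B \<omega> ^ 4 \<partial>M) + (\<integral>\<omega>. C \<omega> ^ 4 \<partial>M) + (\<integral>\<omega>. E \<omega> ^ 4 \<partial>M))) / 4"
    using int by (simp add: Bochner_Integration.integral_add)
  also have "\<dots> \<le> (K * s ^ 4 / s ^ 3 + s * (K + K + K)) / 4"
    using s by (intro divide_right_mono add_mono mult_left_mono bound) auto
  also have "\<dots> = K * s" using s by (simp add: field_simps power4_eq_xxxx power3_eq_cube)
  finally show "(\<integral>\<omega>. A \<omega> * B \<omega> * C \<omega> * E \<omega> \<partial>M) \<le> K * s" .
qed

context spliced_process
begin

text \<open>The kernels to which the coupling applies: w is a weight carried along so that all bounds scale with
  it, the growth is that of a product of the functions lw, and the increments are governed by D.\<close>

definition regular :: "real \<Rightarrow> (real \<Rightarrow> real \<Rightarrow> real) \<Rightarrow> bool" where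
  "regular w h \<longleftrightarrow> 0 \<le> w \<and> (\<lambda>(x, y). h x y) \<in> borel_measurable (borel \<Otimes>\<^sub>M borel) \<and>
     (\<forall>x y. \<bar>h x y\<bar> \<le> w * lw x * lw y) \<and>
     (\<forall>x x' y. \<bar>h x y - h x' y\<bar> \<le> w * D x x' * lw y) \<and>
     (\<forall>x y y'. \<bar>h x y - h x y'\<bar> \<le> w * lw x * D y y')"

lemma regular_measurable:
  assumes "regular w h" "f \<in> borel_measurable N" "g \<in> borel_measurable N"
  shows "(\<lambda>x. h (f x) (g x)) \<in> borel_measurable N"
  using assms(1) measurable_compose[OF measurable_Pair[OF assms(2,3)], of "\<lambda>(x, y). h x y"]
  by (simp add: regular_def)

lemma product_integrable:
  assumes h: "regular w h" and h': "regular w' h'"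
    and V: "\<And>t. V t \<in> borel_measurable M" "\<And>t. integrable M (\<lambda>\<omega>. lw (V t \<omega>) ^ 4)"
      "\<And>t. (\<integral>\<omega>. lw (V t \<omega>) ^ 4 \<partial>M) \<le> K"
  shows "integrable M (\<lambda>\<omega>. h (V k \<omega>) (V j \<omega>) * h' (V l \<omega>) (V m \<omega>))"
    and "\<bar>\<integral>\<omega>. h (V k \<omega>) (V j \<omega>) * h' (V l \<omega>) (V m \<omega>) \<partial>M\<bar> \<le> w * w' * K"
proof -
  note [measurable] = V(1) regular_measurable[OF h] regular_measurable[OF h']
  let ?L = "\<lambda>\<omega>. lw (V k \<omega>) * lw (V j \<omega>) * lw (V l \<omega>) * lw (V m \<omega>)"
  have L: "integrable M ?L" "(\<integral>\<omega>. ?L \<omega> \<partial>M) \<le> K * 1"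
    by (rule expectation_product_four[where s = 1, OF _ _ _ _ lw_nonneg lw_nonneg lw_nonneg lw_nonneg
          V(2) V(2) V(2) V(2) _ V(3) V(3) V(3)]; use V(3) in simp)+
  have w: "0 \<le> w" "0 \<le> w'" using h h' by (auto simp: regular_def)
  have pt: "\<bar>h (V k \<omega>) (V j \<omega>) * h' (V l \<omega>) (V m \<omega>)\<bar> \<le> w * w' * ?L \<omega>" for \<omega>
  proof -
    have "\<bar>h (V k \<omega>) (V j \<omega>)\<bar> * \<bar>h' (V l \<omega>) (V m \<omega>)\<bar>
       \<le> (w * lw (V k \<omega>) * lw (V j \<omega>)) * (w' * lw (V l \<omega>) * lw (V m \<omega>))"
      using h h' by (intro mult_mono) (auto simp: regular_def intro!: mult_nonneg_nonneg lw_nonneg)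
    then show ?thesis by (simp add: abs_mult mult_ac)
  qed
  show 1: "integrable M (\<lambda>\<omega>. h (V k \<omega>) (V j \<omega>) * h' (V l \<omega>) (V m \<omega>))"
  proof (rule Bochner_Integration.integrable_bound[OF integrable_mult_right[OF L(1), of "w * w'"]])
    show "AE \<omega> in M. norm (h (V k \<omega>) (V j \<omega>) * h' (V l \<omega>) (V m \<omega>)) \<le> norm (w * w' * ?L \<omega>)"
      using pt by (intro AE_I2) (metis abs_of_nonneg abs_ge_zero order_trans real_norm_def)
  qed measurable
  have "\<bar>\<integral>\<omega>. h (V k \<omega>) (V j \<omega>) * h' (V l \<omega>) (V m \<omega>) \<partial>M\<bar> \<le> (\<integral>\<omega>. w * w' * ?L \<omega> \<partial>M)"
    by (rule order_trans[OF integral_abs_bound])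
       (intro integral_mono integrable_abs 1 integrable_mult_right L pt)
  also have "\<dots> \<le> w * w' * K" using L w by (simp add: mult_left_mono)
  finally show "\<bar>\<integral>\<omega>. h (V k \<omega>) (V j \<omega>) * h' (V l \<omega>) (V m \<omega>) \<partial>M\<bar> \<le> w * w' * K" .
qed

lemmas product_integrable_X = product_integrable[where V = X, OF _ _ X_measurable lw_moment]
lemmas product_integrable_Y = product_integrable[where V = "Y a" for a, OF _ _ Y_measurable lw_Y_moment]

text \<open>Splicing at time a changes only the variables after a, all of which lie beyond the gap. A product of
  two kernels is changed by at most four terms, each with one small factor D and three factors lw.\<close>

lemma splice_error:
  assumes h: "regular w h" and h': "regular w' h'"
    and gap: "\<And>t. t \<in> {k, j, l, m} \<Longrightarrow> t \<le> a \<or> a + G \<le> t"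
  shows "\<bar>(\<integral>\<omega>. h (X k \<omega>) (X j \<omega>) * h' (X l \<omega>) (X m \<omega>) \<partial>M)
        - (\<integral>\<omega>. h (Y a k \<omega>) (Y a j \<omega>) * h' (Y a l \<omega>) (Y a m \<omega>) \<partial>M)\<bar> \<le> 4 * K * w * w' * r ^ G"
proof -
  note [measurable] = regular_measurable[OF h] regular_measurable[OF h']
  define d where "d t \<omega> = D (X t \<omega>) (Y a t \<omega>)" for t \<omega>
  define x where "x t \<omega> = lw (X t \<omega>)" for t \<omega>
  define y where "y t \<omega> = lw (Y a t \<omega>)" for t \<omega>
  have [measurable]: "d t \<in> borel_measurable M" "x t \<in> borel_measurable M" "y t \<in> borel_measurable M" for t
    unfolding d_def[abs_def] x_def[abs_def] y_def[abs_def] by measurable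
  have nn: "0 \<le> d t \<omega>" "0 \<le> x t \<omega>" "0 \<le> y t \<omega>" for t \<omega>
    by (auto simp: d_def x_def y_def D_nonneg lw_nonneg)
  have dm: "integrable M (\<lambda>\<omega>. d t \<omega> ^ 4)" for t unfolding d_def by (rule D_moment)
  have db: "(\<integral>\<omega>. d t \<omega> ^ 4 \<partial>M) \<le> K * (r ^ G) ^ 4" if "t \<in> {k, j, l, m}" for t
    unfolding d_def by (rule D_moment_gap[OF gap[OF that]])
  have xm: "integrable M (\<lambda>\<omega>. x t \<omega> ^ 4)" "(\<integral>\<omega>. x t \<omega> ^ 4 \<partial>M) \<le> K"
    "integrable M (\<lambda>\<omega>. y t \<omega> ^ 4)" "(\<integral>\<omega>. y t \<omega> ^ 4 \<partial>M) \<le> K" for t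
    unfolding x_def y_def by (rule lw_moment lw_Y_moment)+
  have w: "0 \<le> w" "0 \<le> w'" using h h' by (auto simp: regular_def)
  define E1 where "E1 \<omega> = d k \<omega> * x j \<omega> * x l \<omega> * x m \<omega>" for \<omega>
  define E2 where "E2 \<omega> = d j \<omega> * y k \<omega> * x l \<omega> * x m \<omega>" for \<omega>
  define E3 where "E3 \<omega> = d l \<omega> * y k \<omega> * y j \<omega> * x m \<omega>" for \<omega>
  define E4 where "E4 \<omega> = d m \<omega> * y k \<omega> * y j \<omega> * y l \<omega>" for \<omega>
  have rG: "0 < r ^ G" using r by simp
  have E1: "integrable M E1" "(\<integral>\<omega>. E1 \<omega> \<partial>M) \<le> K * r ^ G" unfolding E1_def[abs_def]
    by (rule expectation_product_four[OF _ _ _ _ nn(1) nn(2) nn(2) nn(2) dm xm(1) xm(1) xm(1) db xm(2) xm(2) xm(2) rG]; simp)+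
  have E2: "integrable M E2" "(\<integral>\<omega>. E2 \<omega> \<partial>M) \<le> K * r ^ G" unfolding E2_def[abs_def]
    by (rule expectation_product_four[OF _ _ _ _ nn(1) nn(3) nn(2) nn(2) dm xm(3) xm(1) xm(1) db xm(4) xm(2) xm(2) rG]; simp)+
  have E3: "integrable M E3" "(\<integral>\<omega>. E3 \<omega> \<partial>M) \<le> K * r ^ G" unfolding E3_def[abs_def]
    by (rule expectation_product_four[OF _ _ _ _ nn(1) nn(3) nn(3) nn(2) dm xm(3) xm(3) xm(1) db xm(4) xm(4) xm(2) rG]; simp)+
  have E4: "integrable M E4" "(\<integral>\<omega>. E4 \<omega> \<partial>M) \<le> K * r ^ G" unfolding E4_def[abs_def]
    by (rule expectation_product_four[OF _ _ _ _ nn(1) nn(3) nn(3) nn(3) dm xm(3) xm(3) xm(3) db xm(4) xm(4) xm(4) rG]; simp)+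
  let ?f = "\<lambda>\<omega>. h (X k \<omega>) (X j \<omega>) * h' (X l \<omega>) (X m \<omega>)"
  let ?g = "\<lambda>\<omega>. h (Y a k \<omega>) (Y a j \<omega>) * h' (Y a l \<omega>) (Y a m \<omega>)"
  have pt: "\<bar>?f \<omega> - ?g \<omega>\<bar> \<le> w * w' * (E1 \<omega> + E2 \<omega> + E3 \<omega> + E4 \<omega>)" for \<omega>
  proof -
    have a1: "\<bar>h (X k \<omega>) (X j \<omega>) - h (Y a k \<omega>) (X j \<omega>)\<bar> \<le> w * d k \<omega> * x j \<omega>"
      and a2: "\<bar>h (Y a k \<omega>) (X j \<omega>) - h (Y a k \<omega>) (Y a j \<omega>)\<bar> \<le> w * y k \<omega> * d j \<omega>"
      and b1: "\<bar>h' (X l \<omega>) (X m \<omega>) - h' (Y a l \<omega>) (X m \<omega>)\<bar> \<le> w' * d l \<omega> * x m \<omega>"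
      and b2: "\<bar>h' (Y a l \<omega>) (X m \<omega>) - h' (Y a l \<omega>) (Y a m \<omega>)\<bar> \<le> w' * y l \<omega> * d m \<omega>"
      and c1: "\<bar>h (Y a k \<omega>) (Y a j \<omega>)\<bar> \<le> w * y k \<omega> * y j \<omega>"
      and c2: "\<bar>h' (X l \<omega>) (X m \<omega>)\<bar> \<le> w' * x l \<omega> * x m \<omega>"
      using h h' by (simp_all add: regular_def d_def x_def y_def)
    have "\<bar>?f \<omega> - ?g \<omega>\<bar> \<le> \<bar>h (X k \<omega>) (X j \<omega>) - h (Y a k \<omega>) (Y a j \<omega>)\<bar> * \<bar>h' (X l \<omega>) (X m \<omega>)\<bar>
       + \<bar>h (Y a k \<omega>) (Y a j \<omega>)\<bar> * \<bar>h' (X l \<omega>) (X m \<omega>) - h' (Y a l \<omega>) (Y a m \<omega>)\<bar>"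
      unfolding abs_mult[symmetric] by (rule order_trans[OF _ abs_triangle_ineq]) (simp add: algebra_simps)
    also have "\<dots> \<le> (w * d k \<omega> * x j \<omega> + w * y k \<omega> * d j \<omega>) * (w' * x l \<omega> * x m \<omega>)
       + (w * y k \<omega> * y j \<omega>) * (w' * d l \<omega> * x m \<omega> + w' * y l \<omega> * d m \<omega>)"
      using a1 a2 b1 b2 c1 c2 by (intro add_mono mult_mono) auto
    also have "\<dots> = w * w' * (E1 \<omega> + E2 \<omega> + E3 \<omega> + E4 \<omega>)"
      by (simp add: E1_def E2_def E3_def E4_def algebra_simps)
    finally show ?thesis .
  qed
  have f: "integrable M ?f" by (rule product_integrable_X[OF h h'])
  have g: "integrable M ?g" by (rule product_integrable_Y[OF h h'])
  have "\<bar>(\<integral>\<omega>. ?f \<omega> \<partial>M) - (\<integral>\<omega>. ?g \<omega> \<partial>M)\<bar> = \<bar>\<integral>\<omega>. ?f \<omega> - ?g \<omega> \<partial>M\<bar>"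
    using f g by simp
  also have "\<dots> \<le> (\<integral>\<omega>. w * w' * (E1 \<omega> + E2 \<omega> + E3 \<omega> + E4 \<omega>) \<partial>M)"
    by (rule order_trans[OF integral_abs_bound])
       (intro integral_mono integrable_abs Bochner_Integration.integrable_diff f g integrable_mult_right
         Bochner_Integration.integrable_add E1 E2 E3 E4 pt)
  also have "\<dots> = w * w' * ((\<integral>\<omega>. E1 \<omega> \<partial>M) + (\<integral>\<omega>. E2 \<omega> \<partial>M) + (\<integral>\<omega>. E3 \<omega> \<partial>M) + (\<integral>\<omega>. E4 \<omega> \<partial>M))"
    using E1 E2 E3 E4 by simp
  also have "\<dots> \<le> w * w' * (K * r ^ G + K * r ^ G + K * r ^ G + K * r ^ G)"
    using w by (intro mult_left_mono add_mono E1 E2 E3 E4) auto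
  finally show ?thesis by (simp add: algebra_simps)
qed

lemma splice_integral:
  fixes \<Phi> :: "(nat \<Rightarrow> real) \<Rightarrow> 'b :: {banach, second_countable_topology}"
  assumes \<Phi>[measurable]: "\<Phi> \<in> borel_measurable paths" and int: "integrable M (\<lambda>\<omega>. \<Phi> (\<lambda>k. Y a k \<omega>))"
  shows "integrable (M \<Otimes>\<^sub>M M) (\<lambda>(\<omega>, \<omega>'). \<Phi> (\<lambda>k. if k \<le> a then X k \<omega> else X k \<omega>'))"
    and "(\<integral>\<omega>. \<Phi> (\<lambda>k. Y a k \<omega>) \<partial>M) = (\<integral>(\<omega>, \<omega>'). \<Phi> (\<lambda>k. if k \<le> a then X k \<omega> else X k \<omega>') \<partial>(M \<Otimes>\<^sub>M M))"
proof -
  have mY: "(\<lambda>\<omega> k. Y a k \<omega>) \<in> measurable M paths"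
    and mS: "(\<lambda>(\<omega>, \<omega>') k. if k \<le> a then X k \<omega> else X k \<omega>') \<in> measurable (M \<Otimes>\<^sub>M M) paths"
    by (auto intro!: measurable_PiM_single' simp: split_def)
  have "integrable (distr M paths (\<lambda>\<omega> k. Y a k \<omega>)) \<Phi>"
    by (rule iffD2[OF integrable_distr_eq[OF mY \<Phi>] int])
  then show "integrable (M \<Otimes>\<^sub>M M) (\<lambda>(\<omega>, \<omega>'). \<Phi> (\<lambda>k. if k \<le> a then X k \<omega> else X k \<omega>'))"
    unfolding Y_law integrable_distr_eq[OF mS \<Phi>] by (simp add: split_def)
  have "(\<integral>\<omega>. \<Phi> (\<lambda>k. Y a k \<omega>) \<partial>M) = (\<integral>x. \<Phi> x \<partial>distr M paths (\<lambda>\<omega> k. Y a k \<omega>))"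
    by (rule integral_distr[OF mY \<Phi>, symmetric])
  also have "\<dots> = (\<integral>(\<omega>, \<omega>'). \<Phi> (\<lambda>k. if k \<le> a then X k \<omega> else X k \<omega>') \<partial>(M \<Otimes>\<^sub>M M))"
    unfolding Y_law integral_distr[OF mS \<Phi>] by (simp add: split_def)
  finally show "(\<integral>\<omega>. \<Phi> (\<lambda>k. Y a k \<omega>) \<partial>M) = (\<integral>(\<omega>, \<omega>'). \<Phi> (\<lambda>k. if k \<le> a then X k \<omega> else X k \<omega>') \<partial>(M \<Otimes>\<^sub>M M))" .
qed

lemma splice_product:
  fixes k j l m :: nat
  assumes h: "regular w h" and h': "regular w' h'"
  defines "\<Phi> \<equiv> \<lambda>x. h (x k) (x j) * h' (x l) (x m)"
  shows "integrable (M \<Otimes>\<^sub>M M) (\<lambda>(\<omega>, \<omega>'). \<Phi> (\<lambda>k. if k \<le> a then X k \<omega> else X k \<omega>'))"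
    and "(\<integral>\<omega>. h (Y a k \<omega>) (Y a j \<omega>) * h' (Y a l \<omega>) (Y a m \<omega>) \<partial>M)
      = (\<integral>(\<omega>, \<omega>'). \<Phi> (\<lambda>k. if k \<le> a then X k \<omega> else X k \<omega>') \<partial>(M \<Otimes>\<^sub>M M))"
proof -
  have \<Phi>: "\<Phi> \<in> borel_measurable paths"
    unfolding \<Phi>_def by (intro borel_measurable_times regular_measurable[OF h] regular_measurable[OF h'])  measurable
  have int: "integrable M (\<lambda>\<omega>. \<Phi> (\<lambda>k. Y a k \<omega>))"
    unfolding \<Phi>_def by (rule product_integrable_Y[OF h h'])
  show "integrable (M \<Otimes>\<^sub>M M) (\<lambda>(\<omega>, \<omega>'). \<Phi> (\<lambda>k. if k \<le> a then X k \<omega> else X k \<omega>'))"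
    by (rule splice_integral[OF \<Phi> int])
  show "(\<integral>\<omega>. h (Y a k \<omega>) (Y a j \<omega>) * h' (Y a l \<omega>) (Y a m \<omega>) \<partial>M)
      = (\<integral>(\<omega>, \<omega>'). \<Phi> (\<lambda>k. if k \<le> a then X k \<omega> else X k \<omega>') \<partial>(M \<Otimes>\<^sub>M M))"
    using splice_integral(2)[OF \<Phi> int] by (simp add: \<Phi>_def)
qed

text \<open>After splicing, the variable at the isolated first time is independent of all the others, so the
  degenerate kernel may be integrated in this variable alone.\<close>

lemma splice_first_zero:
  assumes h: "regular w h" and h': "regular w' h'"
    and deg: "\<And>y. (\<integral>\<omega>. h (X k \<omega>) y \<partial>M) = 0"
    and t: "k \<le> a" "a < j" "a < l" "a < m"
  shows "(\<integral>\<omega>. h (Y a k \<omega>) (Y a j \<omega>) * h' (Y a l \<omega>) (Y a m \<omega>) \<partial>M) = 0"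
proof -
  interpret P: pair_prob_space M M ..
  let ?f = "\<lambda>\<omega> \<omega>'. h (X k \<omega>) (X j \<omega>') * h' (X l \<omega>') (X m \<omega>')"
  have "integrable (M \<Otimes>\<^sub>M M) (case_prod ?f)"
    using splice_product(1)[OF h h', of k a j l m] t by simp
  from P.integral_snd[OF this] splice_product(2)[OF h h', of a k j l m] t show ?thesis
    by (simp add: deg)
qed

lemma splice_last_zero:
  assumes h: "regular w h" and h': "regular w' h'"
    and deg: "\<And>y. (\<integral>\<omega>. h (X k \<omega>) y \<partial>M) = 0"
    and t: "a < k" "j \<le> a" "l \<le> a" "m \<le> a"
  shows "(\<integral>\<omega>. h (Y a k \<omega>) (Y a j \<omega>) * h' (Y a l \<omega>) (Y a m \<omega>) \<partial>M) = 0"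
proof -
  interpret P: pair_prob_space M M ..
  let ?f = "\<lambda>\<omega> \<omega>'. h (X k \<omega>') (X j \<omega>) * h' (X l \<omega>) (X m \<omega>)"
  have "integrable (M \<Otimes>\<^sub>M M) (case_prod ?f)"
    using splice_product(1)[OF h h', of k a j l m] t by simp
  from P.integral_fst'[OF this] splice_product(2)[OF h h', of a k j l m] t show ?thesis
    by (simp add: deg)
qed

lemma splice_pair_factor:
  assumes h: "regular w h" and h': "regular w' h'"
    and t: "k \<le> a" "j \<le> a" "a < l" "a < m"
  shows "(\<integral>\<omega>. h (Y a k \<omega>) (Y a j \<omega>) * h' (Y a l \<omega>) (Y a m \<omega>) \<partial>M)
     = (\<integral>\<omega>. h (X k \<omega>) (X j \<omega>) \<partial>M) * (\<integral>\<omega>. h' (X l \<omega>) (X m \<omega>) \<partial>M)"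
proof -
  interpret P: pair_prob_space M M ..
  let ?f = "\<lambda>\<omega> \<omega>'. h (X k \<omega>) (X j \<omega>) * h' (X l \<omega>') (X m \<omega>')"
  have "integrable (M \<Otimes>\<^sub>M M) (case_prod ?f)"
    using splice_product(1)[OF h h', of k a j l m] t by simp
  from P.integral_fst'[OF this] splice_product(2)[OF h h', of a k j l m] t show ?thesis
    by simp
qed

lemma regular_one: "regular 1 (\<lambda>_ _. 1)"
  using lw_ge_1 lw_nonneg D_nonneg mult_mono[OF lw_ge_1 lw_ge_1]
  by (auto simp: regular_def)

end

section \<open>Covariances of degenerate kernels\<close>

definition ndist :: "nat \<Rightarrow> nat \<Rightarrow> nat" where
  "ndist a b = (a - b) + (b - a)"

lemma ndist_commute: "ndist a b = ndist b a" by (simp add: ndist_def)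

lemma sum_power_ndist_le:
  fixes R :: real
  assumes R: "0 < R" "R < 1" and B: "finite B"
  shows "(\<Sum>l\<in>B. R ^ ndist k l) \<le> 2 / (1 - R)"
proof -
  have geo: "(\<Sum>n\<in>I. R ^ n) \<le> 1 / (1 - R)" if "finite I" for I
    using sum_le_suminf[OF summable_geometric[of R] that] suminf_geometric[of R] R by simp
  have "(\<Sum>l\<in>B. R ^ ndist k l) = (\<Sum>l\<in>{l\<in>B. l \<le> k}. R ^ ndist k l) + (\<Sum>l\<in>{l\<in>B. \<not> l \<le> k}. R ^ ndist k l)"
    using B by (subst sum.union_disjoint[symmetric]) (auto intro!: sum.cong)
  also have "(\<Sum>l\<in>{l\<in>B. l \<le> k}. R ^ ndist k l) = (\<Sum>n\<in>(\<lambda>l. k - l) ` {l\<in>B. l \<le> k}. R ^ n)"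
    by (subst sum.reindex) (auto simp: inj_on_def ndist_def)
  also have "(\<Sum>l\<in>{l\<in>B. \<not> l \<le> k}. R ^ ndist k l) = (\<Sum>n\<in>(\<lambda>l. l - k) ` {l\<in>B. \<not> l \<le> k}. R ^ n)"
    by (subst sum.reindex) (auto simp: inj_on_def ndist_def)
  finally show ?thesis using geo[of "(\<lambda>l. k - l) ` {l\<in>B. l \<le> k}"] geo[of "(\<lambda>l. l - k) ` {l\<in>B. \<not> l \<le> k}"] B
    by simp
qed

text \<open>By 2 w_p w_q \<le> w_p^2 + w_q^2 and the symmetry of \<kappa>, only the row sums of \<kappa> matter.\<close>

lemma schur_test:
  fixes \<kappa> :: "'p \<Rightarrow> 'p \<Rightarrow> real" and w :: "'p \<Rightarrow> real"
  assumes fin: "finite P" and nonneg: "\<And>p q. 0 \<le> \<kappa> p q" and sym: "\<And>p q. \<kappa> p q = \<kappa> q p"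
    and row: "\<And>p. p \<in> P \<Longrightarrow> (\<Sum>q\<in>P. \<kappa> p q) \<le> S"
  shows "(\<Sum>p\<in>P. \<Sum>q\<in>P. w p * w q * \<kappa> p q) \<le> S * (\<Sum>p\<in>P. (w p)\<^sup>2)"
proof -
  have "(\<Sum>p\<in>P. \<Sum>q\<in>P. w p * w q * \<kappa> p q)
      \<le> (\<Sum>p\<in>P. \<Sum>q\<in>P. ((w p)\<^sup>2 * \<kappa> p q + (w q)\<^sup>2 * \<kappa> p q) / 2)"
  proof (intro sum_mono)
    fix p q
    have "w p * w q \<le> ((w p)\<^sup>2 + (w q)\<^sup>2) / 2"
      using zero_le_power2[of "w p - w q"] by (simp add: power2_diff)
    from mult_right_mono[OF this nonneg[of p q]]
    show "w p * w q * \<kappa> p q \<le> ((w p)\<^sup>2 * \<kappa> p q + (w q)\<^sup>2 * \<kappa> p q) / 2"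
      by (simp add: distrib_right)
  qed
  also have "\<dots> = ((\<Sum>p\<in>P. \<Sum>q\<in>P. (w p)\<^sup>2 * \<kappa> p q) + (\<Sum>p\<in>P. \<Sum>q\<in>P. (w q)\<^sup>2 * \<kappa> p q)) / 2"
    by (simp add: sum.distrib flip: sum_divide_distrib)
  also have "(\<Sum>p\<in>P. \<Sum>q\<in>P. (w q)\<^sup>2 * \<kappa> p q) = (\<Sum>p\<in>P. \<Sum>q\<in>P. (w p)\<^sup>2 * \<kappa> p q)"
    by (subst sum.swap) (simp add: sym)
  also have "((\<Sum>p\<in>P. \<Sum>q\<in>P. (w p)\<^sup>2 * \<kappa> p q) + (\<Sum>p\<in>P. \<Sum>q\<in>P. (w p)\<^sup>2 * \<kappa> p q)) / 2
     = (\<Sum>p\<in>P. (w p)\<^sup>2 * (\<Sum>q\<in>P. \<kappa> p q))"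
    unfolding sum_distrib_left by simp
  also have "\<dots> \<le> (\<Sum>p\<in>P. (w p)\<^sup>2 * S)"
    by (intro sum_mono mult_left_mono row) auto
  also have "\<dots> = S * (\<Sum>p\<in>P. (w p)\<^sup>2)"
    by (simp add: sum_distrib_left mult.commute)
  finally show ?thesis .
qed

context spliced_process
begin

text \<open>Splicing between the two times makes the expectation vanish.\<close>

lemma expectation_degenerate_le:
  assumes h: "regular w h" and deg: "\<And>y. (\<integral>\<omega>. h (X k \<omega>) y \<partial>M) = 0"
  shows "\<bar>\<integral>\<omega>. h (X k \<omega>) (X j \<omega>) \<partial>M\<bar> \<le> 4 * K * w * r ^ ndist k j"
proof -
  consider "k < j" | "j < k" | "k = j" by linarith
  then show ?thesis
  proof cases
    case 1
    have "\<bar>(\<integral>\<omega>. h (X k \<omega>) (X j \<omega>) * 1 \<partial>M) - (\<integral>\<omega>. h (Y k k \<omega>) (Y k j \<omega>) * 1 \<partial>M)\<bar> \<le> 4 * K * w * 1 * r ^ (j - k)"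
      by (rule splice_error[OF h regular_one, where l = j and m = j]) (use 1 in auto)
    moreover have "(\<integral>\<omega>. h (Y k k \<omega>) (Y k j \<omega>) * 1 \<partial>M) = 0"
      by (rule splice_first_zero[OF h regular_one deg, where l = j and m = j]) (use 1 in auto)
    ultimately show ?thesis using 1 by (simp add: ndist_def)
  next
    case 2
    have "\<bar>(\<integral>\<omega>. h (X k \<omega>) (X j \<omega>) * 1 \<partial>M) - (\<integral>\<omega>. h (Y j k \<omega>) (Y j j \<omega>) * 1 \<partial>M)\<bar> \<le> 4 * K * w * 1 * r ^ (k - j)"
      by (rule splice_error[OF h regular_one, where l = j and m = j]) (use 2 in auto)
    moreover have "(\<integral>\<omega>. h (Y j k \<omega>) (Y j j \<omega>) * 1 \<partial>M) = 0"
      by (rule splice_last_zero[OF h regular_one deg, where l = j and m = j]) (use 2 in auto)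
    ultimately show ?thesis using 2 by (simp add: ndist_def)
  next
    case 3
    have "0 \<le> w * K" using h K_ge_1 by (simp add: regular_def)
    then show ?thesis
      using product_integrable_X(2)[OF h regular_one, of k j] 3 by (simp add: ndist_def algebra_simps)
  qed
qed

end

text \<open>Kernels that integrate to zero in either variable, as do the completely degenerate terms of a
  Hoeffding decomposition.\<close>

locale degenerate_family = spliced_process +
  fixes h :: "nat \<Rightarrow> nat \<Rightarrow> real \<Rightarrow> real \<Rightarrow> real" and w :: "nat \<Rightarrow> nat \<Rightarrow> real"
  assumes reg: "\<And>k j. regular (w k j) (h k j)"
    and h_sym: "\<And>k j x y. h k j x y = h j k y x" and w_sym: "\<And>k j. w k j = w j k"
    and deg: "\<And>k j y. (\<integral>\<omega>. h k j (X k \<omega>) y \<partial>M) = 0"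
begin

definition hX :: "nat \<Rightarrow> nat \<Rightarrow> 'a \<Rightarrow> real" where
  "hX k j \<omega> = h k j (X k \<omega>) (X j \<omega>)"

definition cov :: "nat \<Rightarrow> nat \<Rightarrow> nat \<Rightarrow> nat \<Rightarrow> real" where
  "cov k j l m = (\<integral>\<omega>. hX k j \<omega> * hX l m \<omega> \<partial>M) - (\<integral>\<omega>. hX k j \<omega> \<partial>M) * (\<integral>\<omega>. hX l m \<omega> \<partial>M)"

lemma hX_sym: "hX k j = hX j k" by (simp add: hX_def fun_eq_iff h_sym[of k j])

lemma cov_sym: "cov k j l m = cov j k l m" "cov k j l m = cov k j m l" "cov k j l m = cov l m k j"
  unfolding cov_def by (simp_all add: hX_sym[of k j] hX_sym[of l m] mult.commute)

lemma w_nonneg: "0 \<le> w k j" using reg[of k j] by (simp add: regular_def)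

lemma hX_measurable [measurable]: "hX k j \<in> borel_measurable M"
  unfolding hX_def[abs_def] by (rule regular_measurable[OF reg]) auto

lemma hX_prod_integrable: "integrable M (\<lambda>\<omega>. hX k j \<omega> * hX l m \<omega>)"
  unfolding hX_def by (rule product_integrable_X[OF reg reg])

lemma hX_integrable: "integrable M (hX k j)"
  using product_integrable_X(1)[OF reg regular_one, of k j k j] by (simp add: hX_def[abs_def])

lemma mean_le: "\<bar>\<integral>\<omega>. hX k j \<omega> \<partial>M\<bar> \<le> 4 * K * w k j * r ^ ndist k j"
  unfolding hX_def by (rule expectation_degenerate_le[OF reg deg])

lemma mean_product_le:
  assumes "G \<le> ndist k j"
  shows "\<bar>(\<integral>\<omega>. hX k j \<omega> \<partial>M) * (\<integral>\<omega>. hX l m \<omega> \<partial>M)\<bar> \<le> 16 * K\<^sup>2 * (w k j * w l m) * r ^ G"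
proof -
  have "\<bar>\<integral>\<omega>. hX k j \<omega> \<partial>M\<bar> \<le> 4 * K * w k j * r ^ G"
    using assms r K_ge_1 w_nonneg[of k j]
    by (intro order_trans[OF mean_le] mult_left_mono power_decreasing) auto
  moreover have "\<bar>\<integral>\<omega>. hX l m \<omega> \<partial>M\<bar> \<le> 4 * K * w l m * 1"
    using r K_ge_1 w_nonneg[of l m]
    by (intro order_trans[OF mean_le] mult_left_mono power_le_one) auto
  ultimately have "\<bar>(\<integral>\<omega>. hX k j \<omega> \<partial>M)\<bar> * \<bar>(\<integral>\<omega>. hX l m \<omega> \<partial>M)\<bar> \<le> (4 * K * w k j * r ^ G) * (4 * K * w l m * 1)"
    using r K_ge_1 w_nonneg[of k j] by (intro mult_mono) auto
  then show ?thesis by (simp add: abs_mult power2_eq_square mult_ac)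
qed

lemma prod_bound_mono: "4 * K * w k j * w l m * r ^ G \<le> 4 * K\<^sup>2 * (w k j * w l m) * r ^ G"
proof -
  have "K * 1 \<le> K * K" using K_ge_1 by (intro mult_left_mono) auto
  then have "K * (4 * (w k j * w l m * r ^ G)) \<le> K\<^sup>2 * (4 * (w k j * w l m * r ^ G))"
    using r w_nonneg by (intro mult_right_mono) (auto simp: power2_eq_square)
  then show ?thesis by (simp add: mult_ac)
qed

lemma cov_trivial: "\<bar>cov k j l m\<bar> \<le> 20 * K\<^sup>2 * (w k j * w l m)"
proof -
  have "w k j * w l m * K \<le> 4 * K\<^sup>2 * (w k j * w l m)"
    using prod_bound_mono[of k j l m 0] mult_nonneg_nonneg[OF mult_nonneg_nonneg[OF w_nonneg w_nonneg], of K k j l m] K_ge_1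
    by (simp add: mult_ac)
  then have 1: "\<bar>(\<integral>\<omega>. hX k j \<omega> * hX l m \<omega> \<partial>M)\<bar> \<le> 4 * K\<^sup>2 * (w k j * w l m)"
    using product_integrable_X(2)[OF reg[of k j] reg[of l m], of k j l m]
    unfolding hX_def by (rule order_trans[rotated])
  have 2: "\<bar>(\<integral>\<omega>. hX k j \<omega> \<partial>M) * (\<integral>\<omega>. hX l m \<omega> \<partial>M)\<bar> \<le> 16 * K\<^sup>2 * (w k j * w l m)"
    using mean_product_le[of 0 k j l m] by simp
  have "20 * K\<^sup>2 * (w k j * w l m) = 4 * K\<^sup>2 * (w k j * w l m) + 16 * K\<^sup>2 * (w k j * w l m)"
    by (simp add: algebra_simps)
  then show ?thesis using 1 2 unfolding cov_def by linarith
qed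

text \<open>If the first time is isolated, then splicing behind it annihilates the mixed moment; the mean of the
  first kernel is small as well, since its two times are far apart.\<close>

lemma cov_isolated_first:
  assumes "k + G \<le> j" "k + G \<le> l" "k + G \<le> m"
  shows "\<bar>cov k j l m\<bar> \<le> 20 * K\<^sup>2 * (w k j * w l m) * r ^ G"
proof (cases "G = 0")
  case True
  then show ?thesis using cov_trivial by simp
next
  case False
  have "\<bar>(\<integral>\<omega>. hX k j \<omega> * hX l m \<omega> \<partial>M) - (\<integral>\<omega>. h k j (Y k k \<omega>) (Y k j \<omega>) * h l m (Y k l \<omega>) (Y k m \<omega>) \<partial>M)\<bar>
      \<le> 4 * K * w k j * w l m * r ^ G"
    unfolding hX_def by (rule splice_error[OF reg reg]) (use assms in auto)
  moreover have "(\<integral>\<omega>. h k j (Y k k \<omega>) (Y k j \<omega>) * h l m (Y k l \<omega>) (Y k m \<omega>) \<partial>M) = 0"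
    by (rule splice_first_zero[OF reg reg deg]) (use assms False in auto)
  ultimately have "\<bar>(\<integral>\<omega>. hX k j \<omega> * hX l m \<omega> \<partial>M)\<bar> \<le> 4 * K * w k j * w l m * r ^ G" by simp
  also note prod_bound_mono
  finally have 1: "\<bar>(\<integral>\<omega>. hX k j \<omega> * hX l m \<omega> \<partial>M)\<bar> \<le> 4 * K\<^sup>2 * (w k j * w l m) * r ^ G" .
  have 2: "\<bar>(\<integral>\<omega>. hX k j \<omega> \<partial>M) * (\<integral>\<omega>. hX l m \<omega> \<partial>M)\<bar> \<le> 16 * K\<^sup>2 * (w k j * w l m) * r ^ G"
    by (rule mean_product_le) (use assms in \<open>simp add: ndist_def\<close>)
  have "20 * K\<^sup>2 * (w k j * w l m) * r ^ G
      = 4 * K\<^sup>2 * (w k j * w l m) * r ^ G + 16 * K\<^sup>2 * (w k j * w l m) * r ^ G"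
    by (simp add: algebra_simps)
  then show ?thesis using 1 2 unfolding cov_def by linarith
qed

lemma cov_isolated_last:
  assumes "j + G \<le> k" "l + G \<le> k" "m + G \<le> k"
  shows "\<bar>cov k j l m\<bar> \<le> 20 * K\<^sup>2 * (w k j * w l m) * r ^ G"
proof (cases "G = 0")
  case True
  then show ?thesis using cov_trivial by simp
next
  case False
  \<comment> \<open>The last time is k, and the gap before it reaches back to k - G.\<close>
  let ?a = "k - G"
  have "\<bar>(\<integral>\<omega>. hX k j \<omega> * hX l m \<omega> \<partial>M) - (\<integral>\<omega>. h k j (Y ?a k \<omega>) (Y ?a j \<omega>) * h l m (Y ?a l \<omega>) (Y ?a m \<omega>) \<partial>M)\<bar>
      \<le> 4 * K * w k j * w l m * r ^ G"
    unfolding hX_def by (rule splice_error[OF reg reg]) (use assms in auto)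
  moreover have "(\<integral>\<omega>. h k j (Y ?a k \<omega>) (Y ?a j \<omega>) * h l m (Y ?a l \<omega>) (Y ?a m \<omega>) \<partial>M) = 0"
    by (rule splice_last_zero[OF reg reg deg]) (use assms False in auto)
  ultimately have "\<bar>(\<integral>\<omega>. hX k j \<omega> * hX l m \<omega> \<partial>M)\<bar> \<le> 4 * K * w k j * w l m * r ^ G" by simp
  also note prod_bound_mono
  finally have 1: "\<bar>(\<integral>\<omega>. hX k j \<omega> * hX l m \<omega> \<partial>M)\<bar> \<le> 4 * K\<^sup>2 * (w k j * w l m) * r ^ G" .
  have 2: "\<bar>(\<integral>\<omega>. hX k j \<omega> \<partial>M) * (\<integral>\<omega>. hX l m \<omega> \<partial>M)\<bar> \<le> 16 * K\<^sup>2 * (w k j * w l m) * r ^ G"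
    by (rule mean_product_le) (use assms in \<open>simp add: ndist_def\<close>)
  have "20 * K\<^sup>2 * (w k j * w l m) * r ^ G
      = 4 * K\<^sup>2 * (w k j * w l m) * r ^ G + 16 * K\<^sup>2 * (w k j * w l m) * r ^ G"
    by (simp add: algebra_simps)
  then show ?thesis using 1 2 unfolding cov_def by linarith
qed

text \<open>If a gap separates the two pairs, then splicing in it factorises the mixed moment.\<close>

lemma cov_separated_pairs:
  assumes "max k j + G \<le> l" "max k j + G \<le> m"
  shows "\<bar>cov k j l m\<bar> \<le> 20 * K\<^sup>2 * (w k j * w l m) * r ^ G"
proof (cases "G = 0")
  case True
  then show ?thesis using cov_trivial by simp
next
  case False
  let ?a = "max k j"
  have "\<bar>(\<integral>\<omega>. hX k j \<omega> * hX l m \<omega> \<partial>M) - (\<integral>\<omega>. h k j (Y ?a k \<omega>) (Y ?a j \<omega>) * h l m (Y ?a l \<omega>) (Y ?a m \<omega>) \<partial>M)\<bar>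
      \<le> 4 * K * w k j * w l m * r ^ G"
    unfolding hX_def by (rule splice_error[OF reg reg]) (use assms in auto)
  moreover have "(\<integral>\<omega>. h k j (Y ?a k \<omega>) (Y ?a j \<omega>) * h l m (Y ?a l \<omega>) (Y ?a m \<omega>) \<partial>M)
      = (\<integral>\<omega>. hX k j \<omega> \<partial>M) * (\<integral>\<omega>. hX l m \<omega> \<partial>M)"
    unfolding hX_def by (rule splice_pair_factor[OF reg reg]) (use assms False in auto)
  ultimately have "\<bar>cov k j l m\<bar> \<le> 4 * K * w k j * w l m * r ^ G" by (simp add: cov_def)
  also note prod_bound_mono
  also have "4 * K\<^sup>2 * (w k j * w l m) * r ^ G \<le> 20 * K\<^sup>2 * (w k j * w l m) * r ^ G"
    using w_nonneg r by (intro mult_right_mono) auto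
  finally show ?thesis .
qed

definition R where "R = root 4 r"

lemma R: "0 < R" "R < 1" "R ^ 4 = r"
  using r by (auto simp: R_def)

lemma rate_le:
  assumes "u \<le> 4 * G"
  shows "r ^ G \<le> R ^ u"
proof -
  have "r ^ G = R ^ (4 * G)" using R(3) by (simp add: power_mult)
  also have "\<dots> \<le> R ^ u" using assms R by (intro power_decreasing) auto
  finally show ?thesis .
qed

lemma cov_gap:
  assumes "\<bar>cov k j l m\<bar> \<le> 20 * K\<^sup>2 * (w k j * w l m) * r ^ G" "u \<le> 4 * G"
  shows "\<bar>cov k j l m\<bar> \<le> 20 * K\<^sup>2 * (w k j * w l m) * R ^ u"
  using assms(1) mult_left_mono[OF rate_le[OF assms(2)], of "20 * K\<^sup>2 * (w k j * w l m)"] w_nonneg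
  by (auto intro: order_trans)

text \<open>Order the four times. The first and the last gap always yield decay. The middle gap does so if it
  separates the two pairs; if it does not, each of its sides contains one time of either pair, and then
  the first and the last gap alone bound the distance of the two pairs. In every case this distance is at
  most four times the largest useful gap, whence the fourth root of the rate.\<close>

lemma cov_sorted:
  assumes "k \<le> j" "k \<le> l" "l \<le> m"
  shows "\<bar>cov k j l m\<bar> \<le> 20 * K\<^sup>2 * (w k j * w l m) * R ^ (ndist k l + ndist j m)"
proof -
  have c1: "cov k j l m = cov m l k j" and c2: "cov k j l m = cov j k l m"
    using cov_sym by metis+
  have wc: "w k j * w l m = w m l * w k j" "w k j * w l m = w j k * w l m"
    using w_sym by (metis mult.commute)+
  consider "j \<le> l" | "l \<le> j" "j \<le> m" | "m \<le> j" using assms by linarith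
  then show ?thesis
  proof cases
    case 1
    have u: "ndist k l + ndist j m \<le> 4 * max (j - k) (max (l - j) (m - l))"
      using assms 1 by (auto simp: ndist_def)
    have g1: "\<bar>cov k j l m\<bar> \<le> 20 * K\<^sup>2 * (w k j * w l m) * r ^ (j - k)"
      using assms 1 by (intro cov_isolated_first) auto
    have g2: "\<bar>cov k j l m\<bar> \<le> 20 * K\<^sup>2 * (w k j * w l m) * r ^ (l - j)"
      using assms 1 by (intro cov_separated_pairs) auto
    have g3: "\<bar>cov k j l m\<bar> \<le> 20 * K\<^sup>2 * (w k j * w l m) * r ^ (m - l)"
      unfolding c1 wc(1) using assms 1 by (intro cov_isolated_last) auto
    have "\<bar>cov k j l m\<bar> \<le> 20 * K\<^sup>2 * (w k j * w l m) * r ^ max (j - k) (max (l - j) (m - l))"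
      using g1 g2 g3 by (simp add: max_def)
    then show ?thesis using u by (rule cov_gap)
  next
    case 2
    have u: "ndist k l + ndist j m \<le> 4 * max (l - k) (m - j)"
      using assms 2 by (auto simp: ndist_def)
    have g1: "\<bar>cov k j l m\<bar> \<le> 20 * K\<^sup>2 * (w k j * w l m) * r ^ (l - k)"
      using assms 2 by (intro cov_isolated_first) auto
    have g3: "\<bar>cov k j l m\<bar> \<le> 20 * K\<^sup>2 * (w k j * w l m) * r ^ (m - j)"
      unfolding c1 wc(1) using assms 2 by (intro cov_isolated_last) auto
    have "\<bar>cov k j l m\<bar> \<le> 20 * K\<^sup>2 * (w k j * w l m) * r ^ max (l - k) (m - j)"
      using g1 g3 by (simp add: max_def)
    then show ?thesis using u by (rule cov_gap)
  next
    case 3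
    have u: "ndist k l + ndist j m \<le> 4 * max (l - k) (j - m)"
      using assms 3 by (auto simp: ndist_def)
    have g1: "\<bar>cov k j l m\<bar> \<le> 20 * K\<^sup>2 * (w k j * w l m) * r ^ (l - k)"
      using assms 3 by (intro cov_isolated_first) auto
    have g3: "\<bar>cov k j l m\<bar> \<le> 20 * K\<^sup>2 * (w k j * w l m) * r ^ (j - m)"
      unfolding c2 wc(2) using assms 3 by (intro cov_isolated_last) auto
    have "\<bar>cov k j l m\<bar> \<le> 20 * K\<^sup>2 * (w k j * w l m) * r ^ max (l - k) (j - m)"
      using g1 g3 by (simp add: max_def)
    then show ?thesis using u by (rule cov_gap)
  qed
qed

text \<open>Decay in the distance of two pairs of times, for both ways of matching them.\<close>

definition \<kappa> :: "nat \<times> nat \<Rightarrow> nat \<times> nat \<Rightarrow> real" where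
  "\<kappa> = (\<lambda>(k, j) (l, m). R ^ (ndist k l + ndist j m) + R ^ (ndist k m + ndist j l))"

lemma \<kappa>_sym: "\<kappa> (k, j) (l, m) = \<kappa> (j, k) (l, m)" "\<kappa> (k, j) (l, m) = \<kappa> (k, j) (m, l)"
  "\<kappa> p q = \<kappa> q p"
  by (auto simp: \<kappa>_def ndist_commute add.commute split: prod.splits)

text \<open>All the symmetries of the covariance preserve \<kappa>, so it suffices to treat ordered times.\<close>

lemma cov_le: "\<bar>cov k j l m\<bar> \<le> 20 * K\<^sup>2 * (w k j * w l m) * \<kappa> (k, j) (l, m)"
proof -
  have sorted: "\<bar>cov k j l m\<bar> \<le> 20 * K\<^sup>2 * (w k j * w l m) * \<kappa> (k, j) (l, m)"
    if "k \<le> j" "k \<le> l" "l \<le> m" for k j l m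
  proof (rule order_trans[OF cov_sorted[OF that]])
    show "20 * K\<^sup>2 * (w k j * w l m) * R ^ (ndist k l + ndist j m) \<le> 20 * K\<^sup>2 * (w k j * w l m) * \<kappa> (k, j) (l, m)"
      using w_nonneg R by (intro mult_left_mono) (auto simp: \<kappa>_def)
  qed
  have minl: "\<bar>cov k j l m\<bar> \<le> 20 * K\<^sup>2 * (w k j * w l m) * \<kappa> (k, j) (l, m)"
    if "k \<le> j" "k \<le> l" "k \<le> m" for k j l m
  proof (cases "l \<le> m")
    case True with that show ?thesis by (intro sorted) auto
  next
    case False
    with that have "\<bar>cov k j m l\<bar> \<le> 20 * K\<^sup>2 * (w k j * w m l) * \<kappa> (k, j) (m, l)" by (intro sorted) auto
    then show ?thesis by (simp add: cov_sym(2)[of k j m l] w_sym[of m l] \<kappa>_sym(2)[of k j m l])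
  qed
  consider "k \<le> j" "k \<le> l" "k \<le> m" | "j \<le> k" "j \<le> l" "j \<le> m" | "l \<le> k" "l \<le> j" "l \<le> m" | "m \<le> k" "m \<le> j" "m \<le> l"
    by linarith
  then show ?thesis
  proof cases
    case 1 then show ?thesis by (rule minl)
  next
    case 2
    then have "\<bar>cov j k l m\<bar> \<le> 20 * K\<^sup>2 * (w j k * w l m) * \<kappa> (j, k) (l, m)" by (intro minl) auto
    then show ?thesis by (simp add: cov_sym(1)[of j k l m] w_sym[of j k] \<kappa>_sym(1)[of j k l m])
  next
    case 3
    then have "\<bar>cov l m k j\<bar> \<le> 20 * K\<^sup>2 * (w l m * w k j) * \<kappa> (l, m) (k, j)" by (intro minl) auto
    then show ?thesis
      by (simp add: cov_sym(3)[of l m k j] \<kappa>_sym(3)[of "(l, m)" "(k, j)"] mult.commute[of "w l m" "w k j"])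
  next
    case 4
    then have "\<bar>cov m l k j\<bar> \<le> 20 * K\<^sup>2 * (w m l * w k j) * \<kappa> (m, l) (k, j)" by (intro minl) auto
    then show ?thesis
      by (simp add: cov_sym(1)[of m l k j] w_sym[of m l] \<kappa>_sym(1)[of m l k j]
          cov_sym(3)[of l m k j] \<kappa>_sym(3)[of "(l, m)" "(k, j)"] mult.commute[of "w l m" "w k j"])
  qed
qed

definition Q :: "nat set \<Rightarrow> 'a \<Rightarrow> real" where
  "Q B \<omega> = (\<Sum>k\<in>B. \<Sum>j\<in>B. hX k j \<omega>)"

lemma Q_pairs: "Q B \<omega> = (\<Sum>p\<in>B \<times> B. hX (fst p) (snd p) \<omega>)"
  by (simp add: Q_def sum.cartesian_product split_def)

lemma Q_measurable [measurable]: "Q B \<in> borel_measurable M"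
  unfolding Q_def[abs_def] by measurable

lemma Q_integrable: "integrable M (Q B)"
  unfolding Q_def[abs_def] by (intro Bochner_Integration.integrable_sum hX_integrable)

lemma Q_sq: "(Q B \<omega>)\<^sup>2 = (\<Sum>p\<in>B \<times> B. \<Sum>q\<in>B \<times> B. hX (fst p) (snd p) \<omega> * hX (fst q) (snd q) \<omega>)"
  unfolding Q_pairs power2_eq_square by (simp add: sum_product)

lemma Q_square_integrable: "integrable M (\<lambda>\<omega>. (Q B \<omega>)\<^sup>2)"
  unfolding Q_sq by (intro Bochner_Integration.integrable_sum hX_prod_integrable)

definition S where "S = 2 / (1 - R)"

lemma S_pos: "0 < S" using R by (simp add: S_def)

text \<open>For a fixed pair of times, the covariances with all other pairs are summable, so the Schur test
  bounds the variance by the sum of the squared weights.\<close>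

lemma Q_variance_le:
  assumes B: "finite B"
  shows "(\<integral>\<omega>. (Q B \<omega>)\<^sup>2 \<partial>M) - (\<integral>\<omega>. Q B \<omega> \<partial>M)\<^sup>2 \<le> 40 * K\<^sup>2 * S\<^sup>2 * (\<Sum>k\<in>B. \<Sum>j\<in>B. (w k j)\<^sup>2)"
proof -
  let ?P = "B \<times> B" and ?w = "\<lambda>p. w (fst p) (snd p)"
  have mean: "(\<integral>\<omega>. Q B \<omega> \<partial>M) = (\<Sum>p\<in>?P. \<integral>\<omega>. hX (fst p) (snd p) \<omega> \<partial>M)"
    unfolding Q_pairs by (intro Bochner_Integration.integral_sum hX_integrable)
  have sq: "(\<integral>\<omega>. (Q B \<omega>)\<^sup>2 \<partial>M) = (\<Sum>p\<in>?P. \<Sum>q\<in>?P. \<integral>\<omega>. hX (fst p) (snd p) \<omega> * hX (fst q) (snd q) \<omega> \<partial>M)"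
    unfolding Q_sq
    by (simp add: Bochner_Integration.integral_sum Bochner_Integration.integrable_sum hX_prod_integrable)
  have "(\<integral>\<omega>. (Q B \<omega>)\<^sup>2 \<partial>M) - (\<integral>\<omega>. Q B \<omega> \<partial>M)\<^sup>2
      = (\<Sum>p\<in>?P. \<Sum>q\<in>?P. cov (fst p) (snd p) (fst q) (snd q))"
    unfolding sq mean unfolding power2_eq_square sum_product cov_def by (simp add: sum_subtractf)
  also have "\<dots> \<le> (\<Sum>p\<in>?P. \<Sum>q\<in>?P. 20 * K\<^sup>2 * (?w p * ?w q * \<kappa> p q))"
  proof (intro sum_mono)
    fix p q
    show "cov (fst p) (snd p) (fst q) (snd q) \<le> 20 * K\<^sup>2 * (?w p * ?w q * \<kappa> p q)"
      using cov_le[of "fst p" "snd p" "fst q" "snd q"] by (simp add: mult.assoc)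
  qed
  also have "\<dots> = 20 * K\<^sup>2 * (\<Sum>p\<in>?P. \<Sum>q\<in>?P. ?w p * ?w q * \<kappa> p q)"
    by (simp add: sum_distrib_left)
  also have "\<dots> \<le> 20 * K\<^sup>2 * (2 * S\<^sup>2 * (\<Sum>p\<in>?P. (?w p)\<^sup>2))"
  proof (intro mult_left_mono schur_test)
    fix p q
    show "0 \<le> \<kappa> p q" using R by (auto simp: \<kappa>_def split: prod.splits)
    show "\<kappa> p q = \<kappa> q p" by (rule \<kappa>_sym)
  next
    fix p assume "p \<in> ?P"
    have row: "(\<Sum>l\<in>B. R ^ ndist k l) \<le> S" "0 \<le> (\<Sum>l\<in>B. R ^ ndist k l)" for k
      unfolding S_def using R B by (auto intro: sum_power_ndist_le sum_nonneg)
    obtain k j where p: "p = (k, j)" by (cases p)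
    have "(\<Sum>q\<in>?P. \<kappa> p q) = (\<Sum>l\<in>B. \<Sum>m\<in>B. R ^ ndist k l * R ^ ndist j m)
        + (\<Sum>l\<in>B. \<Sum>m\<in>B. R ^ ndist j l * R ^ ndist k m)"
      by (simp add: p \<kappa>_def sum.cartesian_product[symmetric] split_def sum.distrib power_add mult.commute)
         (simp add: sum.cartesian_product split_def mult.commute)
    also have "\<dots> = (\<Sum>l\<in>B. R ^ ndist k l) * (\<Sum>m\<in>B. R ^ ndist j m)
        + (\<Sum>l\<in>B. R ^ ndist j l) * (\<Sum>m\<in>B. R ^ ndist k m)"
      by (simp add: sum_product)
    also have "\<dots> \<le> S * S + S * S"
      using row S_pos by (intro add_mono mult_mono) auto
    finally show "(\<Sum>q\<in>?P. \<kappa> p q) \<le> 2 * S\<^sup>2" by (simp add: power2_eq_square)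
  qed (use B in auto)
  also have "(\<Sum>p\<in>?P. (?w p)\<^sup>2) = (\<Sum>k\<in>B. \<Sum>j\<in>B. (w k j)\<^sup>2)"
    by (simp add: sum.cartesian_product split_def)
  finally show ?thesis by simp
qed

end

section \<open>Linear statistics\<close>

lemma exp_minus_first_order:
  fixes x :: real
  assumes x: "0 \<le> x"
  shows "\<bar>exp (- x) - (1 - x)\<bar> \<le> x\<^sup>2"
proof -
  have "1 - x \<le> exp (- x)" using exp_ge_add_one_self[of "- x"] by simp
  moreover have "exp (- x) \<le> 1 - x + x\<^sup>2"
  proof -
    have "exp (- x) * (1 + x) \<le> exp (- x) * exp x" by (intro mult_left_mono exp_ge_add_one_self) auto
    also have "\<dots> = 1" by (simp flip: exp_add)
    also have "1 \<le> (1 - x + x\<^sup>2) * (1 + x)"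
      using zero_le_power[OF x, of 3] by (simp add: algebra_simps power2_eq_square power3_eq_cube)
    finally show ?thesis using x by (simp add: mult_le_cancel_right)
  qed
  ultimately show ?thesis by linarith
qed

locale linear_family = spliced_process +
  fixes y :: "nat \<Rightarrow> real \<Rightarrow> real" and v :: "nat \<Rightarrow> real"
  assumes v_nonneg: "\<And>k. 0 \<le> v k" and y_measurable [measurable]: "\<And>k. y k \<in> borel_measurable borel"
    and y_le: "\<And>k x. \<bar>y k x\<bar> \<le> v k * lw x"
    and y_diff: "\<And>k x x'. \<bar>y k x - y k x'\<bar> \<le> v k * D x x'"
    and y_centred: "\<And>k. (\<integral>\<omega>. y k (X k \<omega>) \<partial>M) = 0"
begin

text \<open>The square of a linear statistic is the quadratic form with this kernel. The variance bound for
  degenerate quadratic forms thus gives the fourth moments of linear statistics.\<close>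

lemma product_regular: "regular (v k * v j) (\<lambda>x z. y k x * y j z)"
  unfolding regular_def
proof (intro conjI allI)
  show "(\<lambda>(x, z). y k x * y j z) \<in> borel_measurable (borel \<Otimes>\<^sub>M borel)" by measurable
  fix x x' z z'
  have "\<bar>y k x\<bar> * \<bar>y j z\<bar> \<le> (v k * lw x) * (v j * lw z)"
    using v_nonneg lw_nonneg by (intro mult_mono y_le) auto
  then show "\<bar>y k x * y j z\<bar> \<le> v k * v j * lw x * lw z" by (simp add: abs_mult mult_ac)
  have "\<bar>y k x - y k x'\<bar> * \<bar>y j z\<bar> \<le> (v k * D x x') * (v j * lw z)"
    using v_nonneg D_nonneg by (intro mult_mono y_le y_diff) auto
  moreover have "y k x * y j z - y k x' * y j z = (y k x - y k x') * y j z" by (simp add: algebra_simps)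
  ultimately show "\<bar>y k x * y j z - y k x' * y j z\<bar> \<le> v k * v j * D x x' * lw z"
    by (simp only: abs_mult mult_ac)
  have "\<bar>y k x\<bar> * \<bar>y j z - y j z'\<bar> \<le> (v k * lw x) * (v j * D z z')"
    using v_nonneg lw_nonneg by (intro mult_mono y_le y_diff) auto
  moreover have "y k x * y j z - y k x * y j z' = y k x * (y j z - y j z')" by (simp add: algebra_simps)
  ultimately show "\<bar>y k x * y j z - y k x * y j z'\<bar> \<le> v k * v j * lw x * D z z'"
    by (simp only: abs_mult mult_ac)
qed (use v_nonneg in auto)

sublocale sq: degenerate_family M X Y lw D K r "\<lambda>k j x z. y k x * y j z" "\<lambda>k j. v k * v j"
  by unfold_locales (auto intro: product_regular simp: mult.commute y_centred)

definition Lin :: "nat set \<Rightarrow> 'a \<Rightarrow> real" where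
  "Lin B \<omega> = (\<Sum>k\<in>B. y k (X k \<omega>))"

lemma Lin_measurable [measurable]: "Lin B \<in> borel_measurable M"
  unfolding Lin_def[abs_def] by measurable

lemma Lin_product: "Lin A \<omega> * Lin B \<omega> = (\<Sum>k\<in>A. \<Sum>j\<in>B. sq.hX k j \<omega>)"
  by (simp add: Lin_def sum_product sq.hX_def)

lemma Lin_square: "(Lin B \<omega>)\<^sup>2 = sq.Q B \<omega>"
  by (simp add: power2_eq_square Lin_product sq.Q_def)

lemma Lin_fourth: "Lin B \<omega> ^ 4 = (sq.Q B \<omega>)\<^sup>2"
  by (simp flip: Lin_square power_mult)

lemma Lin_square_integrable: "integrable M (\<lambda>\<omega>. (Lin B \<omega>)\<^sup>2)"
  unfolding Lin_square by (rule sq.Q_integrable)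

lemma Lin_fourth_integrable: "integrable M (\<lambda>\<omega>. Lin B \<omega> ^ 4)"
  unfolding Lin_fourth by (rule sq.Q_square_integrable)

lemma Lin_integrable: "integrable M (Lin B)"
  by (rule square_integrable_imp_integrable) (auto intro: Lin_square_integrable)

lemma Lin_mean: "integral\<^sup>L M (Lin B) = 0"
proof -
  have "integrable M (\<lambda>\<omega>. y k (X k \<omega>))" for k
    using Lin_integrable[of "{k}"] by (simp add: Lin_def[abs_def])
  then show ?thesis unfolding Lin_def[abs_def] by (simp add: Bochner_Integration.integral_sum y_centred)
qed

definition C2 where "C2 = 8 * K / (1 - r)"
definition C4 where "C4 = 40 * K\<^sup>2 * sq.S\<^sup>2 + C2\<^sup>2"

lemma C2_nonneg: "0 \<le> C2" using K_ge_1 r by (simp add: C2_def)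
lemma C4_nonneg: "0 \<le> C4" by (simp add: C4_def)

lemma Lin_second_moment:
  assumes B: "finite B"
  shows "(\<integral>\<omega>. (Lin B \<omega>)\<^sup>2 \<partial>M) \<le> C2 * (\<Sum>k\<in>B. (v k)\<^sup>2)"
proof -
  have "(\<integral>\<omega>. (Lin B \<omega>)\<^sup>2 \<partial>M) = (\<Sum>k\<in>B. \<Sum>j\<in>B. \<integral>\<omega>. sq.hX k j \<omega> \<partial>M)"
    unfolding Lin_square sq.Q_def
    by (simp add: Bochner_Integration.integral_sum Bochner_Integration.integrable_sum sq.hX_integrable)
  also have "\<dots> \<le> (\<Sum>k\<in>B. \<Sum>j\<in>B. v k * v j * (4 * K * r ^ ndist k j))"
  proof (intro sum_mono)
    fix k j
    show "(\<integral>\<omega>. sq.hX k j \<omega> \<partial>M) \<le> v k * v j * (4 * K * r ^ ndist k j)"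
      using sq.mean_le[of k j] by (simp add: mult_ac)
  qed
  also have "\<dots> \<le> C2 * (\<Sum>k\<in>B. (v k)\<^sup>2)"
  proof (rule schur_test[OF B])
    fix k
    show "(\<Sum>j\<in>B. 4 * K * r ^ ndist k j) \<le> C2"
      using mult_left_mono[OF sum_power_ndist_le[OF r B, of k], of "4 * K"] K_ge_1
      by (simp add: C2_def sum_distrib_left)
  qed (use K_ge_1 r in \<open>auto simp: ndist_commute\<close>)
  finally show ?thesis .
qed

lemma Lin_fourth_moment:
  assumes B: "finite B"
  shows "(\<integral>\<omega>. Lin B \<omega> ^ 4 \<partial>M) \<le> C4 * (\<Sum>k\<in>B. (v k)\<^sup>2)\<^sup>2"
proof -
  let ?V = "\<Sum>k\<in>B. (v k)\<^sup>2"
  have "(\<integral>\<omega>. sq.Q B \<omega> \<partial>M) \<le> C2 * ?V" "0 \<le> (\<integral>\<omega>. sq.Q B \<omega> \<partial>M)"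
    using Lin_second_moment[OF B] by (auto simp flip: Lin_square)
  then have "(\<integral>\<omega>. sq.Q B \<omega> \<partial>M)\<^sup>2 \<le> (C2 * ?V)\<^sup>2" by (rule power_mono)
  moreover have "(\<Sum>k\<in>B. \<Sum>j\<in>B. (v k * v j)\<^sup>2) = ?V\<^sup>2"
    by (simp add: power2_eq_square[of ?V] sum_product power_mult_distrib)
  ultimately show ?thesis
    using sq.Q_variance_le[OF B] unfolding Lin_fourth C4_def by (simp add: power_mult_distrib algebra_simps)
qed

lemma Lin_cross_moment:
  assumes g: "\<And>k j. k \<in> A \<Longrightarrow> j \<in> B \<Longrightarrow> g \<le> ndist k j"
  shows "integrable M (\<lambda>\<omega>. Lin A \<omega> * Lin B \<omega>)"
    and "\<bar>\<integral>\<omega>. Lin A \<omega> * Lin B \<omega> \<partial>M\<bar> \<le> 4 * K * r ^ g * ((\<Sum>k\<in>A. v k) * (\<Sum>k\<in>B. v k))"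
proof -
  show "integrable M (\<lambda>\<omega>. Lin A \<omega> * Lin B \<omega>)"
    unfolding Lin_product by (intro Bochner_Integration.integrable_sum sq.hX_integrable)
  have "(\<integral>\<omega>. Lin A \<omega> * Lin B \<omega> \<partial>M) = (\<Sum>k\<in>A. \<Sum>j\<in>B. \<integral>\<omega>. sq.hX k j \<omega> \<partial>M)"
    unfolding Lin_product
    by (simp add: Bochner_Integration.integral_sum Bochner_Integration.integrable_sum sq.hX_integrable)
  also have "\<bar>\<dots>\<bar> \<le> (\<Sum>k\<in>A. \<Sum>j\<in>B. 4 * K * r ^ g * (v k * v j))"
  proof (intro order_trans[OF sum_abs] sum_mono)
    fix k j assume kj: "k \<in> A" "j \<in> B"
    have "\<bar>\<integral>\<omega>. sq.hX k j \<omega> \<partial>M\<bar> \<le> 4 * K * (v k * v j) * r ^ ndist k j" by (rule sq.mean_le)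
    also have "\<dots> \<le> 4 * K * (v k * v j) * r ^ g"
      using K_ge_1 v_nonneg r g[OF kj] by (intro mult_left_mono power_decreasing) auto
    finally show "\<bar>\<integral>\<omega>. sq.hX k j \<omega> \<partial>M\<bar> \<le> 4 * K * r ^ g * (v k * v j)" by (simp add: mult_ac)
  qed
  also have "\<dots> = 4 * K * r ^ g * ((\<Sum>k\<in>A. v k) * (\<Sum>k\<in>B. v k))"
    by (simp only: sum_product) (simp only: sum_distrib_left)
  finally show "\<bar>\<integral>\<omega>. Lin A \<omega> * Lin B \<omega> \<partial>M\<bar> \<le> 4 * K * r ^ g * ((\<Sum>k\<in>A. v k) * (\<Sum>k\<in>B. v k))" .
qed

definition chf :: "real \<Rightarrow> nat set \<Rightarrow> complex" where
  "chf u B = (\<integral>\<omega>. iexp (u * Lin B \<omega>) \<partial>M)"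

lemma iexp_integrable: "Z \<in> borel_measurable M \<Longrightarrow> integrable M (\<lambda>\<omega>. iexp (Z \<omega>))"
  by (rule integrable_const_bound[where B = 1]) auto

lemma norm_chf_le_1: "norm (chf u B) \<le> 1"
proof -
  have "norm (chf u B) \<le> (\<integral>\<omega>. norm (iexp (u * Lin B \<omega>)) \<partial>M)"
    unfolding chf_def by (rule integral_norm_bound)
  then show ?thesis by (simp add: prob_space)
qed

lemma D_first_moment:
  assumes "t \<le> a \<or> a + G \<le> t"
  shows "integrable M (\<lambda>\<omega>. D (X t \<omega>) (Y a t \<omega>))" "(\<integral>\<omega>. D (X t \<omega>) (Y a t \<omega>) \<partial>M) \<le> K * r ^ G"
  using expectation_product_four[of "\<lambda>\<omega>. D (X t \<omega>) (Y a t \<omega>)" "\<lambda>_. 1" "\<lambda>_. 1" "\<lambda>_. 1" K "r ^ G"]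
    D_nonneg D_moment(1) D_moment_gap[OF assms] K_ge_1 r by (auto simp: prob_space)

text \<open>Splicing in the gap replaces the variables after it by independent ones, for which the characteristic
  function factors.\<close>

lemma chf_decouple:
  assumes A: "finite A" "A \<subseteq> {..a}" and B: "finite B" "\<And>k. k \<in> B \<Longrightarrow> a < k \<and> a + g \<le> k"
  shows "norm (chf u (A \<union> B) - chf u A * chf u B) \<le> \<bar>u\<bar> * K * r ^ g * (\<Sum>k\<in>B. v k)"
proof -
  interpret P: pair_prob_space M M ..
  have disj: "A \<inter> B = {}" using A B by force
  define \<Phi> where "\<Phi> x = iexp (u * (\<Sum>k\<in>A \<union> B. y k (x k)))" for x :: "nat \<Rightarrow> real"
  have \<Phi>[measurable]: "\<Phi> \<in> borel_measurable paths" unfolding \<Phi>_def[abs_def] by measurable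
  have XY[measurable]: "(\<lambda>\<omega> k. X k \<omega>) \<in> measurable M paths" "(\<lambda>\<omega> k. Y a k \<omega>) \<in> measurable M paths"
    by (auto intro!: measurable_PiM_single')
  have iX: "integrable M (\<lambda>\<omega>. \<Phi> (\<lambda>k. X k \<omega>))" and iY: "integrable M (\<lambda>\<omega>. \<Phi> (\<lambda>k. Y a k \<omega>))"
    unfolding \<Phi>_def by (rule iexp_integrable, measurable)+
  have eX: "chf u (A \<union> B) = (\<integral>\<omega>. \<Phi> (\<lambda>k. X k \<omega>) \<partial>M)" by (simp add: chf_def \<Phi>_def Lin_def)
  have sp: "\<Phi> (\<lambda>k. if k \<le> a then X k \<omega> else X k \<omega>') = iexp (u * Lin A \<omega>) * iexp (u * Lin B \<omega>')" for \<omega> \<omega>'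
  proof -
    have "(\<Sum>k\<in>A \<union> B. y k (if k \<le> a then X k \<omega> else X k \<omega>')) = Lin A \<omega> + Lin B \<omega>'"
      unfolding Lin_def sum.union_disjoint[OF A(1) B(1) disj]
      using A B by (intro arg_cong2[where f = "(+)"] sum.cong) (auto dest: B(2))
    then show ?thesis by (simp add: \<Phi>_def distrib_left exp_add)
  qed
  have int: "integrable (M \<Otimes>\<^sub>M M) (\<lambda>(\<omega>, \<omega>'). iexp (u * Lin A \<omega>) * iexp (u * Lin B \<omega>'))"
    using splice_integral(1)[OF \<Phi> iY] by (simp add: sp)
  have "(\<integral>\<omega>. \<Phi> (\<lambda>k. Y a k \<omega>) \<partial>M) = (\<integral>(\<omega>, \<omega>'). iexp (u * Lin A \<omega>) * iexp (u * Lin B \<omega>') \<partial>(M \<Otimes>\<^sub>M M))"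
    using splice_integral(2)[OF \<Phi> iY] by (simp add: sp)
  also have "\<dots> = (\<integral>\<omega>. (\<integral>\<omega>'. iexp (u * Lin A \<omega>) * iexp (u * Lin B \<omega>') \<partial>M) \<partial>M)"
    using P.integral_fst'[OF int] by simp
  also have "\<dots> = chf u A * chf u B" by (simp add: chf_def)
  finally have eY: "(\<integral>\<omega>. \<Phi> (\<lambda>k. Y a k \<omega>) \<partial>M) = chf u A * chf u B" .
  have gap: "k \<le> a \<or> a + g \<le> k" if "k \<in> B" for k using B(2)[OF that] by auto
  have Dint: "integrable M (\<lambda>\<omega>. \<bar>u\<bar> * (\<Sum>k\<in>B. v k * D (X k \<omega>) (Y a k \<omega>)))"
    by (intro integrable_mult_right Bochner_Integration.integrable_sum D_first_moment(1)[OF gap])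
  have pt: "norm (\<Phi> (\<lambda>k. X k \<omega>) - \<Phi> (\<lambda>k. Y a k \<omega>)) \<le> \<bar>u\<bar> * (\<Sum>k\<in>B. v k * D (X k \<omega>) (Y a k \<omega>))"
    if \<omega>: "\<omega> \<in> space M" for \<omega>
  proof -
    have "norm (\<Phi> (\<lambda>k. X k \<omega>) - \<Phi> (\<lambda>k. Y a k \<omega>))
        \<le> \<bar>u * (\<Sum>k\<in>A \<union> B. y k (X k \<omega>)) - u * (\<Sum>k\<in>A \<union> B. y k (Y a k \<omega>))\<bar>"
      unfolding \<Phi>_def by (rule order_trans[OF norm_iexp_diff_le min.cobounded2])
    also have "\<dots> = \<bar>u\<bar> * \<bar>\<Sum>k\<in>A \<union> B. y k (X k \<omega>) - y k (Y a k \<omega>)\<bar>"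
      by (simp add: sum_subtractf abs_mult flip: right_diff_distrib)
    also have "(\<Sum>k\<in>A \<union> B. y k (X k \<omega>) - y k (Y a k \<omega>)) = (\<Sum>k\<in>B. y k (X k \<omega>) - y k (Y a k \<omega>))"
      using A B Y_past[OF _ \<omega>] by (intro sum.mono_neutral_right) (auto simp: subset_eq)
    also have "\<bar>u\<bar> * \<bar>\<dots>\<bar> \<le> \<bar>u\<bar> * (\<Sum>k\<in>B. v k * D (X k \<omega>) (Y a k \<omega>))"
      by (intro mult_left_mono order_trans[OF sum_abs] sum_mono y_diff) auto
    finally show ?thesis .
  qed
  have "norm (chf u (A \<union> B) - chf u A * chf u B) = norm (\<integral>\<omega>. \<Phi> (\<lambda>k. X k \<omega>) - \<Phi> (\<lambda>k. Y a k \<omega>) \<partial>M)"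
    unfolding eX eY[symmetric] using iX iY by simp
  also have "\<dots> \<le> (\<integral>\<omega>. norm (\<Phi> (\<lambda>k. X k \<omega>) - \<Phi> (\<lambda>k. Y a k \<omega>)) \<partial>M)" by (rule integral_norm_bound)
  also have "\<dots> \<le> (\<integral>\<omega>. \<bar>u\<bar> * (\<Sum>k\<in>B. v k * D (X k \<omega>) (Y a k \<omega>)) \<partial>M)"
    using iX iY by (intro integral_mono integrable_norm Bochner_Integration.integrable_diff Dint pt)
  also have "\<dots> = \<bar>u\<bar> * (\<Sum>k\<in>B. v k * (\<integral>\<omega>. D (X k \<omega>) (Y a k \<omega>) \<partial>M))"
    using D_first_moment(1)[OF gap] by (simp add: Bochner_Integration.integral_sum)
  also have "\<dots> \<le> \<bar>u\<bar> * (\<Sum>k\<in>B. v k * (K * r ^ g))"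
    using v_nonneg by (intro mult_left_mono sum_mono D_first_moment(2)[OF gap]) auto
  also have "(\<Sum>k\<in>B. v k * (K * r ^ g)) = (\<Sum>k\<in>B. v k) * (K * r ^ g)" by (rule sum_distrib_right[symmetric])
  finally show ?thesis by (simp add: mult_ac)
qed

lemma chf_blocks:
  fixes B :: "nat \<Rightarrow> nat set"
  assumes fin: "\<And>i. finite (B i)"
    and sep: "\<And>i. 0 < i \<Longrightarrow> \<exists>a. (\<forall>i'<i. B i' \<subseteq> {..a}) \<and> (\<forall>k\<in>B i. a < k \<and> a + g \<le> k)"
  shows "norm (chf u (\<Union>i<J. B i) - (\<Prod>i<J. chf u (B i))) \<le> \<bar>u\<bar> * K * r ^ g * (\<Sum>i<J. \<Sum>k\<in>B i. v k)"
proof (induction J)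
  case 0
  show ?case by (simp add: chf_def Lin_def prob_space)
next
  case (Suc J)
  let ?U = "\<Union>i<J. B i"
  show ?case
  proof (cases "J = 0")
    case True
    have "0 \<le> \<bar>u\<bar> * K * r ^ g * (\<Sum>k\<in>B 0. v k)"
      using K_ge_1 r v_nonneg by (intro mult_nonneg_nonneg sum_nonneg) auto
    then show ?thesis using True by (simp add: lessThan_Suc)
  next
  case False
  obtain a where a: "\<And>i'. i' < J \<Longrightarrow> B i' \<subseteq> {..a}" "\<And>k. k \<in> B J \<Longrightarrow> a < k \<and> a + g \<le> k"
    using sep[of J] False by blast
  have "(\<Union>i<Suc J. B i) = ?U \<union> B J" by (auto simp: less_Suc_eq)
  moreover have "norm (chf u (?U \<union> B J) - chf u ?U * chf u (B J)) \<le> \<bar>u\<bar> * K * r ^ g * (\<Sum>k\<in>B J. v k)"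
    using a fin by (intro chf_decouple) auto
  moreover have "norm (chf u ?U * chf u (B J) - (\<Prod>i<J. chf u (B i)) * chf u (B J))
      \<le> \<bar>u\<bar> * K * r ^ g * (\<Sum>i<J. \<Sum>k\<in>B i. v k) * 1"
    unfolding left_diff_distrib[symmetric] norm_mult
    using Suc norm_chf_le_1 by (intro mult_mono) (auto intro: order_trans[OF norm_ge_zero])
  ultimately show ?thesis
    using norm_triangle_ineq[of "chf u (?U \<union> B J) - chf u ?U * chf u (B J)"
        "chf u ?U * chf u (B J) - (\<Prod>i<J. chf u (B i)) * chf u (B J)"]
    by (simp add: distrib_left)
  qed
qed

text \<open>Taylor expansion to second order. The third absolute moment is interpolated between the second and the
  fourth, which have orders \<Sum> v^2 and (\<Sum> v^2)^2; splitting at sqrt \<alpha> gains a factor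
  sqrt \<alpha>.\<close>

lemma chf_gaussian:
  assumes B: "finite B" and \<alpha>: "0 < \<alpha>" "(\<Sum>k\<in>B. (v k)\<^sup>2) \<le> \<alpha>"
  shows "norm (chf u B - complex_of_real (exp (- (u\<^sup>2 / 2 * (\<integral>\<omega>. (Lin B \<omega>)\<^sup>2 \<partial>M)))))
    \<le> (\<bar>u\<bar> ^ 3 * (C2 + C4) * sqrt \<alpha> + u ^ 4 * C2\<^sup>2 * \<alpha>) * (\<Sum>k\<in>B. (v k)\<^sup>2)"
proof -
  let ?V = "\<Sum>k\<in>B. (v k)\<^sup>2" and ?m2 = "\<integral>\<omega>. (Lin B \<omega>)\<^sup>2 \<partial>M"
  have V: "0 \<le> ?V" by (intro sum_nonneg) auto
  have m2: "0 \<le> ?m2" "?m2 \<le> C2 * ?V" by (auto intro: Lin_second_moment[OF B])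
  let ?T = "\<lambda>\<omega>. \<bar>u\<bar> ^ 3 * (sqrt \<alpha> * (Lin B \<omega>)\<^sup>2 + Lin B \<omega> ^ 4 / sqrt \<alpha>)"
  let ?p = "\<lambda>\<omega>. 1 + \<i> * complex_of_real (u * Lin B \<omega>) - complex_of_real ((u * Lin B \<omega>)\<^sup>2 / 2)"
  have pt: "norm (iexp (u * Lin B \<omega>) - ?p \<omega>) \<le> ?T \<omega>" for \<omega>
  proof -
    let ?x = "u * Lin B \<omega>"
    have "norm (iexp ?x - (\<Sum>k\<le>2. (\<i> * ?x) ^ k / fact k)) \<le> \<bar>?x\<bar> ^ 3 / fact 3"
      using iexp_approx1[of ?x 2] by (simp add: eval_nat_numeral)
    also have "(\<Sum>k\<le>2. (\<i> * ?x) ^ k / fact k) = ?p \<omega>"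
      by (simp add: eval_nat_numeral power2_eq_square field_simps)
    also have "\<bar>?x\<bar> ^ 3 / fact 3 \<le> \<bar>?x\<bar> ^ 3" by (simp add: fact_numeral)
    also have "\<bar>?x\<bar> ^ 3 = \<bar>u\<bar> ^ 3 * \<bar>Lin B \<omega>\<bar> ^ 3" by (simp add: abs_mult power_mult_distrib)
    also have "\<bar>Lin B \<omega>\<bar> ^ 3 \<le> sqrt \<alpha> * (Lin B \<omega>)\<^sup>2 + Lin B \<omega> ^ 4 / sqrt \<alpha>"
    proof (cases "\<bar>Lin B \<omega>\<bar> \<le> sqrt \<alpha>")
      case True
      have "\<bar>Lin B \<omega>\<bar> ^ 3 = \<bar>Lin B \<omega>\<bar> * (Lin B \<omega>)\<^sup>2" by (simp add: power3_eq_cube power2_eq_square abs_mult_self_eq mult.assoc)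
      also have "\<dots> \<le> sqrt \<alpha> * (Lin B \<omega>)\<^sup>2" using True by (intro mult_right_mono) auto
      finally show ?thesis using \<alpha> by (smt (verit) divide_nonneg_pos real_sqrt_gt_zero zero_le_even_power even_numeral)
    next
      case False
      have "sqrt \<alpha> * \<bar>Lin B \<omega>\<bar> ^ 3 \<le> \<bar>Lin B \<omega>\<bar> * \<bar>Lin B \<omega>\<bar> ^ 3" using False by (intro mult_right_mono) auto
      also have "\<dots> = \<bar>Lin B \<omega>\<bar> ^ 4" by (simp add: eval_nat_numeral)
      also have "\<dots> = Lin B \<omega> ^ 4" by simp
      finally have "\<bar>Lin B \<omega>\<bar> ^ 3 \<le> Lin B \<omega> ^ 4 / sqrt \<alpha>" using \<alpha> by (simp add: pos_le_divide_eq mult.commute)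
      moreover have "0 \<le> sqrt \<alpha> * (Lin B \<omega>)\<^sup>2" using \<alpha> by simp
      ultimately show ?thesis by linarith
    qed
    finally show ?thesis by (simp add: mult_left_mono)
  qed
  have T: "integrable M ?T"
    by (intro integrable_mult_right Bochner_Integration.integrable_add integrable_divide Lin_square_integrable Lin_fourth_integrable)
  define re where "re \<omega> = 1 - (u * Lin B \<omega>)\<^sup>2 / 2" for \<omega>
  have re: "integrable M re" "(\<integral>\<omega>. re \<omega> \<partial>M) = 1 - u\<^sup>2 / 2 * ?m2"
    using Lin_square_integrable[of B] unfolding re_def[abs_def] power_mult_distrib by (auto simp: prob_space)
  have im: "integrable M (\<lambda>\<omega>. u * Lin B \<omega>)" "(\<integral>\<omega>. u * Lin B \<omega> \<partial>M) = 0"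
    by (rule integrable_mult_right[OF Lin_integrable]) (simp only: integral_mult_right_zero Lin_mean mult_zero_right)
  have p_eq: "?p \<omega> = complex_of_real (re \<omega>) + \<i> * complex_of_real (u * Lin B \<omega>)" for \<omega>
    by (simp add: re_def)
  have cre: "integrable M (\<lambda>\<omega>. complex_of_real (re \<omega>))"
    and cim: "integrable M (\<lambda>\<omega>. \<i> * complex_of_real (u * Lin B \<omega>))"
    using re(1) im(1) by (auto intro: integrable_of_real integrable_mult_right)
  have p: "integrable M ?p" unfolding p_eq using cre cim by (rule Bochner_Integration.integrable_add)
  have ie: "integrable M (\<lambda>\<omega>. iexp (u * Lin B \<omega>))" by (rule iexp_integrable) measurable
  have ep: "(\<integral>\<omega>. ?p \<omega> \<partial>M) = complex_of_real (1 - u\<^sup>2 / 2 * ?m2)"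
    unfolding p_eq Bochner_Integration.integral_add[OF cre cim] integral_mult_right_zero integral_complex_of_real re(2) im(2)
    by (simp add: Lin_mean)
  have "norm (chf u B - complex_of_real (1 - u\<^sup>2 / 2 * ?m2)) = norm (\<integral>\<omega>. iexp (u * Lin B \<omega>) - ?p \<omega> \<partial>M)"
    by (simp only: chf_def Bochner_Integration.integral_diff[OF ie p] ep)
  also have "\<dots> \<le> (\<integral>\<omega>. norm (iexp (u * Lin B \<omega>) - ?p \<omega>) \<partial>M)" by (rule integral_norm_bound)
  also have "\<dots> \<le> (\<integral>\<omega>. ?T \<omega> \<partial>M)"
    by (intro integral_mono integrable_norm Bochner_Integration.integrable_diff iexp_integrable p T pt) auto
  also have "\<dots> = \<bar>u\<bar> ^ 3 * (sqrt \<alpha> * ?m2 + (\<integral>\<omega>. Lin B \<omega> ^ 4 \<partial>M) / sqrt \<alpha>)"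
    using Lin_square_integrable[of B] Lin_fourth_integrable[of B] by simp
  also have "\<dots> \<le> \<bar>u\<bar> ^ 3 * (sqrt \<alpha> * (C2 * ?V) + (C4 * (?V * \<alpha>)) / sqrt \<alpha>)"
  proof (intro mult_left_mono add_mono divide_right_mono)
    have "(\<integral>\<omega>. Lin B \<omega> ^ 4 \<partial>M) \<le> C4 * ?V\<^sup>2" by (rule Lin_fourth_moment[OF B])
    also have "?V\<^sup>2 = ?V * ?V" by (rule power2_eq_square)
    also have "C4 * (?V * ?V) \<le> C4 * (?V * \<alpha>)"
      using V \<alpha> C4_nonneg by (intro mult_left_mono) auto
    finally show "(\<integral>\<omega>. Lin B \<omega> ^ 4 \<partial>M) \<le> C4 * (?V * \<alpha>)" .
  qed (use m2 \<alpha> in auto)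
  also have "(C4 * (?V * \<alpha>)) / sqrt \<alpha> = sqrt \<alpha> * (C4 * ?V)"
  proof -
    have "(C4 * (?V * \<alpha>)) / sqrt \<alpha> = (C4 * ?V) * (\<alpha> / sqrt \<alpha>)" by (simp only: mult.assoc times_divide_eq_right)
    also have "\<alpha> / sqrt \<alpha> = sqrt \<alpha>" using \<alpha> by (intro real_div_sqrt) simp
    finally show ?thesis by (simp only: mult.commute)
  qed
  finally have 1: "norm (chf u B - complex_of_real (1 - u\<^sup>2 / 2 * ?m2)) \<le> \<bar>u\<bar> ^ 3 * (C2 + C4) * sqrt \<alpha> * ?V"
    by (simp add: algebra_simps)
  let ?x = "u\<^sup>2 / 2 * ?m2"
  have x: "0 \<le> ?x" using m2 by simp
  note e = exp_minus_first_order[OF x]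
  have "?x\<^sup>2 \<le> u ^ 4 * C2\<^sup>2 * \<alpha> * ?V"
  proof -
    have "?m2\<^sup>2 \<le> (C2 * ?V)\<^sup>2" using m2 by (intro power_mono) auto
    also have "\<dots> = C2\<^sup>2 * (?V * ?V)" by (simp only: power_mult_distrib power2_eq_square[of ?V])
    also have "\<dots> \<le> C2\<^sup>2 * (\<alpha> * ?V)" using V \<alpha> by (intro mult_left_mono mult_right_mono) auto
    finally have "u ^ 4 / 4 * ?m2\<^sup>2 \<le> u ^ 4 * (C2\<^sup>2 * (\<alpha> * ?V))" by (intro mult_mono) auto
    moreover have "?x\<^sup>2 = u ^ 4 / 4 * ?m2\<^sup>2" by (simp add: power_mult_distrib power_divide flip: power_mult)
    ultimately show ?thesis by (simp add: mult_ac)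
  qed
  then have 2: "norm (complex_of_real (1 - ?x) - complex_of_real (exp (- ?x))) \<le> u ^ 4 * C2\<^sup>2 * \<alpha> * ?V"
    using e by (simp only: norm_of_real flip: of_real_diff)
  show ?thesis
    using norm_triangle_ineq[of "chf u B - complex_of_real (1 - ?x)" "complex_of_real (1 - ?x) - complex_of_real (exp (- ?x))"] 1 2
    by (simp add: algebra_simps)
qed

text \<open>Both errors are sums over the blocks: one from decoupling the blocks, one from replacing each
  characteristic function by a Gaussian one.\<close>

theorem chf_block_sum_gaussian:
  fixes B :: "nat \<Rightarrow> nat set"
  assumes fin: "\<And>i. finite (B i)"
    and sep: "\<And>i. 0 < i \<Longrightarrow> \<exists>a. (\<forall>i'<i. B i' \<subseteq> {..a}) \<and> (\<forall>k\<in>B i. a < k \<and> a + g \<le> k)"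
    and \<alpha>: "0 < \<alpha>" "\<And>i. i < J \<Longrightarrow> (\<Sum>k\<in>B i. (v k)\<^sup>2) \<le> \<alpha>"
  shows "norm (chf u (\<Union>i<J. B i) - complex_of_real (exp (- (u\<^sup>2 / 2 * (\<Sum>i<J. \<integral>\<omega>. (Lin (B i) \<omega>)\<^sup>2 \<partial>M)))))
    \<le> \<bar>u\<bar> * K * r ^ g * (\<Sum>i<J. \<Sum>k\<in>B i. v k)
      + (\<bar>u\<bar> ^ 3 * (C2 + C4) * sqrt \<alpha> + u ^ 4 * C2\<^sup>2 * \<alpha>) * (\<Sum>i<J. \<Sum>k\<in>B i. (v k)\<^sup>2)"
proof -
  let ?e = "\<lambda>i. complex_of_real (exp (- (u\<^sup>2 / 2 * (\<integral>\<omega>. (Lin (B i) \<omega>)\<^sup>2 \<partial>M))))"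
  have "complex_of_real (exp (- (u\<^sup>2 / 2 * (\<Sum>i<J. \<integral>\<omega>. (Lin (B i) \<omega>)\<^sup>2 \<partial>M)))) = (\<Prod>i<J. ?e i)"
    by (simp add: sum_distrib_left exp_sum of_real_prod flip: sum_negf)
  moreover have "norm ((\<Prod>i<J. chf u (B i)) - (\<Prod>i<J. ?e i)) \<le> (\<Sum>i<J. norm (chf u (B i) - ?e i))"
  proof (rule norm_prod_diff)
    show "norm (?e i) \<le> 1" for i
    proof -
      have "0 \<le> u\<^sup>2 / 2 * (\<integral>\<omega>. (Lin (B i) \<omega>)\<^sup>2 \<partial>M)" by (intro mult_nonneg_nonneg integral_nonneg_AE) auto
      then show ?thesis by (simp only: norm_of_real abs_exp_cancel exp_le_one_iff neg_le_0_iff_le)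
    qed
  qed (rule norm_chf_le_1)
  moreover have "(\<Sum>i<J. norm (chf u (B i) - ?e i))
     \<le> (\<Sum>i<J. (\<bar>u\<bar> ^ 3 * (C2 + C4) * sqrt \<alpha> + u ^ 4 * C2\<^sup>2 * \<alpha>) * (\<Sum>k\<in>B i. (v k)\<^sup>2))"
    using \<alpha> by (intro sum_mono chf_gaussian fin) auto
  moreover have "norm (chf u (\<Union>i<J. B i) - (\<Prod>i<J. chf u (B i))) \<le> \<bar>u\<bar> * K * r ^ g * (\<Sum>i<J. \<Sum>k\<in>B i. v k)"
    by (rule chf_blocks[OF fin sep])
  ultimately show ?thesis
    using norm_triangle_ineq[of "chf u (\<Union>i<J. B i) - (\<Prod>i<J. chf u (B i))" "(\<Prod>i<J. chf u (B i)) - (\<Prod>i<J. ?e i)"]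
    by (simp add: sum_distrib_left)
qed

end

section \<open>Hoeffding decomposition\<close>

lemma discriminant_bound:
  fixes a b c :: real
  assumes quad: "\<And>s t. 0 \<le> s\<^sup>2 * a - 2 * s * t * c + t\<^sup>2 * b" and a: "0 \<le> a" and b: "0 \<le> b"
  shows "c\<^sup>2 \<le> a * b"
proof (cases "a = 0")
  case True
  have "(b + 1)\<^sup>2 * a - 2 * (b + 1) * c * c + c\<^sup>2 * b = - ((b + 2) * c\<^sup>2)"
    by (simp add: True power2_eq_square algebra_simps)
  then have "(b + 2) * c\<^sup>2 \<le> 0" using quad[of "b + 1" c] by simp
  then have "c = 0" using b by (simp add: mult_le_0_iff)
  then show ?thesis using True by simp
next
  case False
  then have pos: "0 < a" using a by simp
  have "c\<^sup>2 * a - 2 * c * a * c + a\<^sup>2 * b = a * (a * b - c\<^sup>2)"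
    by (simp add: power2_eq_square algebra_simps)
  then have "0 \<le> a * (a * b - c\<^sup>2)" using quad[of c a] by simp
  then show ?thesis using pos by (simp add: zero_le_mult_iff)
qed

lemma (in prob_space) expectation_product_square_le:
  fixes A B :: "'a \<Rightarrow> real"
  assumes A: "A \<in> borel_measurable M" "integrable M (\<lambda>\<omega>. (A \<omega>)\<^sup>2)"
    and B: "B \<in> borel_measurable M" "integrable M (\<lambda>\<omega>. (B \<omega>)\<^sup>2)"
  shows "integrable M (\<lambda>\<omega>. A \<omega> * B \<omega>)"
    and "\<bar>\<integral>\<omega>. A \<omega> * B \<omega> \<partial>M\<bar> \<le> sqrt (\<integral>\<omega>. (A \<omega>)\<^sup>2 \<partial>M) * sqrt (\<integral>\<omega>. (B \<omega>)\<^sup>2 \<partial>M)"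
proof -
  note [measurable] = A(1) B(1)
  show AB: "integrable M (\<lambda>\<omega>. A \<omega> * B \<omega>)"
  proof (rule Bochner_Integration.integrable_bound[OF Bochner_Integration.integrable_add[OF A(2) B(2)]])
    show "AE \<omega> in M. norm (A \<omega> * B \<omega>) \<le> norm ((A \<omega>)\<^sup>2 + (B \<omega>)\<^sup>2)"
    proof (rule AE_I2)
      fix \<omega>
      have "2 * (\<bar>A \<omega>\<bar> * \<bar>B \<omega>\<bar>) \<le> (A \<omega>)\<^sup>2 + (B \<omega>)\<^sup>2"
        using sum_squares_bound[of "\<bar>A \<omega>\<bar>" "\<bar>B \<omega>\<bar>"] by simp
      moreover have "0 \<le> \<bar>A \<omega>\<bar> * \<bar>B \<omega>\<bar>" by simp
      ultimately show "norm (A \<omega> * B \<omega>) \<le> norm ((A \<omega>)\<^sup>2 + (B \<omega>)\<^sup>2)"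
        unfolding real_norm_def abs_mult by linarith
    qed
  qed measurable
  let ?a = "\<integral>\<omega>. (A \<omega>)\<^sup>2 \<partial>M" and ?b = "\<integral>\<omega>. (B \<omega>)\<^sup>2 \<partial>M" and ?c = "\<integral>\<omega>. A \<omega> * B \<omega> \<partial>M"
  have quad: "0 \<le> s\<^sup>2 * ?a - 2 * s * t * ?c + t\<^sup>2 * ?b" for s t :: real
  proof -
    have "0 \<le> (\<integral>\<omega>. (s * A \<omega> - t * B \<omega>)\<^sup>2 \<partial>M)" by (intro integral_nonneg_AE) auto
    also have "(\<lambda>\<omega>. (s * A \<omega> - t * B \<omega>)\<^sup>2) = (\<lambda>\<omega>. s\<^sup>2 * (A \<omega>)\<^sup>2 - 2 * s * t * (A \<omega> * B \<omega>) + t\<^sup>2 * (B \<omega>)\<^sup>2)"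
      by (auto simp: power2_eq_square algebra_simps)
    also have "(\<integral>\<omega>. s\<^sup>2 * (A \<omega>)\<^sup>2 - 2 * s * t * (A \<omega> * B \<omega>) + t\<^sup>2 * (B \<omega>)\<^sup>2 \<partial>M) = s\<^sup>2 * ?a - 2 * s * t * ?c + t\<^sup>2 * ?b"
      using A(2) B(2) AB by simp
    finally show ?thesis .
  qed
  have a: "0 \<le> ?a" by (intro integral_nonneg_AE) auto
  have b: "0 \<le> ?b" by (intro integral_nonneg_AE) auto
  have "?c\<^sup>2 \<le> ?a * ?b" by (rule discriminant_bound[OF quad a b])
  then have "sqrt (?c\<^sup>2) \<le> sqrt (?a * ?b)" by (rule real_sqrt_le_mono)
  then show "\<bar>?c\<bar> \<le> sqrt ?a * sqrt ?b" by (simp add: real_sqrt_mult)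
qed

locale kernel_row = spliced_process +
  fixes H :: "real \<Rightarrow> real \<Rightarrow> real" and c0 :: real and W :: "nat \<Rightarrow> nat \<Rightarrow> real" and n :: nat
  assumes H_reg: "regular c0 H" and H_sym: "\<And>x z. H x z = H z x" and W_sym: "\<And>k j. W k j = W j k"
begin

definition HP :: "nat \<Rightarrow> real \<Rightarrow> real" where
  "HP j x = (\<integral>\<omega>. H x (X j \<omega>) \<partial>M)"

definition m :: "nat \<Rightarrow> nat \<Rightarrow> real" where
  "m k j = (\<integral>\<omega>. HP j (X k \<omega>) \<partial>M)"

definition c1 where "c1 = c0 * (1 + K)\<^sup>2"

lemma c0_nonneg: "0 \<le> c0" using H_reg by (simp add: regular_def)

lemma H_le: "\<bar>H x z\<bar> \<le> c0 * lw x * lw z" and H_diff: "\<bar>H x z - H x' z\<bar> \<le> c0 * D x x' * lw z"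
  using H_reg by (auto simp: regular_def)

lemma c1_ge: "c0 \<le> c1" "c0 * K \<le> c1" "0 \<le> c1" "c0 + c0 * K \<le> c1" "c0 * K + c0 * K\<^sup>2 \<le> c1" "c0 + c0 * K + c0 * K + c0 * K\<^sup>2 = c1"
proof -
  have p: "0 \<le> c0 * K" "0 \<le> c0 * K\<^sup>2" using c0_nonneg K_ge_1 by auto
  have e: "c1 = c0 + 2 * (c0 * K) + c0 * K\<^sup>2" by (simp add: c1_def power2_eq_square algebra_simps)
  show "c0 \<le> c1" "c0 * K \<le> c1" "0 \<le> c1" "c0 + c0 * K \<le> c1" "c0 * K + c0 * K\<^sup>2 \<le> c1" "c0 + c0 * K + c0 * K + c0 * K\<^sup>2 = c1"
    using p c0_nonneg unfolding e by linarith+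
qed

lemma lw_mean: "integrable M (\<lambda>\<omega>. lw (X k \<omega>))" "(\<integral>\<omega>. lw (X k \<omega>) \<partial>M) \<le> K"
proof -
  have pt: "lw x \<le> lw x ^ 4" for x
    using power_increasing[of 1 4 "lw x"] lw_ge_1[of x] by simp
  show 1: "integrable M (\<lambda>\<omega>. lw (X k \<omega>))"
    by (rule Bochner_Integration.integrable_bound[OF lw_moment(1)[of k]])
       (use pt lw_nonneg in \<open>auto intro!: AE_I2 simp: abs_of_nonneg\<close>)
  have "(\<integral>\<omega>. lw (X k \<omega>) \<partial>M) \<le> (\<integral>\<omega>. lw (X k \<omega>) ^ 4 \<partial>M)"
    by (rule integral_mono[OF 1 lw_moment(1)]) (rule pt)
  then show "(\<integral>\<omega>. lw (X k \<omega>) \<partial>M) \<le> K" using lw_moment(2)[of k] by simp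
qed

lemma H_integrable: "integrable M (\<lambda>\<omega>. H x (X j \<omega>))"
proof (rule Bochner_Integration.integrable_bound[OF integrable_mult_right[OF lw_mean(1), of "c0 * lw x"]])
  show "(\<lambda>\<omega>. H x (X j \<omega>)) \<in> borel_measurable M" by (rule regular_measurable[OF H_reg]) auto
  show "AE \<omega> in M. norm (H x (X j \<omega>)) \<le> norm (c0 * lw x * lw (X j \<omega>))"
    using H_le c0_nonneg lw_nonneg by (intro AE_I2) (simp add: abs_mult)
qed

lemma HP_measurable [measurable]: "HP j \<in> borel_measurable borel"
proof -
  have "(\<lambda>(x, \<omega>). H x (X j \<omega>)) \<in> borel_measurable (borel \<Otimes>\<^sub>M M)"
    unfolding split_def by (rule regular_measurable[OF H_reg]) auto
  then show ?thesis unfolding HP_def[abs_def] by (rule borel_measurable_lebesgue_integral)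
qed

lemma HP_le: "\<bar>HP j x\<bar> \<le> c0 * K * lw x"
proof -
  have "\<bar>HP j x\<bar> \<le> (\<integral>\<omega>. c0 * lw x * lw (X j \<omega>) \<partial>M)"
    unfolding HP_def by (rule order_trans[OF integral_abs_bound])
      (intro integral_mono integrable_abs H_integrable integrable_mult_right lw_mean H_le)
  also have "\<dots> \<le> c0 * lw x * K"
    using mult_left_mono[OF lw_mean(2)[of j], of "c0 * lw x"] c0_nonneg lw_nonneg[of x] by simp
  finally show ?thesis by (simp add: mult_ac)
qed

lemma HP_diff: "\<bar>HP j x - HP j x'\<bar> \<le> c0 * K * D x x'"
proof -
  have "\<bar>HP j x - HP j x'\<bar> = \<bar>\<integral>\<omega>. H x (X j \<omega>) - H x' (X j \<omega>) \<partial>M\<bar>"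
    unfolding HP_def using H_integrable by simp
  also have "\<dots> \<le> (\<integral>\<omega>. c0 * D x x' * lw (X j \<omega>) \<partial>M)"
    by (rule order_trans[OF integral_abs_bound])
      (intro integral_mono integrable_abs Bochner_Integration.integrable_diff H_integrable integrable_mult_right lw_mean H_diff)
  also have "\<dots> \<le> c0 * D x x' * K"
    using mult_left_mono[OF lw_mean(2)[of j], of "c0 * D x x'"] c0_nonneg D_nonneg[of x x'] by simp
  finally show ?thesis by (simp add: mult_ac)
qed

lemma HP_integrable: "integrable M (\<lambda>\<omega>. HP j (X k \<omega>))"
proof (rule Bochner_Integration.integrable_bound[OF integrable_mult_right[OF lw_mean(1)[of k], of "c0 * K"]])
  show "AE \<omega> in M. norm (HP j (X k \<omega>)) \<le> norm (c0 * K * lw (X k \<omega>))"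
    using HP_le c0_nonneg lw_nonneg K_ge_1 by (intro AE_I2) (simp add: abs_mult)
qed measurable

lemma m_le: "\<bar>m k j\<bar> \<le> c0 * K\<^sup>2"
proof -
  have "\<bar>m k j\<bar> \<le> (\<integral>\<omega>. c0 * K * lw (X k \<omega>) \<partial>M)"
    unfolding m_def by (rule order_trans[OF integral_abs_bound])
      (intro integral_mono integrable_abs HP_integrable integrable_mult_right lw_mean HP_le)
  also have "\<dots> \<le> c0 * K * K"
    using mult_left_mono[OF lw_mean(2)[of k], of "c0 * K"] c0_nonneg K_ge_1 by simp
  finally show ?thesis by (simp add: power2_eq_square mult.assoc)
qed

text \<open>Both sides are the mean of the kernel at independent copies of the two variables.\<close>

lemma m_sym: "m k j = m j k"
proof -
  interpret P: pair_prob_space M M ..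
  have meas: "(\<lambda>(\<omega>, \<omega>'). H (X k \<omega>) (X j \<omega>')) \<in> borel_measurable (M \<Otimes>\<^sub>M M)"
    unfolding split_def by (rule regular_measurable[OF H_reg]) auto
  have int: "integrable (M \<Otimes>\<^sub>M M) (\<lambda>(\<omega>, \<omega>'). H (X k \<omega>) (X j \<omega>'))"
  proof (rule P.Fubini_integrable[OF meas])
    show "AE x in M. integrable M (\<lambda>y. case (x, y) of (\<omega>, \<omega>') \<Rightarrow> H (X k \<omega>) (X j \<omega>'))"
      by (simp add: H_integrable)
    have le: "(\<integral>y. \<bar>H (X k x) (X j y)\<bar> \<partial>M) \<le> c0 * K * lw (X k x)" for x
    proof -
      have "(\<integral>y. \<bar>H (X k x) (X j y)\<bar> \<partial>M) \<le> (\<integral>\<omega>. c0 * lw (X k x) * lw (X j \<omega>) \<partial>M)"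
        by (intro integral_mono integrable_abs H_integrable integrable_mult_right lw_mean H_le)
      also have "\<dots> \<le> c0 * lw (X k x) * K"
        using mult_left_mono[OF lw_mean(2)[of j], of "c0 * lw (X k x)"] c0_nonneg lw_nonneg[of "X k x"] by simp
      finally show ?thesis by (simp add: mult_ac)
    qed
    have "integrable M (\<lambda>x. \<integral>y. \<bar>H (X k x) (X j y)\<bar> \<partial>M)"
    proof (rule Bochner_Integration.integrable_bound[OF integrable_mult_right[OF lw_mean(1)[of k], of "c0 * K"]])
      show "(\<lambda>x. \<integral>y. \<bar>H (X k x) (X j y)\<bar> \<partial>M) \<in> borel_measurable M"
        using meas by (intro borel_measurable_lebesgue_integral) (auto simp: split_def)
      show "AE x in M. norm (\<integral>y. \<bar>H (X k x) (X j y)\<bar> \<partial>M) \<le> norm (c0 * K * lw (X k x))"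
      proof (rule AE_I2)
        fix x
        have "0 \<le> (\<integral>y. \<bar>H (X k x) (X j y)\<bar> \<partial>M)" by (intro integral_nonneg_AE) auto
        then show "norm (\<integral>y. \<bar>H (X k x) (X j y)\<bar> \<partial>M) \<le> norm (c0 * K * lw (X k x))"
          using le[of x] by simp
      qed
    qed
    then show "integrable M (\<lambda>x. \<integral>y. norm (case (x, y) of (\<omega>, \<omega>') \<Rightarrow> H (X k \<omega>) (X j \<omega>')) \<partial>M)" by simp
  qed
  have "m k j = (\<integral>\<omega>. (\<integral>\<omega>'. H (X k \<omega>) (X j \<omega>') \<partial>M) \<partial>M)" by (simp add: m_def HP_def)
  also have "\<dots> = (\<integral>\<omega>'. (\<integral>\<omega>. H (X k \<omega>) (X j \<omega>') \<partial>M) \<partial>M)" by (rule P.Fubini_integral[OF int, symmetric])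
  also have "\<dots> = m j k" unfolding m_def HP_def by (simp only: H_sym[of "X k _" "X j _"])
  finally show ?thesis .
qed

text \<open>The completely degenerate part of the kernel in Hoeffding's decomposition. The linear part, with the
  contributions of both arguments collected at one index, is y.\<close>

definition h :: "nat \<Rightarrow> nat \<Rightarrow> real \<Rightarrow> real \<Rightarrow> real" where
  "h k j x z = W k j * (H x z - HP j x - HP k z + m k j)"

definition y :: "nat \<Rightarrow> real \<Rightarrow> real" where
  "y k x = (\<Sum>j\<in>{1..n}. W k j * (HP j x - m k j))"

definition rowW :: "nat \<Rightarrow> real" where
  "rowW k = (\<Sum>j\<in>{1..n}. \<bar>W k j\<bar>)"

lemma rowW_nonneg: "0 \<le> rowW k" unfolding rowW_def by (intro sum_nonneg) auto

lemma h_sym: "h k j x z = h j k z x"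
  by (simp add: h_def W_sym[of k j] H_sym[of x z] m_sym[of k j])

lemma one_le_lw2: "1 \<le> lw x * lw z"
  using mult_mono[OF lw_ge_1 lw_ge_1, of x z] lw_nonneg by simp

lemma h_regular: "regular (c1 * \<bar>W k j\<bar>) (h k j)"
proof -
  note [measurable] = regular_measurable[OF H_reg]
  have le: "\<bar>H x z - HP j x - HP k z + m k j\<bar> \<le> c1 * lw x * lw z" for k j x z
  proof -
    have 1: "c0 * K * lw x * 1 \<le> c0 * K * lw x * lw z" "c0 * K * lw z * 1 \<le> c0 * K * lw z * lw x"
      "c0 * K\<^sup>2 * 1 \<le> c0 * K\<^sup>2 * (lw x * lw z)"
      using c0_nonneg K_ge_1 lw_ge_1 lw_nonneg one_le_lw2 by (intro mult_left_mono mult_nonneg_nonneg; simp)+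
    have "\<bar>H x z - HP j x - HP k z + m k j\<bar> \<le> c0 * lw x * lw z + c0 * K * lw x + c0 * K * lw z + c0 * K\<^sup>2"
      using H_le[of x z] HP_le[of j x] HP_le[of k z] m_le[of k j] by linarith
    also have "\<dots> \<le> (c0 + c0 * K + c0 * K + c0 * K\<^sup>2) * (lw x * lw z)"
      using 1 by (simp add: algebra_simps)
    finally show ?thesis unfolding c1_ge by (simp add: mult.assoc)
  qed
  have diff: "\<bar>(H x z - HP j x - HP k z + m k j) - (H x' z - HP j x' - HP k z + m k j)\<bar> \<le> c1 * D x x' * lw z" for k j x x' z
  proof -
    have 1: "c0 * K * D x x' * 1 \<le> c0 * K * D x x' * lw z"
      using c0_nonneg K_ge_1 lw_ge_1 D_nonneg by (intro mult_left_mono mult_nonneg_nonneg) auto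
    have "\<bar>(H x z - HP j x - HP k z + m k j) - (H x' z - HP j x' - HP k z + m k j)\<bar> \<le> c0 * D x x' * lw z + c0 * K * D x x'"
      using H_diff[of x z x'] HP_diff[of j x x'] by linarith
    also have "\<dots> \<le> (c0 + c0 * K) * (D x x' * lw z)" using 1 by (simp add: algebra_simps)
    also have "\<dots> \<le> c1 * (D x x' * lw z)" using c1_ge D_nonneg lw_nonneg by (intro mult_right_mono) auto
    finally show ?thesis by (simp add: mult.assoc)
  qed
  have fst: "\<bar>h k j x z - h k j x' z\<bar> \<le> c1 * \<bar>W k j\<bar> * D x x' * lw z" for k j x x' z
  proof -
    have "\<bar>h k j x z - h k j x' z\<bar> = \<bar>W k j\<bar> * \<bar>(H x z - HP j x - HP k z + m k j) - (H x' z - HP j x' - HP k z + m k j)\<bar>"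
      unfolding h_def right_diff_distrib[symmetric] abs_mult ..
    also have "\<dots> \<le> \<bar>W k j\<bar> * (c1 * D x x' * lw z)" by (intro mult_left_mono diff) auto
    finally show ?thesis by (simp add: mult_ac)
  qed
  show ?thesis unfolding regular_def
  proof (intro conjI allI)
    show "0 \<le> c1 * \<bar>W k j\<bar>" using c1_ge(3) by (intro mult_nonneg_nonneg) auto
    show "(\<lambda>(x, z). h k j x z) \<in> borel_measurable (borel \<Otimes>\<^sub>M borel)" unfolding h_def split_def by measurable
    fix x x' z z'
    have "\<bar>h k j x z\<bar> \<le> \<bar>W k j\<bar> * (c1 * lw x * lw z)"
      unfolding h_def abs_mult by (intro mult_left_mono le) auto
    then show "\<bar>h k j x z\<bar> \<le> c1 * \<bar>W k j\<bar> * lw x * lw z" by (simp add: mult_ac)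
    show "\<bar>h k j x z - h k j x' z\<bar> \<le> c1 * \<bar>W k j\<bar> * D x x' * lw z" by (rule fst)
    show "\<bar>h k j x z - h k j x z'\<bar> \<le> c1 * \<bar>W k j\<bar> * lw x * D z z'"
      using fst[of j k z x z'] unfolding h_sym[of k j x] W_sym[of k j] by (simp add: mult_ac)
  qed
qed

sublocale quad: degenerate_family M X Y lw D K r h "\<lambda>k j. c1 * \<bar>W k j\<bar>"
proof unfold_locales
  fix k j z
  have "(\<integral>\<omega>. H (X k \<omega>) z - HP j (X k \<omega>) - HP k z + m k j \<partial>M) = HP k z - m k j - HP k z + m k j"
    using H_integrable[of z k] HP_integrable[of j k]
    by (simp add: prob_space HP_def H_sym[of z] m_def)
  then show "(\<integral>\<omega>. h k j (X k \<omega>) z \<partial>M) = 0" unfolding h_def by simp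
qed (use h_regular h_sym W_sym in auto)

sublocale lin: linear_family M X Y lw D K r y "\<lambda>k. c1 * rowW k"
proof unfold_locales
  fix k x x'
  show "0 \<le> c1 * rowW k" using c1_ge(3) rowW_nonneg by (intro mult_nonneg_nonneg) auto
  show "y k \<in> borel_measurable borel" unfolding y_def[abs_def] by measurable
  have le: "\<bar>HP j x - m k j\<bar> \<le> c1 * lw x" for j
  proof -
    have "c0 * K\<^sup>2 * 1 \<le> c0 * K\<^sup>2 * lw x" using c0_nonneg lw_ge_1 by (intro mult_left_mono) auto
    then have "\<bar>HP j x - m k j\<bar> \<le> (c0 * K + c0 * K\<^sup>2) * lw x"
      using HP_le[of j x] m_le[of k j] by (simp add: algebra_simps)
    also have "\<dots> \<le> c1 * lw x" using c1_ge lw_nonneg by (intro mult_right_mono) auto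
    finally show ?thesis .
  qed
  have "\<bar>y k x\<bar> \<le> (\<Sum>j\<in>{1..n}. \<bar>W k j\<bar> * (c1 * lw x))"
    unfolding y_def by (intro order_trans[OF sum_abs] sum_mono) (auto simp: abs_mult intro!: mult_left_mono le)
  also have "\<dots> = rowW k * (c1 * lw x)" unfolding rowW_def by (rule sum_distrib_right[symmetric])
  finally show "\<bar>y k x\<bar> \<le> c1 * rowW k * lw x" by (simp only: mult_ac)
  have "\<bar>y k x - y k x'\<bar> \<le> (\<Sum>j\<in>{1..n}. \<bar>W k j\<bar> * (c1 * D x x'))"
    unfolding y_def sum_subtractf[symmetric] right_diff_distrib[symmetric]
  proof (intro order_trans[OF sum_abs] sum_mono)
    fix j
    have "\<bar>HP j x - HP j x'\<bar> \<le> c1 * D x x'"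
      using HP_diff[of j x x'] mult_right_mono[OF c1_ge(2) D_nonneg[of x x']] by linarith
    then show "\<bar>W k j * (HP j x - m k j - (HP j x' - m k j))\<bar> \<le> \<bar>W k j\<bar> * (c1 * D x x')"
      by (simp add: abs_mult mult_left_mono)
  qed
  also have "\<dots> = rowW k * (c1 * D x x')" unfolding rowW_def by (rule sum_distrib_right[symmetric])
  finally show "\<bar>y k x - y k x'\<bar> \<le> c1 * rowW k * D x x'" by (simp only: mult_ac)
  have "(\<integral>\<omega>. y k (X k \<omega>) \<partial>M) = (\<Sum>j\<in>{1..n}. W k j * ((\<integral>\<omega>. HP j (X k \<omega>) \<partial>M) - m k j))"
    unfolding y_def using HP_integrable by (subst Bochner_Integration.integral_sum) (auto simp: prob_space)
  then show "(\<integral>\<omega>. y k (X k \<omega>) \<partial>M) = 0" by (simp add: m_def)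
qed

definition V :: "'a \<Rightarrow> real" where
  "V \<omega> = (\<Sum>k\<in>{1..n}. \<Sum>j\<in>{1..n}. W k j * H (X k \<omega>) (X j \<omega>))"

text \<open>By the symmetry of the kernel and of the weights, the two projections of the kernel contribute equally,
  whence the factor 2.\<close>

lemma V_decomposition:
  "V \<omega> = quad.Q {1..n} \<omega> + 2 * lin.Lin {1..n} \<omega> + (\<Sum>k\<in>{1..n}. \<Sum>j\<in>{1..n}. W k j * m k j)"
proof -
  have sw: "(\<Sum>k\<in>{1..n}. \<Sum>j\<in>{1..n}. W k j * HP k (X j \<omega>)) = (\<Sum>k\<in>{1..n}. \<Sum>j\<in>{1..n}. W k j * HP j (X k \<omega>))"
    by (subst sum.swap) (simp add: W_sym)
  have "quad.Q {1..n} \<omega> = V \<omega> - (\<Sum>k\<in>{1..n}. \<Sum>j\<in>{1..n}. W k j * HP j (X k \<omega>))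
     - (\<Sum>k\<in>{1..n}. \<Sum>j\<in>{1..n}. W k j * HP k (X j \<omega>)) + (\<Sum>k\<in>{1..n}. \<Sum>j\<in>{1..n}. W k j * m k j)"
    by (simp add: quad.Q_def quad.hX_def h_def V_def distrib_left right_diff_distrib sum.distrib sum_subtractf)
  moreover have "lin.Lin {1..n} \<omega> = (\<Sum>k\<in>{1..n}. \<Sum>j\<in>{1..n}. W k j * HP j (X k \<omega>)) - (\<Sum>k\<in>{1..n}. \<Sum>j\<in>{1..n}. W k j * m k j)"
    by (simp add: lin.Lin_def y_def right_diff_distrib sum_subtractf)
  ultimately show ?thesis using sw by simp
qed

definition Qc :: "'a \<Rightarrow> real" where
  "Qc \<omega> = quad.Q {1..n} \<omega> - (\<integral>\<omega>. quad.Q {1..n} \<omega> \<partial>M)"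

lemma V_centred: "V \<omega> - (\<integral>\<omega>. V \<omega> \<partial>M) = 2 * lin.Lin {1..n} \<omega> + Qc \<omega>"
proof -
  have "(\<integral>\<omega>. V \<omega> \<partial>M) = (\<integral>\<omega>. quad.Q {1..n} \<omega> \<partial>M) + (\<Sum>k\<in>{1..n}. \<Sum>j\<in>{1..n}. W k j * m k j)"
    unfolding V_decomposition using quad.Q_integrable[of "{1..n}"] lin.Lin_integrable[of "{1..n}"]
    by (simp add: prob_space lin.Lin_mean)
  then show ?thesis by (simp add: V_decomposition Qc_def)
qed

definition CQ where "CQ = 40 * K\<^sup>2 * quad.S\<^sup>2 * c1\<^sup>2"

lemma Qc_measurable [measurable]: "Qc \<in> borel_measurable M"
  unfolding Qc_def[abs_def] by measurable

lemma Qc_second_moment: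
  "integrable M (\<lambda>\<omega>. (Qc \<omega>)\<^sup>2)" "(\<integral>\<omega>. (Qc \<omega>)\<^sup>2 \<partial>M) \<le> CQ * (\<Sum>k\<in>{1..n}. \<Sum>j\<in>{1..n}. (W k j)\<^sup>2)"
proof -
  let ?Q = "quad.Q {1..n}"
  show "integrable M (\<lambda>\<omega>. (Qc \<omega>)\<^sup>2)"
    unfolding Qc_def power2_diff using quad.Q_integrable[of "{1..n}"] quad.Q_square_integrable[of "{1..n}"] by auto
  have "(\<integral>\<omega>. (Qc \<omega>)\<^sup>2 \<partial>M) = (\<integral>\<omega>. (?Q \<omega>)\<^sup>2 \<partial>M) - (\<integral>\<omega>. ?Q \<omega> \<partial>M)\<^sup>2"
    unfolding Qc_def by (rule variance_eq) (auto intro: quad.Q_integrable quad.Q_square_integrable)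
  also have "\<dots> \<le> 40 * K\<^sup>2 * quad.S\<^sup>2 * (\<Sum>k\<in>{1..n}. \<Sum>j\<in>{1..n}. (c1 * \<bar>W k j\<bar>)\<^sup>2)"
    by (rule quad.Q_variance_le) simp
  also have "\<dots> = CQ * (\<Sum>k\<in>{1..n}. \<Sum>j\<in>{1..n}. (W k j)\<^sup>2)"
    by (simp add: CQ_def power_mult_distrib sum_distrib_left mult.assoc)
  finally show "(\<integral>\<omega>. (Qc \<omega>)\<^sup>2 \<partial>M) \<le> CQ * (\<Sum>k\<in>{1..n}. \<Sum>j\<in>{1..n}. (W k j)\<^sup>2)" .
qed

end

section \<open>Normal approximation for one row\<close>

text \<open>The three vanishing quantities are x, the share of the degenerate part and of the gaps, \<alpha>, the share
  of the largest block, and z, the coupling error over a gap.\<close>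

definition clt_error :: "real \<Rightarrow> real \<Rightarrow> real \<Rightarrow> real \<Rightarrow> real \<Rightarrow> real \<Rightarrow> real \<Rightarrow> real \<Rightarrow> real \<Rightarrow> real \<Rightarrow> real" where
  "clt_error C2 C4 c1 CE K c u x \<alpha> z =
     \<bar>u\<bar> * sqrt (CE / c * x) + 2 * \<bar>u\<bar> * K * c1 / sqrt c * z
     + (8 * \<bar>u\<bar> ^ 3 * (C2 + C4) * sqrt ((c1\<^sup>2 + 1) / c * \<alpha>) + 16 * u ^ 4 * C2\<^sup>2 * ((c1\<^sup>2 + 1) / c * \<alpha>)) * (c1\<^sup>2 / c)
     + u\<^sup>2 / 2 * (16 * K * c1\<^sup>2 / c * z + 2 * sqrt (CE / c * x) + CE / c * x)"

lemma clt_error_tendsto_0: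
  assumes "x \<longlonglongrightarrow> 0" "\<alpha> \<longlonglongrightarrow> 0" "z \<longlonglongrightarrow> 0"
  shows "(\<lambda>n. clt_error C2 C4 c1 CE K c u (x n) (\<alpha> n) (z n)) \<longlonglongrightarrow> 0"
  unfolding clt_error_def by (rule tendsto_eq_intros assms refl | simp)+

lemma clt_error_mono:
  assumes "0 \<le> CE" "0 < c" "x \<le> x'"
  shows "clt_error C2 C4 c1 CE K c u x \<alpha> z \<le> clt_error C2 C4 c1 CE K c u x' \<alpha> z"
proof -
  have le: "CE / c * x \<le> CE / c * x'" using assms by (intro mult_left_mono) auto
  have 1: "\<bar>u\<bar> * sqrt (CE / c * x) \<le> \<bar>u\<bar> * sqrt (CE / c * x')"
    by (rule mult_left_mono[OF real_sqrt_le_mono[OF le] abs_ge_zero])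
  have "2 * sqrt (CE / c * x) + CE / c * x \<le> 2 * sqrt (CE / c * x') + CE / c * x'"
    using le real_sqrt_le_mono[OF le] by linarith
  then have 2: "u\<^sup>2 / 2 * (16 * K * c1\<^sup>2 / c * z + 2 * sqrt (CE / c * x) + CE / c * x)
      \<le> u\<^sup>2 / 2 * (16 * K * c1\<^sup>2 / c * z + 2 * sqrt (CE / c * x') + CE / c * x')"
    by (intro mult_left_mono) auto
  show ?thesis unfolding clt_error_def using 1 2 by linarith
qed

lemma exp_minus_lipschitz:
  fixes x y :: real
  assumes "0 \<le> x" "0 \<le> y"
  shows "\<bar>exp (- x) - exp (- y)\<bar> \<le> \<bar>x - y\<bar>"
proof -
  have *: "exp (- a) - exp (- b) \<le> b - a" if "0 \<le> a" "a \<le> b" for a b :: real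
  proof -
    have "exp (- a) - exp (- b) = exp (- a) * (1 - exp (- (b - a)))" by (simp add: algebra_simps flip: exp_add)
    also have "\<dots> \<le> 1 * (b - a)"
    proof (rule mult_mono)
      show "1 - exp (- (b - a)) \<le> b - a" using exp_ge_add_one_self[of "- (b - a)"] by linarith
    qed (use that in auto)
    finally show ?thesis by simp
  qed
  show ?thesis
  proof (cases "x \<le> y")
    case True
    then have "exp (- y) \<le> exp (- x)" by simp
    then show ?thesis using *[of x y] assms True by simp
  next
    case False
    then have "exp (- x) \<le> exp (- y)" by simp
    then show ?thesis using *[of y x] assms False by simp
  qed
qed

lemma (in prob_space) expectation_abs_le_sqrt:
  fixes A :: "'a \<Rightarrow> real"
  assumes [measurable]: "A \<in> borel_measurable M" and A: "integrable M (\<lambda>\<omega>. (A \<omega>)\<^sup>2)"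
  shows "(\<integral>\<omega>. \<bar>A \<omega>\<bar> \<partial>M) \<le> sqrt (\<integral>\<omega>. (A \<omega>)\<^sup>2 \<partial>M)"
  using expectation_product_square_le(2)[of "\<lambda>\<omega>. \<bar>A \<omega>\<bar>" "\<lambda>_. 1"] A by (simp add: prob_space)

context kernel_row
begin

definition CE where "CE = 8 * lin.C2 * c1\<^sup>2 + 2 * CQ"

abbreviation "vW k \<equiv> c1 * rowW k"

definition Zc :: "'a \<Rightarrow> real" where "Zc \<omega> = V \<omega> - (\<integral>\<omega>. V \<omega> \<partial>M)"

lemma Zc_eq: "Zc \<omega> = 2 * lin.Lin {1..n} \<omega> + Qc \<omega>"
  by (simp add: Zc_def V_centred)

lemma Zc_measurable [measurable]: "Zc \<in> borel_measurable M"
  unfolding Zc_eq[abs_def] by measurable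

lemma square_integrable_sum:
  assumes A: "A \<in> borel_measurable M" "integrable M (\<lambda>\<omega>. (A \<omega>)\<^sup>2)"
    and B: "B \<in> borel_measurable M" "integrable M (\<lambda>\<omega>. (B \<omega>)\<^sup>2)"
  shows "integrable M (\<lambda>\<omega>. (A \<omega> + B \<omega>)\<^sup>2 :: real)"
proof -
  have "(A \<omega> + B \<omega>)\<^sup>2 = (A \<omega>)\<^sup>2 + 2 * (A \<omega> * B \<omega>) + (B \<omega>)\<^sup>2" for \<omega> by (simp add: power2_sum)
  then show ?thesis
    using A(2) B(2) expectation_product_square_le(1)[OF A B] by simp
qed

lemma two_Lin_square_integrable: "integrable M (\<lambda>\<omega>. (2 * lin.Lin B \<omega>)\<^sup>2)"
  using lin.Lin_square_integrable[of B] by (simp add: power_mult_distrib)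

lemma Zc_square_integrable: "integrable M (\<lambda>\<omega>. (Zc \<omega>)\<^sup>2)"
  unfolding Zc_eq by (intro square_integrable_sum two_Lin_square_integrable Qc_second_moment) measurable

text \<open>From a^2 \<le> 2 (a + b)^2 + 2 b^2, with a twice the linear and b the degenerate part: a
  negligible degenerate part cannot cancel the linear one.\<close>

lemma variance_lower:
  "2 * (\<integral>\<omega>. (lin.Lin {1..n} \<omega>)\<^sup>2 \<partial>M) - (\<integral>\<omega>. (Qc \<omega>)\<^sup>2 \<partial>M) \<le> (\<integral>\<omega>. (Zc \<omega>)\<^sup>2 \<partial>M)"
proof -
  have "2 * (\<integral>\<omega>. (lin.Lin {1..n} \<omega>)\<^sup>2 \<partial>M) \<le> (\<integral>\<omega>. (Zc \<omega>)\<^sup>2 + (Qc \<omega>)\<^sup>2 \<partial>M)"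
  proof (subst integral_mult_right_zero[symmetric], intro integral_mono)
    fix \<omega>
    show "2 * (lin.Lin {1..n} \<omega>)\<^sup>2 \<le> (Zc \<omega>)\<^sup>2 + (Qc \<omega>)\<^sup>2"
      using zero_le_power2[of "Zc \<omega> + Qc \<omega>"] unfolding Zc_eq by (simp add: power2_eq_square algebra_simps)
  qed (use lin.Lin_square_integrable Zc_square_integrable Qc_second_moment(1) in auto)
  then show ?thesis using Zc_square_integrable Qc_second_moment(1) by simp
qed

end

text \<open>The blocks are ordered in time, with gaps of length at least g between them; the first block may
  begin at time 1, so nothing is required before it.\<close>

locale blocked_row = kernel_row +
  fixes B :: "nat \<Rightarrow> nat set" and g J :: nat
  assumes B_sub: "\<And>i. B i \<subseteq> {1..n}"
    and B_sep: "\<And>i. 0 < i \<Longrightarrow> \<exists>a. (\<forall>i'<i. B i' \<subseteq> {..a}) \<and> (\<forall>k\<in>B i. a < k \<and> a + g \<le> k)"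
begin

definition U where "U = (\<Union>i<J. B i)"

lemma B_finite: "finite (B i)" using B_sub finite_subset by blast

lemma B_disjoint: "i \<noteq> i' \<Longrightarrow> B i \<inter> B i' = {}"
proof -
  have *: "B i \<inter> B i' = {}" if "i < i'" for i i'
  proof -
    have "0 < i'" using that by simp
    from B_sep[OF this] obtain a where a: "\<forall>i<i'. B i \<subseteq> {..a}" "\<forall>k\<in>B i'. a < k \<and> a + g \<le> k"
      by (elim exE conjE)
    have "B i \<subseteq> {..a}" using a(1) that by simp
    then show ?thesis using a(2) by force
  qed
  show "i \<noteq> i' \<Longrightarrow> B i \<inter> B i' = {}" using *[of i i'] *[of i' i] by (cases "i < i'") auto
qed

lemma B_gap:
  assumes "i \<noteq> i'" "k \<in> B i" "j \<in> B i'"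
  shows "g \<le> ndist k j"
proof -
  have *: "g \<le> ndist k j" if "i < i'" "k \<in> B i" "j \<in> B i'" for i i' k j
  proof -
    have "0 < i'" using that by simp
    from B_sep[OF this] obtain a where a: "\<forall>i<i'. B i \<subseteq> {..a}" "\<forall>k\<in>B i'. a < k \<and> a + g \<le> k"
      by (elim exE conjE)
    have "B i \<subseteq> {..a}" using a(1) that(1) by simp
    then have "k \<le> a" "a + g \<le> j" using a(2) that(2,3) by auto
    then show ?thesis by (simp add: ndist_def)
  qed
  show ?thesis
    using *[of i i' k j] *[of i' i j k] assms by (cases "i < i'") (auto simp: ndist_commute)
qed

lemma U_sub: "U \<subseteq> {1..n}" unfolding U_def using B_sub by auto

lemma sum_U: "sum f U = (\<Sum>i<J. sum f (B i))" for f :: "nat \<Rightarrow> real"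
  unfolding U_def by (rule sum.UNION_disjoint) (auto simp: B_finite dest: B_disjoint)

definition Er :: "'a \<Rightarrow> real" where
  "Er \<omega> = 2 * lin.Lin ({1..n} - U) \<omega> + Qc \<omega>"

lemma Er_measurable [measurable]: "Er \<in> borel_measurable M" unfolding Er_def[abs_def] by measurable

lemma Zc_Er: "Zc \<omega> = 2 * lin.Lin U \<omega> + Er \<omega>"
proof -
  have "lin.Lin {1..n} \<omega> = lin.Lin ({1..n} - U) \<omega> + lin.Lin U \<omega>"
    unfolding lin.Lin_def by (rule sum.subset_diff[OF U_sub]) simp
  then show ?thesis by (simp add: Zc_eq Er_def)
qed

lemma Er_square_integrable: "integrable M (\<lambda>\<omega>. (Er \<omega>)\<^sup>2)"
  unfolding Er_def by (intro square_integrable_sum two_Lin_square_integrable Qc_second_moment) measurable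

lemma Er_second_moment:
  "(\<integral>\<omega>. (Er \<omega>)\<^sup>2 \<partial>M) \<le> CE * ((\<Sum>k\<in>{1..n} - U. (rowW k)\<^sup>2) + (\<Sum>k\<in>{1..n}. \<Sum>j\<in>{1..n}. (W k j)\<^sup>2))"
    (is "_ \<le> CE * (?\<beta> + ?w)")
proof -
  have "(\<integral>\<omega>. (Er \<omega>)\<^sup>2 \<partial>M) \<le> (\<integral>\<omega>. 8 * (lin.Lin ({1..n} - U) \<omega>)\<^sup>2 + 2 * (Qc \<omega>)\<^sup>2 \<partial>M)"
  proof (intro integral_mono Er_square_integrable Bochner_Integration.integrable_add integrable_mult_right
      lin.Lin_square_integrable Qc_second_moment)
    fix \<omega>
    show "(Er \<omega>)\<^sup>2 \<le> 8 * (lin.Lin ({1..n} - U) \<omega>)\<^sup>2 + 2 * (Qc \<omega>)\<^sup>2"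
      using zero_le_power2[of "2 * lin.Lin ({1..n} - U) \<omega> - Qc \<omega>"] unfolding Er_def
      by (simp add: power2_eq_square algebra_simps)
  qed
  also have "\<dots> = 8 * (\<integral>\<omega>. (lin.Lin ({1..n} - U) \<omega>)\<^sup>2 \<partial>M) + 2 * (\<integral>\<omega>. (Qc \<omega>)\<^sup>2 \<partial>M)"
    using lin.Lin_square_integrable Qc_second_moment(1) by simp
  also have "\<dots> \<le> 8 * (lin.C2 * (\<Sum>k\<in>{1..n} - U. (vW k)\<^sup>2)) + 2 * (CQ * ?w)"
    by (intro add_mono mult_left_mono lin.Lin_second_moment Qc_second_moment) auto
  also have "(\<Sum>k\<in>{1..n} - U. (vW k)\<^sup>2) = c1\<^sup>2 * ?\<beta>" by (simp add: power_mult_distrib sum_distrib_left)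
  also have "8 * (lin.C2 * (c1\<^sup>2 * ?\<beta>)) + 2 * (CQ * ?w) \<le> CE * (?\<beta> + ?w)"
  proof -
    have p: "0 \<le> lin.C2 * c1\<^sup>2" "0 \<le> CQ" using lin.C2_nonneg by (auto simp: CQ_def)
    have q: "0 \<le> ?\<beta>" "0 \<le> ?w" by (auto intro!: sum_nonneg)
    have "0 \<le> 8 * ((lin.C2 * c1\<^sup>2) * ?w) + 2 * (CQ * ?\<beta>)"
      using mult_nonneg_nonneg[OF p(1) q(2)] mult_nonneg_nonneg[OF p(2) q(1)] by linarith
    moreover have "CE * (?\<beta> + ?w) = 8 * (lin.C2 * (c1\<^sup>2 * ?\<beta>)) + 2 * (CQ * ?w) + (8 * ((lin.C2 * c1\<^sup>2) * ?w) + 2 * (CQ * ?\<beta>))"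
      by (simp add: CE_def algebra_simps)
    ultimately show ?thesis by linarith
  qed
  finally show ?thesis .
qed

lemma block_sum_variance:
  "\<bar>4 * (\<integral>\<omega>. (lin.Lin U \<omega>)\<^sup>2 \<partial>M) - (\<integral>\<omega>. (Zc \<omega>)\<^sup>2 \<partial>M)\<bar>
     \<le> 2 * (sqrt (\<integral>\<omega>. (Er \<omega>)\<^sup>2 \<partial>M) * sqrt (\<integral>\<omega>. (Zc \<omega>)\<^sup>2 \<partial>M)) + (\<integral>\<omega>. (Er \<omega>)\<^sup>2 \<partial>M)"
proof -
  note i = Er_square_integrable Zc_square_integrable
  note cs = expectation_product_square_le[OF Er_measurable i(1) Zc_measurable i(2)]
  have "4 * (lin.Lin U \<omega>)\<^sup>2 = (Zc \<omega>)\<^sup>2 - 2 * (Er \<omega> * Zc \<omega>) + (Er \<omega>)\<^sup>2" for \<omega>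
    unfolding Zc_Er by (simp add: power2_eq_square algebra_simps)
  then have "4 * (\<integral>\<omega>. (lin.Lin U \<omega>)\<^sup>2 \<partial>M) = (\<integral>\<omega>. (Zc \<omega>)\<^sup>2 - 2 * (Er \<omega> * Zc \<omega>) + (Er \<omega>)\<^sup>2 \<partial>M)"
    by (simp flip: integral_mult_right_zero)
  also have "\<dots> = (\<integral>\<omega>. (Zc \<omega>)\<^sup>2 \<partial>M) - 2 * (\<integral>\<omega>. Er \<omega> * Zc \<omega> \<partial>M) + (\<integral>\<omega>. (Er \<omega>)\<^sup>2 \<partial>M)"
    using i cs(1) by simp
  moreover have "0 \<le> (\<integral>\<omega>. (Er \<omega>)\<^sup>2 \<partial>M)" by (intro integral_nonneg_AE) auto
  ultimately show ?thesis using cs(2) unfolding abs_le_iff by linarith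
qed

text \<open>Different blocks are nearly uncorrelated, being separated by a gap.\<close>

lemma block_variances:
  "\<bar>(\<integral>\<omega>. (lin.Lin U \<omega>)\<^sup>2 \<partial>M) - (\<Sum>i<J. \<integral>\<omega>. (lin.Lin (B i) \<omega>)\<^sup>2 \<partial>M)\<bar> \<le> 4 * K * r ^ g * (\<Sum>k\<in>{1..n}. vW k)\<^sup>2"
proof -
  let ?L = "\<lambda>i. lin.Lin (B i)" and ?v = "\<lambda>i. \<Sum>k\<in>B i. vW k"
  have LU: "lin.Lin U \<omega> = (\<Sum>i<J. ?L i \<omega>)" for \<omega> unfolding lin.Lin_def by (rule sum_U)
  have v: "0 \<le> vW k" for k by (rule lin.v_nonneg)
  have pair: "integrable M (\<lambda>\<omega>. ?L i \<omega> * ?L i' \<omega>)" for i i'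
    by (rule lin.Lin_cross_moment(1)[where g = 0]) simp
  have "(\<integral>\<omega>. (lin.Lin U \<omega>)\<^sup>2 \<partial>M) = (\<Sum>i<J. \<Sum>i'<J. \<integral>\<omega>. ?L i \<omega> * ?L i' \<omega> \<partial>M)"
    unfolding LU power2_eq_square sum_product
    by (simp add: Bochner_Integration.integral_sum Bochner_Integration.integrable_sum pair)
  moreover have "(\<Sum>i<J. \<integral>\<omega>. (?L i \<omega>)\<^sup>2 \<partial>M) = (\<Sum>i<J. \<Sum>i'<J. if i = i' then \<integral>\<omega>. ?L i \<omega> * ?L i' \<omega> \<partial>M else 0)"
    by (simp add: power2_eq_square)
  ultimately have "\<bar>(\<integral>\<omega>. (lin.Lin U \<omega>)\<^sup>2 \<partial>M) - (\<Sum>i<J. \<integral>\<omega>. (?L i \<omega>)\<^sup>2 \<partial>M)\<bar>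
      = \<bar>\<Sum>i<J. \<Sum>i'<J. (\<integral>\<omega>. ?L i \<omega> * ?L i' \<omega> \<partial>M) - (if i = i' then \<integral>\<omega>. ?L i \<omega> * ?L i' \<omega> \<partial>M else 0)\<bar>"
    by (simp only: sum_subtractf)
  also have "\<dots> \<le> (\<Sum>i<J. \<Sum>i'<J. 4 * K * r ^ g * (?v i * ?v i'))"
  proof (rule order_trans[OF sum_abs sum_mono], rule order_trans[OF sum_abs sum_mono])
    fix i i'
    have "0 \<le> ?v i" for i by (rule sum_nonneg) (rule v)
    then have nn: "0 \<le> 4 * K * r ^ g * (?v i * ?v i')"
      using K_ge_1 r by (intro mult_nonneg_nonneg[of "4 * K * r ^ g"] mult_nonneg_nonneg[of "?v i"]) auto
    show "\<bar>(\<integral>\<omega>. ?L i \<omega> * ?L i' \<omega> \<partial>M) - (if i = i' then \<integral>\<omega>. ?L i \<omega> * ?L i' \<omega> \<partial>M else 0)\<bar> \<le> 4 * K * r ^ g * (?v i * ?v i')"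
    proof (cases "i = i'")
      case True then show ?thesis using nn by simp
    next
      case False
      then show ?thesis using lin.Lin_cross_moment(2)[OF B_gap[OF False]] by simp
    qed
  qed
  also have "\<dots> = 4 * K * r ^ g * (\<Sum>i<J. ?v i)\<^sup>2"
    by (simp only: power2_eq_square sum_product) (simp only: sum_distrib_left)
  also have "(\<Sum>i<J. ?v i) = (\<Sum>k\<in>U. vW k)" by (rule sum_U[symmetric])
  also have "4 * K * r ^ g * (\<Sum>k\<in>U. vW k)\<^sup>2 \<le> 4 * K * r ^ g * (\<Sum>k\<in>{1..n}. vW k)\<^sup>2"
    using K_ge_1 r v U_sub by (intro mult_left_mono power_mono sum_mono2 sum_nonneg) auto
  finally show ?thesis .
qed

text \<open>After normalisation by the standard deviation, the remainder outside the blocks changes the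
  characteristic function by at most its standard deviation. The sum over the blocks is nearly Gaussian,
  and its variance is close to 1 because the remainder and the correlations between blocks are small.\<close>

theorem chf_error_le:
  assumes c: "0 < c" and b: "0 < b" "b = (\<Sum>k\<in>{1..n}. (rowW k)\<^sup>2)"
    and s2: "c * b \<le> (\<integral>\<omega>. (Zc \<omega>)\<^sup>2 \<partial>M)"
    and \<alpha>: "0 < \<alpha>" "\<And>i. i < J \<Longrightarrow> (\<Sum>k\<in>B i. (rowW k)\<^sup>2) \<le> \<alpha>"
  shows "norm ((\<integral>\<omega>. iexp (u * (Zc \<omega> / sqrt (\<integral>\<omega>. (Zc \<omega>)\<^sup>2 \<partial>M))) \<partial>M) - complex_of_real (exp (- (u\<^sup>2 / 2))))
    \<le> clt_error lin.C2 lin.C4 c1 CE K c u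
        (((\<Sum>k\<in>{1..n} - U. (rowW k)\<^sup>2) + (\<Sum>k\<in>{1..n}. \<Sum>j\<in>{1..n}. (W k j)\<^sup>2)) / b) (\<alpha> / b) (r ^ g * real n)"
proof -
  define S2 where "S2 = (\<integral>\<omega>. (Zc \<omega>)\<^sup>2 \<partial>M)"
  define s where "s = sqrt S2"
  define \<epsilon> where "\<epsilon> = (\<integral>\<omega>. (Er \<omega>)\<^sup>2 \<partial>M)"
  define \<tau> where "\<tau> = (\<Sum>i<J. \<integral>\<omega>. (lin.Lin (B i) \<omega>)\<^sup>2 \<partial>M)"
  define x where "x = ((\<Sum>k\<in>{1..n} - U. (rowW k)\<^sup>2) + (\<Sum>k\<in>{1..n}. \<Sum>j\<in>{1..n}. (W k j)\<^sup>2)) / b"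
  define z where "z = r ^ g * real n"
  define \<sigma> where "\<sigma> = (\<Sum>k\<in>{1..n}. rowW k)"
  have S2_ge: "c * b \<le> S2" unfolding S2_def by (rule s2)
  have S2: "0 < S2" by (rule less_le_trans[OF mult_pos_pos[OF c b(1)] S2_ge])
  have s: "0 < s" "s\<^sup>2 = S2" using S2 by (simp_all add: s_def)
  have bS: "b / S2 \<le> 1 / c"
  proof -
    have "b \<le> S2 / c" using S2_ge c by (simp add: pos_le_divide_eq mult.commute)
    then have "b / S2 \<le> S2 / c / S2" using S2 by (intro divide_right_mono) auto
    then show ?thesis using S2 by simp
  qed
  have \<epsilon>0: "0 \<le> \<epsilon>" unfolding \<epsilon>_def by (intro integral_nonneg_AE) auto
  have x0: "0 \<le> x" unfolding x_def using b(1) by (intro divide_nonneg_pos add_nonneg_nonneg sum_nonneg) auto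
  have CE0: "0 \<le> CE" using lin.C2_nonneg by (simp add: CE_def CQ_def)
  have \<tau>0: "0 \<le> \<tau>" unfolding \<tau>_def by (intro sum_nonneg integral_nonneg_AE) auto
  have \<delta>: "\<epsilon> / S2 \<le> CE / c * x"
  proof -
    have "\<epsilon> \<le> CE * (x * b)" using Er_second_moment b(1) by (simp add: \<epsilon>_def x_def)
    then have "\<epsilon> / S2 \<le> CE * (x * b) / S2" using S2 by (intro divide_right_mono) auto
    also have "\<dots> = CE * x * (b / S2)" by simp
    also have "\<dots> \<le> CE * x * (1 / c)" using CE0 x0 by (intro mult_left_mono bS) auto
    finally show ?thesis by simp
  qed
  have sq\<delta>: "sqrt \<epsilon> / s \<le> sqrt (CE / c * x)"
    using real_sqrt_le_mono[OF \<delta>] by (simp add: s_def real_sqrt_divide)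
  have z0: "0 \<le> z" using r by (simp add: z_def)
  have \<sigma>0: "0 \<le> \<sigma>" unfolding \<sigma>_def by (intro sum_nonneg rowW_nonneg)
  have \<sigma>2: "\<sigma>\<^sup>2 \<le> real n * b"
    using sum_squared_le_sum_of_squares[of rowW "{1..n}"] by (simp add: \<sigma>_def b(2) mult.commute)
  have \<sigma>s: "\<sigma>\<^sup>2 / S2 \<le> real n / c"
  proof -
    have "\<sigma>\<^sup>2 / S2 \<le> real n * b / S2" using \<sigma>2 S2 by (intro divide_right_mono) auto
    also have "\<dots> = real n * (b / S2)" by simp
    also have "\<dots> \<le> real n * (1 / c)" by (intro mult_left_mono bS) auto
    finally show ?thesis by simp
  qed
  have n1: "n \<ge> 1"
  proof (rule ccontr)
    assume "\<not> n \<ge> 1"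
    then have "b = 0" using b(2) by simp
    then show False using b(1) by simp
  qed
  have \<sigma>s': "\<sigma> / s \<le> real n / sqrt c"
  proof -
    have "\<sigma> / s = sqrt (\<sigma>\<^sup>2 / S2)" using \<sigma>0 by (simp add: s_def real_sqrt_divide)
    also have "\<dots> \<le> sqrt (real n / c)" using \<sigma>s by (rule real_sqrt_le_mono)
    also have "\<dots> = sqrt (real n) / sqrt c" by (rule real_sqrt_divide)
    also have "\<dots> \<le> real n / sqrt c"
    proof (rule divide_right_mono)
      have "sqrt (real n) * 1 \<le> sqrt (real n) * sqrt (real n)" using n1 by (intro mult_left_mono) auto
      then show "sqrt (real n) \<le> real n" by simp
    qed (use c in simp)
    finally show ?thesis .
  qed
  have v_sum: "(\<Sum>k\<in>{1..n}. vW k) = c1 * \<sigma>" by (simp add: \<sigma>_def sum_distrib_left)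
  let ?u = "2 * u / s"
  have absu: "\<bar>?u\<bar> = 2 * \<bar>u\<bar> / s" using s by (simp add: abs_mult)
  \<comment> \<open>The remainder outside the blocks, compared with the standard deviation of the statistic.\<close>
  have step1: "norm ((\<integral>\<omega>. iexp (u * (Zc \<omega> / s)) \<partial>M) - lin.chf ?u U) \<le> \<bar>u\<bar> * sqrt (CE / c * x)"
  proof -
    have i1: "integrable M (\<lambda>\<omega>. iexp (u * (Zc \<omega> / s)))" and i2: "integrable M (\<lambda>\<omega>. iexp (?u * lin.Lin U \<omega>))"
      by (rule lin.iexp_integrable, measurable)+
    have Eint: "integrable M (\<lambda>\<omega>. \<bar>u\<bar> / s * \<bar>Er \<omega>\<bar>)"
      using square_integrable_imp_integrable[OF Er_measurable Er_square_integrable] by simp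
    have "norm ((\<integral>\<omega>. iexp (u * (Zc \<omega> / s)) \<partial>M) - lin.chf ?u U)
        = norm (\<integral>\<omega>. iexp (u * (Zc \<omega> / s)) - iexp (?u * lin.Lin U \<omega>) \<partial>M)"
      by (simp only: lin.chf_def Bochner_Integration.integral_diff[OF i1 i2])
    also have "\<dots> \<le> (\<integral>\<omega>. norm (iexp (u * (Zc \<omega> / s)) - iexp (?u * lin.Lin U \<omega>)) \<partial>M)" by (rule integral_norm_bound)
    also have "\<dots> \<le> (\<integral>\<omega>. \<bar>u\<bar> / s * \<bar>Er \<omega>\<bar> \<partial>M)"
    proof (intro integral_mono integrable_norm Bochner_Integration.integrable_diff i1 i2 Eint)
      fix \<omega>
      have "u * (Zc \<omega> / s) - ?u * lin.Lin U \<omega> = u / s * Er \<omega>"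
        unfolding Zc_Er by (simp add: add_divide_distrib algebra_simps)
      then show "norm (iexp (u * (Zc \<omega> / s)) - iexp (?u * lin.Lin U \<omega>)) \<le> \<bar>u\<bar> / s * \<bar>Er \<omega>\<bar>"
        using norm_iexp_diff_le[of "u * (Zc \<omega> / s)" "?u * lin.Lin U \<omega>"] s by (simp add: abs_mult)
    qed
    also have "\<dots> = \<bar>u\<bar> / s * (\<integral>\<omega>. \<bar>Er \<omega>\<bar> \<partial>M)" by simp
    also have "\<dots> \<le> \<bar>u\<bar> / s * sqrt \<epsilon>"
      unfolding \<epsilon>_def using s by (intro mult_left_mono expectation_abs_le_sqrt Er_square_integrable) auto
    also have "\<dots> = \<bar>u\<bar> * (sqrt \<epsilon> / s)" by simp
    also have "\<dots> \<le> \<bar>u\<bar> * sqrt (CE / c * x)" by (intro mult_left_mono sq\<delta>) auto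
    finally show ?thesis .
  qed
  \<comment> \<open>Adding 1 keeps the bound positive for a vanishing kernel.\<close>
  define \<alpha>' where "\<alpha>' = (c1\<^sup>2 + 1) * \<alpha>"
  have \<alpha>': "0 < \<alpha>'" using \<alpha> by (simp add: \<alpha>'_def add_nonneg_pos)
  have B\<alpha>: "(\<Sum>k\<in>B i. (vW k)\<^sup>2) \<le> \<alpha>'" if "i < J" for i
  proof -
    have "(\<Sum>k\<in>B i. (vW k)\<^sup>2) = c1\<^sup>2 * (\<Sum>k\<in>B i. (rowW k)\<^sup>2)" by (simp add: power_mult_distrib sum_distrib_left)
    also have "\<dots> \<le> (c1\<^sup>2 + 1) * \<alpha>" using \<alpha>(2)[OF that] by (intro mult_mono sum_nonneg) auto
    finally show ?thesis by (simp add: \<alpha>'_def)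
  qed
  have aS: "\<alpha>' / S2 \<le> (c1\<^sup>2 + 1) / c * (\<alpha> / b)"
  proof -
    have "\<alpha>' / S2 = (c1\<^sup>2 + 1) * (\<alpha> / b) * (b / S2)" using b(1) by (simp add: \<alpha>'_def)
    also have "\<dots> \<le> (c1\<^sup>2 + 1) * (\<alpha> / b) * (1 / c)"
      using \<alpha> b(1) by (intro mult_left_mono bS mult_nonneg_nonneg divide_nonneg_pos) auto
    finally show ?thesis by (simp add: mult.commute)
  qed
  have asq: "sqrt \<alpha>' / s \<le> sqrt ((c1\<^sup>2 + 1) / c * (\<alpha> / b))"
    using real_sqrt_le_mono[OF aS] by (simp add: s_def real_sqrt_divide)
  \<comment> \<open>The sum over the blocks, with its own variance.\<close>
  have step2: "norm (lin.chf ?u U - complex_of_real (exp (- (?u\<^sup>2 / 2 * \<tau>))))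
      \<le> 2 * \<bar>u\<bar> * K * c1 / sqrt c * z
       + (8 * \<bar>u\<bar> ^ 3 * (lin.C2 + lin.C4) * sqrt ((c1\<^sup>2 + 1) / c * (\<alpha> / b)) + 16 * u ^ 4 * lin.C2\<^sup>2 * ((c1\<^sup>2 + 1) / c * (\<alpha> / b))) * (c1\<^sup>2 / c)"
  proof -
    have "norm (lin.chf ?u U - complex_of_real (exp (- (?u\<^sup>2 / 2 * \<tau>))))
      \<le> \<bar>?u\<bar> * K * r ^ g * (\<Sum>i<J. \<Sum>k\<in>B i. vW k)
       + (\<bar>?u\<bar> ^ 3 * (lin.C2 + lin.C4) * sqrt \<alpha>' + ?u ^ 4 * lin.C2\<^sup>2 * \<alpha>') * (\<Sum>i<J. \<Sum>k\<in>B i. (vW k)\<^sup>2)"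
      unfolding U_def \<tau>_def by (rule lin.chf_block_sum_gaussian[OF B_finite B_sep \<alpha>' B\<alpha>])
    also have "(\<Sum>i<J. \<Sum>k\<in>B i. vW k) = (\<Sum>k\<in>U. vW k)" by (rule sum_U[symmetric])
    also have "(\<Sum>i<J. \<Sum>k\<in>B i. (vW k)\<^sup>2) = (\<Sum>k\<in>U. (vW k)\<^sup>2)" by (rule sum_U[symmetric])
    also have "\<bar>?u\<bar> * K * r ^ g * (\<Sum>k\<in>U. vW k) + (\<bar>?u\<bar> ^ 3 * (lin.C2 + lin.C4) * sqrt \<alpha>' + ?u ^ 4 * lin.C2\<^sup>2 * \<alpha>') * (\<Sum>k\<in>U. (vW k)\<^sup>2)
      \<le> \<bar>?u\<bar> * K * r ^ g * (c1 * \<sigma>) + (\<bar>?u\<bar> ^ 3 * (lin.C2 + lin.C4) * sqrt \<alpha>' + ?u ^ 4 * lin.C2\<^sup>2 * \<alpha>') * (c1\<^sup>2 * b)"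
    proof (intro add_mono mult_left_mono)
      show "(\<Sum>k\<in>U. vW k) \<le> c1 * \<sigma>"
        unfolding v_sum[symmetric] using U_sub lin.v_nonneg by (intro sum_mono2) auto
      have "(\<Sum>k\<in>U. (vW k)\<^sup>2) \<le> (\<Sum>k\<in>{1..n}. (vW k)\<^sup>2)" using U_sub by (intro sum_mono2) auto
      also have "\<dots> = c1\<^sup>2 * b" unfolding b(2) by (simp add: power_mult_distrib sum_distrib_left)
      finally show "(\<Sum>k\<in>U. (vW k)\<^sup>2) \<le> c1\<^sup>2 * b" .
      show "0 \<le> \<bar>?u\<bar> ^ 3 * (lin.C2 + lin.C4) * sqrt \<alpha>' + ?u ^ 4 * lin.C2\<^sup>2 * \<alpha>'"
        using lin.C2_nonneg lin.C4_nonneg \<alpha>' by (intro add_nonneg_nonneg mult_nonneg_nonneg) auto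
    qed (use K_ge_1 r in auto)
    also have "\<bar>?u\<bar> * K * r ^ g * (c1 * \<sigma>) = 2 * \<bar>u\<bar> * K * c1 * r ^ g * (\<sigma> / s)" unfolding absu by simp
    also have "\<dots> \<le> 2 * \<bar>u\<bar> * K * c1 * r ^ g * (real n / sqrt c)"
      using K_ge_1 c1_ge(3) r by (intro mult_left_mono \<sigma>s' mult_nonneg_nonneg) auto
    also have "\<dots> = 2 * \<bar>u\<bar> * K * c1 / sqrt c * z" by (simp add: z_def)
    also have "(\<bar>?u\<bar> ^ 3 * (lin.C2 + lin.C4) * sqrt \<alpha>' + ?u ^ 4 * lin.C2\<^sup>2 * \<alpha>') * (c1\<^sup>2 * b)
       = (8 * \<bar>u\<bar> ^ 3 * (lin.C2 + lin.C4) * (sqrt \<alpha>' / s) + 16 * u ^ 4 * lin.C2\<^sup>2 * (\<alpha>' / S2)) * (c1\<^sup>2 * (b / S2))"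
    proof -
      have e1: "\<bar>?u\<bar> ^ 3 = 8 * \<bar>u\<bar> ^ 3 / (s * S2)" unfolding absu s(2)[symmetric]
        by (simp add: power_divide power_mult_distrib power3_eq_cube power2_eq_square)
      have e2: "?u ^ 4 = 16 * u ^ 4 / (S2 * S2)" unfolding s(2)[symmetric]
        by (simp add: power_divide power_mult_distrib power4_eq_xxxx power2_eq_square mult.assoc)
      show ?thesis unfolding e1 e2 by (simp add: distrib_left add_divide_distrib mult_ac)
    qed
    also have "\<dots> \<le> (8 * \<bar>u\<bar> ^ 3 * (lin.C2 + lin.C4) * sqrt ((c1\<^sup>2 + 1) / c * (\<alpha> / b)) + 16 * u ^ 4 * lin.C2\<^sup>2 * ((c1\<^sup>2 + 1) / c * (\<alpha> / b))) * (c1\<^sup>2 * (1 / c))"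
      using lin.C2_nonneg lin.C4_nonneg b(1) S2 c \<alpha>
      by (intro mult_mono add_mono mult_left_mono asq aS bS add_nonneg_nonneg mult_nonneg_nonneg) auto
    finally show ?thesis by simp
  qed
  \<comment> \<open>The variance of the sum over the blocks, compared with that of the statistic.\<close>
  have step3: "\<bar>exp (- (?u\<^sup>2 / 2 * \<tau>)) - exp (- (u\<^sup>2 / 2))\<bar> \<le> u\<^sup>2 / 2 * (16 * K * c1\<^sup>2 / c * z + 2 * sqrt (CE / c * x) + CE / c * x)"
  proof -
    have "\<bar>exp (- (?u\<^sup>2 / 2 * \<tau>)) - exp (- (u\<^sup>2 / 2))\<bar> \<le> \<bar>?u\<^sup>2 / 2 * \<tau> - u\<^sup>2 / 2\<bar>"
      using \<tau>0 by (intro exp_minus_lipschitz) auto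
    also have "?u\<^sup>2 / 2 * \<tau> - u\<^sup>2 / 2 = u\<^sup>2 / 2 * (4 * \<tau> / S2 - 1)"
      unfolding s(2)[symmetric] by (simp add: power_divide power_mult_distrib algebra_simps)
    also have "\<bar>\<dots>\<bar> = u\<^sup>2 / 2 * \<bar>4 * \<tau> / S2 - 1\<bar>" by (simp add: abs_mult)
    also have "\<dots> \<le> u\<^sup>2 / 2 * (16 * K * c1\<^sup>2 / c * z + 2 * sqrt (CE / c * x) + CE / c * x)"
    proof (rule mult_left_mono)
      let ?T = "\<integral>\<omega>. (lin.Lin U \<omega>)\<^sup>2 \<partial>M"
      have 1: "\<bar>4 * ?T - S2\<bar> \<le> 2 * (sqrt \<epsilon> * s) + \<epsilon>"
        using block_sum_variance by (simp add: S2_def \<epsilon>_def s_def)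
      have 2: "\<bar>?T - \<tau>\<bar> \<le> 4 * K * r ^ g * (c1 * \<sigma>)\<^sup>2" using block_variances by (simp only: \<tau>_def v_sum)
      have "\<bar>4 * \<tau> - S2\<bar> \<le> 16 * K * r ^ g * (c1 * \<sigma>)\<^sup>2 + (2 * (sqrt \<epsilon> * s) + \<epsilon>)"
        using 1 2 by linarith
      then have "\<bar>4 * \<tau> - S2\<bar> / S2 \<le> (16 * K * r ^ g * (c1 * \<sigma>)\<^sup>2 + (2 * (sqrt \<epsilon> * s) + \<epsilon>)) / S2"
        using S2 by (intro divide_right_mono) auto
      also have "\<dots> = 16 * K * r ^ g * c1\<^sup>2 * (\<sigma>\<^sup>2 / S2) + 2 * (sqrt \<epsilon> * s / S2) + \<epsilon> / S2"
        by (simp add: add_divide_distrib power_mult_distrib)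
      also have "sqrt \<epsilon> * s / S2 = sqrt \<epsilon> / s" using s unfolding s(2)[symmetric] by (simp add: power2_eq_square)
      also have "16 * K * r ^ g * c1\<^sup>2 * (\<sigma>\<^sup>2 / S2) + 2 * (sqrt \<epsilon> / s) + \<epsilon> / S2
          \<le> 16 * K * r ^ g * c1\<^sup>2 * (real n / c) + 2 * sqrt (CE / c * x) + CE / c * x"
        using K_ge_1 r by (intro add_mono mult_left_mono \<sigma>s sq\<delta> \<delta>) auto
      also have "16 * K * r ^ g * c1\<^sup>2 * (real n / c) = 16 * K * c1\<^sup>2 / c * z" by (simp add: z_def)
      finally have "\<bar>4 * \<tau> - S2\<bar> / S2 \<le> 16 * K * c1\<^sup>2 / c * z + 2 * sqrt (CE / c * x) + CE / c * x" .
      moreover have "\<bar>4 * \<tau> / S2 - 1\<bar> = \<bar>4 * \<tau> - S2\<bar> / S2"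
      proof -
        have "4 * \<tau> / S2 - 1 = (4 * \<tau> - S2) / S2" using S2 by (simp add: diff_divide_distrib)
        then show ?thesis using S2 by (simp add: abs_divide)
      qed
      ultimately show "\<bar>4 * \<tau> / S2 - 1\<bar> \<le> 16 * K * c1\<^sup>2 / c * z + 2 * sqrt (CE / c * x) + CE / c * x" by simp
    qed simp
    finally show ?thesis .
  qed
  have step3': "norm (complex_of_real (exp (- (?u\<^sup>2 / 2 * \<tau>))) - complex_of_real (exp (- (u\<^sup>2 / 2))))
      \<le> u\<^sup>2 / 2 * (16 * K * c1\<^sup>2 / c * z + 2 * sqrt (CE / c * x) + CE / c * x)"
    using step3 by (simp only: norm_of_real flip: of_real_diff)
  have tri: "norm (p1 - p4) \<le> norm (p1 - p2) + norm (p2 - p3) + norm (p3 - p4)" for p1 p2 p3 p4 :: complex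
    using norm_triangle_ineq[of "p1 - p2" "p2 - p3"] norm_triangle_ineq[of "p1 - p3" "p3 - p4"] by simp
  have "norm ((\<integral>\<omega>. iexp (u * (Zc \<omega> / s)) \<partial>M) - complex_of_real (exp (- (u\<^sup>2 / 2))))
     \<le> clt_error lin.C2 lin.C4 c1 CE K c u x (\<alpha> / b) z"
    unfolding clt_error_def
    using tri[of "\<integral>\<omega>. iexp (u * (Zc \<omega> / s)) \<partial>M" "complex_of_real (exp (- (u\<^sup>2 / 2)))" "lin.chf ?u U" "complex_of_real (exp (- (?u\<^sup>2 / 2 * \<tau>)))"]
      step1 step2 step3' by linarith
  then show ?thesis by (simp only: s_def S2_def x_def z_def)
qed

end

section \<open>Rows of a piecewise locally stationary array\<close>

text \<open>A derivative is a pointwise limit of difference quotients.\<close>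

lemma measurable_derivative:
  fixes L L' :: "real \<Rightarrow> real"
  assumes d: "\<And>x. (L has_real_derivative L' x) (at x)"
  shows "L \<in> borel_measurable borel" "L' \<in> borel_measurable borel"
proof -
  have cont: "continuous_on UNIV L"
    by (meson d DERIV_isCont continuous_at_imp_continuous_on)
  then show [measurable]: "L \<in> borel_measurable borel" by (rule borel_measurable_continuous_onI)
  show "L' \<in> borel_measurable borel"
  proof (rule borel_measurable_LIMSEQ_real)
    fix x :: real
    have "((\<lambda>h. (L (x + h) - L x) / h) \<longlongrightarrow> L' x) (at 0)"
      using d[of x] by (simp add: DERIV_def)
    moreover have "filterlim (\<lambda>n. inverse (real (Suc n))) (at 0) sequentially"
      unfolding filterlim_at using LIMSEQ_inverse_real_of_nat by (auto simp: eventually_sequentially)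
    ultimately show "(\<lambda>n. (L (x + inverse (real (Suc n))) - L x) / inverse (real (Suc n))) \<longlonglongrightarrow> L' x"
      by (rule filterlim_compose)
  qed measurable
qed

lemma (in prob_space) integrable_power_le:
  fixes f g :: "'a \<Rightarrow> real"
  assumes "f \<in> borel_measurable M" "integrable M g" "\<And>\<omega>. 0 \<le> f \<omega>" "\<And>\<omega>. f \<omega> \<le> g \<omega>"
  shows "integrable M f" "(\<integral>\<omega>. f \<omega> \<partial>M) \<le> (\<integral>\<omega>. g \<omega> \<partial>M)"
proof -
  show 1: "integrable M f"
    by (rule Bochner_Integration.integrable_bound[OF assms(2,1)])
       (use assms(3,4) in \<open>auto intro!: AE_I2 intro: order_trans[OF _ abs_ge_self]\<close>)
  show "(\<integral>\<omega>. f \<omega> \<partial>M) \<le> (\<integral>\<omega>. g \<omega> \<partial>M)" by (rule integral_mono[OF 1 assms(2)]) (rule assms(4))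
qed

context iid_copies
begin

lemma integral_past_mix:
  assumes [measurable]: "f \<in> borel_measurable paths"
  shows "integrable M (\<lambda>\<omega>. f (past (mix eps eps' S) k \<omega>)) \<longleftrightarrow> integrable M (\<lambda>\<omega>. f (past eps k \<omega>) :: real)"
    and "(\<integral>\<omega>. f (past (mix eps eps' S) k \<omega>) \<partial>M) = (\<integral>\<omega>. f (past eps k \<omega>) \<partial>M)"
proof -
  have m: "(\<lambda>x. f (\<lambda>i. x (k - int i))) \<in> borel_measurable paths"
    by (rule measurable_compose[OF shift_measurable assms])
  have e: "(\<lambda>\<omega> i. eps i \<omega>) \<in> measurable M paths" by (auto intro!: measurable_PiM_single')
  show "integrable M (\<lambda>\<omega>. f (past (mix eps eps' S) k \<omega>)) \<longleftrightarrow> integrable M (\<lambda>\<omega>. f (past eps k \<omega>))"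
    using integrable_distr_eq[OF mix_measurable m] integrable_distr_eq[OF e m]
    by (simp add: mix_law past_def)
  show "(\<integral>\<omega>. f (past (mix eps eps' S) k \<omega>) \<partial>M) = (\<integral>\<omega>. f (past eps k \<omega>) \<partial>M)"
    using integral_distr[OF mix_measurable m] integral_distr[OF e m]
    by (simp add: mix_law past_def)
qed

definition row :: "(nat \<Rightarrow> (nat \<Rightarrow> real) \<Rightarrow> real) \<Rightarrow> nat \<Rightarrow> 'a \<Rightarrow> real" where
  "row F k \<omega> = F k (past eps (int k) \<omega>)"

definition spliced_row :: "(nat \<Rightarrow> (nat \<Rightarrow> real) \<Rightarrow> real) \<Rightarrow> nat \<Rightarrow> nat \<Rightarrow> 'a \<Rightarrow> real" where
  "spliced_row F a k \<omega> = (if k \<le> a then row F k \<omega> else F k (past (mix eps eps' {..int a}) (int k) \<omega>))"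

lemma past_measurable [measurable]: "past eps k \<in> measurable M paths"
  using past_mix_measurable[of "{}" k] by (simp add: mix_def[abs_def])

lemma spliced_row_law:
  assumes F: "\<And>k. F k \<in> borel_measurable paths"
  shows "distr M paths (\<lambda>\<omega> k. spliced_row F a k \<omega>)
    = distr (M \<Otimes>\<^sub>M M) paths (\<lambda>(\<omega>, \<omega>') k. if k \<le> a then row F k \<omega> else row F k \<omega>')"
proof -
  define \<Phi> where "\<Phi> = (\<lambda>(x, y) k. if k \<le> a then F k (\<lambda>i. x (int k - int i)) else F k (\<lambda>i. y (int k - int i)))"
  have m: "\<Phi> \<in> measurable (paths \<Otimes>\<^sub>M paths) paths"
  proof (rule measurable_PiM_single')
    fix k :: nat
    have sh: "(\<lambda>x. F k (\<lambda>i. x (int k - int i))) \<in> borel_measurable paths"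
      by (rule measurable_compose[OF shift_measurable F])
    show "(\<lambda>\<omega>. \<Phi> \<omega> k) \<in> borel_measurable (paths \<Otimes>\<^sub>M paths)"
      using measurable_compose[OF measurable_fst sh] measurable_compose[OF measurable_snd sh]
      by (cases "k \<le> a") (auto simp: \<Phi>_def split_def)
  qed auto
  have dep: "\<Phi> (x, y) = \<Phi> (x', y)" if "\<And>i. i \<le> int a \<Longrightarrow> x i = x' i" for x x' y
    using that by (auto simp: \<Phi>_def fun_eq_iff intro!: arg_cong[where f = "F _"])
  have "distr M paths (\<lambda>\<omega>. \<Phi> (\<lambda>i. eps i \<omega>, \<lambda>i. mix eps eps' {..int a} i \<omega>))
     = distr (M \<Otimes>\<^sub>M M) paths (\<lambda>(\<omega>, \<omega>'). \<Phi> (\<lambda>i. eps i \<omega>, \<lambda>i. eps i \<omega>'))"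
    by (rule splice_noise_law[OF m]) (rule dep)
  then show ?thesis
    by (simp add: \<Phi>_def spliced_row_def[abs_def] row_def past_def split_def cong: if_cong)
qed

text \<open>The constants K and r depend on the moment and dependence bounds only, and so are the same for all
  rows of the array.\<close>

theorem spliced_process_row:
  fixes L L' :: "real \<Rightarrow> real" and C \<eta> A B q :: real
  assumes d: "\<And>x. (L has_real_derivative L' x) (at x)"
    and b: "\<And>a b t. a \<le> t \<Longrightarrow> t \<le> b \<Longrightarrow> \<bar>L' t\<bar> \<le> C * (\<bar>L' a\<bar> + \<bar>L' b\<bar> + 1)"
    and eta: "0 < \<eta>" "\<eta> \<le> 1" and q: "0 < q" "q < 1" and B: "0 \<le> B"
  obtains K r where "\<And>F. (\<And>k. F k \<in> borel_measurable paths) \<Longrightarrow>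
     (\<And>k i. ky_fan M (\<lambda>\<omega>. F k (past eps 0 \<omega>)) (\<lambda>\<omega>. F k (past (eps(- int i := eps' (- int i))) 0 \<omega>)) \<le> B * q ^ i) \<Longrightarrow>
     (\<And>k. integrable M (\<lambda>\<omega>. L (row F k \<omega>) ^ 8)) \<Longrightarrow> (\<And>k. (\<integral>\<omega>. L (row F k \<omega>) ^ 8 \<partial>M) \<le> A) \<Longrightarrow>
     (\<And>k. integrable M (\<lambda>\<omega>. L' (row F k \<omega>) ^ 8)) \<Longrightarrow> (\<And>k. (\<integral>\<omega>. L' (row F k \<omega>) ^ 8 \<partial>M) \<le> A) \<Longrightarrow>
     spliced_process M (row F) (spliced_row F) (\<lambda>x. 1 + \<bar>L x\<bar>) (kernel_modulus L \<eta>) K r"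
proof -
  note [measurable] = measurable_derivative[OF d]
  define e where "e = min (4 * \<eta>) (1 / 2)"
  \<comment> \<open>Coupled variables at distance g are within q^(g/2) of each other, apart from an event of probability of that order; this power to the e is the fourth power of r^g.\<close>
  define r where "r = q powr (e / 8)"
  define K1 where "K1 = (3 * \<bar>C\<bar> + 256) ^ 4 * (1 + 4 * A + B / (1 - q))"
  define K where "K = max K1 (32 + 16 * A)"
  have e: "0 < e" using eta by (simp add: e_def)
  have r: "0 < r" "r < 1" using q e powr_less_mono2[of "e / 8" q 1] by (auto simp: r_def)
  show thesis
  proof (rule that[of K r])
    fix F
    assume F[measurable]: "\<And>k. F k \<in> borel_measurable paths"
      and kf: "\<And>k i. ky_fan M (\<lambda>\<omega>. F k (past eps 0 \<omega>)) (\<lambda>\<omega>. F k (past (eps(- int i := eps' (- int i))) 0 \<omega>)) \<le> B * q ^ i"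
      and m1: "\<And>k. integrable M (\<lambda>\<omega>. L (row F k \<omega>) ^ 8)" "\<And>k. (\<integral>\<omega>. L (row F k \<omega>) ^ 8 \<partial>M) \<le> A"
      and m2: "\<And>k. integrable M (\<lambda>\<omega>. L' (row F k \<omega>) ^ 8)" "\<And>k. (\<integral>\<omega>. L' (row F k \<omega>) ^ 8 \<partial>M) \<le> A"
    have row_m[measurable]: "row F k \<in> borel_measurable M" for k
      unfolding row_def[abs_def] by measurable
    have mix_m[measurable]: "(\<lambda>\<omega>. F k (past (mix eps eps' S) j \<omega>)) \<in> borel_measurable M" for k S j
      by measurable
    have sp_m[measurable]: "spliced_row F a k \<in> borel_measurable M" for a k
      unfolding spliced_row_def[abs_def] by (cases "k \<le> a") auto
    have Dm: "(\<lambda>(x, y). kernel_modulus L \<eta> x y) \<in> borel_measurable (borel \<Otimes>\<^sub>M borel)"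
      unfolding kernel_modulus_def by measurable
    have spm: "integrable M (\<lambda>\<omega>. f (spliced_row F a k \<omega>) ^ 8)" "(\<integral>\<omega>. f (spliced_row F a k \<omega>) ^ 8 \<partial>M) \<le> A"
      if f[measurable]: "f \<in> borel_measurable borel" and fi: "integrable M (\<lambda>\<omega>. f (row F k \<omega>) ^ 8)" "(\<integral>\<omega>. f (row F k \<omega>) ^ 8 \<partial>M) \<le> A"
      for f :: "real \<Rightarrow> real" and a k
    proof -
      have g: "(\<lambda>x. f (F k x) ^ 8) \<in> borel_measurable paths" by measurable
      show "integrable M (\<lambda>\<omega>. f (spliced_row F a k \<omega>) ^ 8)" "(\<integral>\<omega>. f (spliced_row F a k \<omega>) ^ 8 \<partial>M) \<le> A"
        using fi integral_past_mix[OF g, of "{..int a}" "int k"]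
        by (cases "k \<le> a"; simp add: spliced_row_def row_def)+
    qed
    have D4: "integrable M (\<lambda>\<omega>. kernel_modulus L \<eta> (row F k \<omega>) (spliced_row F a k \<omega>) ^ 4) \<and>
        (a \<le> k \<longrightarrow> (\<integral>\<omega>. kernel_modulus L \<eta> (row F k \<omega>) (spliced_row F a k \<omega>) ^ 4 \<partial>M) \<le> K * (r ^ (k - a)) ^ 4)" for a k
    proof (cases "k \<le> a")
      case True
      then have "kernel_modulus L \<eta> (row F k \<omega>) (spliced_row F a k \<omega>) = 0" for \<omega>
        using eta by (simp add: spliced_row_def kernel_modulus_def)
      moreover have "0 \<le> A" using order_trans[OF integral_nonneg_AE m1(2)] by simp
      then have "0 \<le> K" by (simp add: K_def)
      ultimately show ?thesis using r by simp
    next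
      case False
      define g where "g = k - a"
      have k: "int k = int a + int g" using False by (simp add: g_def)
      define u where "u = q powr (real g / 2)"
      have u: "0 < u" "u \<le> 1" using q by (auto simp: u_def intro!: powr_le1)
      have u2: "u\<^sup>2 = q ^ g" using q by (simp add: u_def powr_power powr_realpow)
      have ue: "u powr e = (r ^ g) ^ 4"
      proof -
        have "(r ^ g) ^ 4 = r ^ (g * 4)" by (simp add: power_mult)
        also have "\<dots> = q powr (e / 8 * real (g * 4))" using q by (simp add: r_def powr_power)
        also have "\<dots> = u powr e" by (simp add: u_def powr_powr field_simps)
        finally show ?thesis by simp
      qed
      have "ky_fan M (row F k) (spliced_row F a k) \<le> B / (1 - q) * u\<^sup>2"
        using ky_fan_mix_past[where F = "F k" and a = "int a" and g = g, OF F kf q B] False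
        by (simp add: row_def[abs_def] spliced_row_def[abs_def] k u2)
      from kernel_modulus_fourth_moment[OF d b measurable_derivative[OF d] row_m sp_m m1(1) spm(1)[OF measurable_derivative(1)[OF d] m1]
          m2(1) spm(1)[OF measurable_derivative(2)[OF d] m2] m1(2) spm(2)[OF measurable_derivative(1)[OF d] m1] m2(2)
          spm(2)[OF measurable_derivative(2)[OF d] m2] this u eta]
      have 1: "integrable M (\<lambda>\<omega>. kernel_modulus L \<eta> (row F k \<omega>) (spliced_row F a k \<omega>) ^ 4)"
        and 2: "(\<integral>\<omega>. kernel_modulus L \<eta> (row F k \<omega>) (spliced_row F a k \<omega>) ^ 4 \<partial>M) \<le> K1 * u powr e"
        by (auto simp: K1_def e_def)
      have "K1 * u powr e \<le> K * (r ^ g) ^ 4"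
        unfolding ue using r by (intro mult_right_mono) (auto simp: K_def)
      with 1 2 show ?thesis unfolding g_def by auto
    qed
    have lw: "integrable M (\<lambda>\<omega>. (1 + \<bar>L (row F k \<omega>)\<bar>) ^ 4) \<and> (\<integral>\<omega>. (1 + \<bar>L (row F k \<omega>)\<bar>) ^ 4 \<partial>M) \<le> K" for k
    proof -
      have pt: "(1 + \<bar>z\<bar>) ^ 4 \<le> 32 + 16 * z ^ 8" for z :: real
      proof -
        define m where "m = max 1 \<bar>z\<bar>"
        have m: "1 \<le> m" "\<bar>z\<bar> \<le> m" by (auto simp: m_def)
        have "(1 + \<bar>z\<bar>) ^ 4 \<le> (2 * m) ^ 4" using m by (intro power_mono) auto
        also have "\<dots> = 16 * m ^ 4" by (simp add: power_mult_distrib)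
        also have "m ^ 4 \<le> m ^ 8" using m by (intro power_increasing) auto
        also have "m ^ 8 \<le> 1 + z ^ 8" by (auto simp: m_def max_def power_even_abs)
        finally show ?thesis by simp
      qed
      have gi: "integrable M (\<lambda>\<omega>. 32 + 16 * L (row F k \<omega>) ^ 8)" using m1(1)[of k] by simp
      have "(\<integral>\<omega>. 32 + 16 * L (row F k \<omega>) ^ 8 \<partial>M) = 32 + 16 * (\<integral>\<omega>. L (row F k \<omega>) ^ 8 \<partial>M)"
        using m1(1)[of k] by (simp add: prob_space)
      also have "\<dots> \<le> K" using m1(2)[of k] by (simp add: K_def)
      finally have le: "(\<integral>\<omega>. 32 + 16 * L (row F k \<omega>) ^ 8 \<partial>M) \<le> K" .
      have fm: "(\<lambda>\<omega>. (1 + \<bar>L (row F k \<omega>)\<bar>) ^ 4) \<in> borel_measurable M" by measurable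
      show ?thesis
        using integrable_power_le[OF fm gi _ pt] le by auto
    qed
    show "spliced_process M (row F) (spliced_row F) (\<lambda>x. 1 + \<bar>L x\<bar>) (kernel_modulus L \<eta>) K r"
    proof (unfold_locales)
      show "distr M paths (\<lambda>\<omega> k. spliced_row F a k \<omega>)
        = distr (M \<Otimes>\<^sub>M M) paths (\<lambda>(\<omega>, \<omega>') k. if k \<le> a then row F k \<omega> else row F k \<omega>')" for a
        by (rule spliced_row_law) measurable
    qed (use D4 lw r row_m sp_m Dm eta in \<open>auto simp: kernel_modulus_def spliced_row_def\<close>)
  qed
qed

end

context iid_copies
begin

lemma piecewise_row_functionals:
  fixes X :: "nat \<Rightarrow> nat \<Rightarrow> 'a \<Rightarrow> real"
  assumes X: "piecewise_locally_stationary M eps R d G X"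
  obtains F where "\<And>n k. F n k \<in> borel_measurable paths"
    and "\<And>n k \<omega>. k \<in> {1..n} \<Longrightarrow> \<omega> \<in> space M \<Longrightarrow> X n k \<omega> = row (F n) k \<omega>"
    and "\<And>n k. k \<in> {1..n} \<Longrightarrow> \<exists>l\<le>R. real k / real n \<in> {d l<..d (Suc l)} \<and> F n k = G l (real k / real n)"
    and "\<And>n k. k \<notin> {1..n} \<Longrightarrow> F n k = (\<lambda>_. 0)"
proof -
  have d: "d 0 = 0" "d (Suc R) = 1" "\<And>j. j \<le> R \<Longrightarrow> d j < d (Suc j)"
    and Gm: "\<And>j. j \<le> R \<Longrightarrow> (\<lambda>(t, x). G j t x) \<in> borel_measurable (restrict_space borel {d j<..d (Suc j)} \<Otimes>\<^sub>M paths)"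
    and Xeq: "\<And>n k \<omega>. n \<ge> 1 \<Longrightarrow> k \<in> {1..n} \<Longrightarrow> \<omega> \<in> space M \<Longrightarrow>
        X n k \<omega> = (\<Sum>j=0..R. G j (real k / real n) (past eps (int k) \<omega>) * indicator {d j<..d (Suc j)} (real k / real n))"
    using X unfolding piecewise_locally_stationary_def by auto
  have mono: "d i \<le> d j" if "i \<le> j" "j \<le> Suc R" for i j
    using that
  proof (induction j rule: dec_induct)
    case (step j)
    then show ?case using d(3)[of j] by auto
  qed simp
  have piece: "\<exists>l\<le>R. t \<in> {d l<..d (Suc l)}" if t: "0 < t" "t \<le> 1" for t
  proof -
    \<comment> \<open>The piece that contains t is the first one whose right end is not before t.\<close>
    define l where "l = (LEAST i. t \<le> d (Suc i))"
    have ex: "t \<le> d (Suc R)" using t d by simp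
    have l1: "t \<le> d (Suc l)" unfolding l_def by (rule LeastI[of _ R]) (rule ex)
    have l2: "l \<le> R" unfolding l_def by (rule Least_le) (rule ex)
    have "d l < t"
    proof (cases l)
      case 0 then show ?thesis using d t by simp
    next
      case (Suc i)
      then have "\<not> t \<le> d (Suc i)" using not_less_Least[of i "\<lambda>i. t \<le> d (Suc i)"] unfolding l_def by auto
      then show ?thesis using Suc by simp
    qed
    then show ?thesis using l1 l2 by auto
  qed
  have uniq: "j = l" if "j \<le> R" "l \<le> R" "t \<in> {d j<..d (Suc j)}" "t \<in> {d l<..d (Suc l)}" for j l t
  proof (rule ccontr)
    assume "j \<noteq> l"
    then consider "Suc j \<le> l" | "Suc l \<le> j" by linarith
    then show False
    proof cases
      case 1 then show False using mono[of "Suc j" l] that by auto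
    next
      case 2 then show False using mono[of "Suc l" j] that by auto
    qed
  qed
  define pc where "pc t = (SOME l. l \<le> R \<and> t \<in> {d l<..d (Suc l)})" for t
  have pc: "pc t \<le> R \<and> t \<in> {d (pc t)<..d (Suc (pc t))}" if "0 < t" "t \<le> 1" for t
    unfolding pc_def using piece[OF that] by (rule someI2_ex) (use piece[OF that] in blast)
  define F where "F n k = (if k \<in> {1..n} then G (pc (real k / real n)) (real k / real n) else (\<lambda>_. 0))" for n k :: nat
  have t01: "0 < real k / real n" "real k / real n \<le> 1" if "k \<in> {1..n}" for k n :: nat
    using that by auto
  have F: "F n k \<in> borel_measurable paths" for n k
  proof (cases "k \<in> {1..n}")
    case True
    let ?t = "real k / real n"
    note p = pc[OF t01[OF True]]
    have "(\<lambda>x. (?t, x)) \<in> measurable paths (restrict_space borel {d (pc ?t)<..d (Suc (pc ?t))} \<Otimes>\<^sub>M paths)"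
      using p by (intro measurable_Pair1') (simp add: space_restrict_space)
    from measurable_compose[OF this Gm[of "pc ?t"]] p show ?thesis by (simp add: F_def True)
  next
    case False
    then show ?thesis unfolding F_def by (simp only: if_False) simp
  qed
  have Xrow: "X n k \<omega> = row (F n) k \<omega>" if k: "k \<in> {1..n}" and \<omega>: "\<omega> \<in> space M" for n k \<omega>
  proof -
    let ?t = "real k / real n"
    note p = pc[OF t01[OF k]]
    have "X n k \<omega> = (\<Sum>j=0..R. G j ?t (past eps (int k) \<omega>) * indicator {d j<..d (Suc j)} ?t)"
      using k \<omega> by (intro Xeq) auto
    also have "\<dots> = (\<Sum>j=0..R. if j = pc ?t then G j ?t (past eps (int k) \<omega>) else 0)"
    proof (rule sum.cong[OF refl])
      fix j assume j: "j \<in> {0..R}"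
      show "G j ?t (past eps (int k) \<omega>) * indicator {d j<..d (Suc j)} ?t = (if j = pc ?t then G j ?t (past eps (int k) \<omega>) else 0)"
      proof (cases "j = pc ?t")
        case True
        then show ?thesis using p by (simp add: indicator_def)
      next
        case False
        then have "?t \<notin> {d j<..d (Suc j)}" using uniq[of j "pc ?t" ?t] p j by auto
        then show ?thesis using False by (simp add: indicator_def)
      qed
    qed
    also have "\<dots> = row (F n) k \<omega>" using p k by (simp add: row_def F_def)
    finally show ?thesis .
  qed
  have FG: "\<exists>l\<le>R. real k / real n \<in> {d l<..d (Suc l)} \<and> F n k = G l (real k / real n)" if k: "k \<in> {1..n}" for n k
    using pc[OF t01[OF k]] k by (intro exI[of _ "pc (real k / real n)"]) (simp add: F_def)
  have F0: "F n k = (\<lambda>_. 0)" if "k \<notin> {1..n}" for n k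
    unfolding F_def using that by (simp only: if_False)
  show thesis by (rule that[of F, OF F Xrow FG F0])
qed

text \<open>The dependence measure is controlled for large lags only. For the other lags the trivial bound 1 is
  absorbed into the constant.\<close>

lemma dep_measure_ky_fan:
  assumes G: "\<And>l t. l \<le> R \<Longrightarrow> t \<in> {d l<..d (Suc l)} \<Longrightarrow> G l t \<in> borel_measurable paths"
    and rho: "0 \<le> \<rho>" "\<rho> < 1"
    and dep: "\<exists>K::real. \<forall>\<^sub>F k in sequentially. dep_measure M eps eps' R d G k 8 \<le> ennreal (K * \<rho> ^ k)"
  obtains B q where "0 < q" "q < 1" "0 \<le> B"
    "\<And>l t i. l \<le> R \<Longrightarrow> t \<in> {d l<..d (Suc l)} \<Longrightarrow>
      ky_fan M (\<lambda>\<omega>. G l t (past eps 0 \<omega>)) (\<lambda>\<omega>. G l t (past (eps(- int i := eps' (- int i))) 0 \<omega>)) \<le> B * q ^ i"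
proof -
  obtain K k0 where K: "\<And>k. k \<ge> k0 \<Longrightarrow> dep_measure M eps eps' R d G k 8 \<le> ennreal (K * \<rho> ^ k)"
    using dep unfolding eventually_sequentially by blast
  define q where "q = max \<rho> (1/2)"
  define K' where "K' = max K 1"
  \<comment> \<open>The second term makes the bound exceed 1 at the finitely many lags below k0.\<close>
  define B where "B = 2 * K' + (1 / q) ^ k0"
  have q: "0 < q" "q < 1" "\<rho> \<le> q" using rho by (auto simp: q_def)
  have K': "0 < K'" "K \<le> K'" by (auto simp: K'_def)
  have past_upd: "past (eps(j := eps' j)) 0 \<in> measurable M paths" for j
  proof -
    have "eps(j := eps' j) = mix eps eps' {j}" by (auto simp: mix_def fun_eq_iff)
    then show ?thesis using past_mix_measurable[of "{j}" 0] by simp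
  qed
  show thesis
  proof (rule that[of q B])
    show "0 < q" "q < 1" by (fact q)+
    show "0 \<le> B" using K' q by (simp add: B_def)
    fix l t i assume l: "l \<le> R" and t: "t \<in> {d l<..d (Suc l)}"
    note Gm = G[OF l t]
    let ?Z1 = "\<lambda>\<omega>. G l t (past eps 0 \<omega>)" and ?Z2 = "\<lambda>\<omega>. G l t (past (eps(- int i := eps' (- int i))) 0 \<omega>)"
    have Z: "?Z1 \<in> borel_measurable M" "?Z2 \<in> borel_measurable M"
      by (rule measurable_compose[OF _ Gm], rule past_measurable past_upd)+
    have qi: "0 < q ^ i" using q by simp
    show "ky_fan M ?Z1 ?Z2 \<le> B * q ^ i"
    proof (cases "i \<ge> k0")
      case True
      have "Lp_norm M 8 (\<lambda>\<omega>. ?Z1 \<omega> - ?Z2 \<omega>) \<le> (SUP t\<in>{d l<..d (Suc l)}.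
        Lp_norm M 8 (\<lambda>\<omega>. G l t (past eps 0 \<omega>) - G l t (past (eps(- int i := eps' (- int i))) 0 \<omega>)))"
        using t by (rule SUP_upper)
      also have "\<dots> \<le> dep_measure M eps eps' R d G i 8"
        unfolding dep_measure_def using l by (intro Max_ge) auto
      also have "\<dots> \<le> ennreal (K * \<rho> ^ i)" by (rule K[OF True])
      also have "\<dots> \<le> ennreal (K' * q ^ i)"
      proof (rule ennreal_leI)
        have "K * \<rho> ^ i \<le> K' * \<rho> ^ i" using K' rho by (intro mult_right_mono) auto
        also have "\<dots> \<le> K' * q ^ i" using K' q rho by (intro mult_left_mono power_mono) auto
        finally show "K * \<rho> ^ i \<le> K' * q ^ i" .
      qed
      finally have "ky_fan M ?Z1 ?Z2 \<le> 2 * (K' * q ^ i)"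
        using K' qi by (intro ky_fan_le_Lp_norm_8 Z) auto
      also have "\<dots> \<le> B * q ^ i"
      proof -
        have "2 * K' * q ^ i \<le> B * q ^ i" using q by (intro mult_right_mono) (auto simp: B_def)
        then show ?thesis by simp
      qed
      finally show ?thesis .
    next
      case False
      have "ky_fan M ?Z1 ?Z2 \<le> 1" by (rule ky_fan_le_1[OF Z])
      also have "1 = (1 / q) ^ k0 * q ^ k0" using q by (simp add: power_one_over)
      also have "\<dots> \<le> B * q ^ i"
        using False q K' by (intro mult_mono power_decreasing) (auto simp: B_def)
      finally show ?thesis .
    qed
  qed
qed

end

lemma sup_max_Lp_norm_finite:
  fixes Z :: "nat \<Rightarrow> nat \<Rightarrow> 'a \<Rightarrow> real"
  assumes fin: "(SUP n\<in>{1..}. MAX j\<in>{1..n}. Lp_norm M 8 (Z n j)) < \<infinity>"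
  obtains c where "0 \<le> c" "\<And>n j. j \<in> {1..n} \<Longrightarrow> Lp_norm M 8 (Z n j) \<le> ennreal c"
proof -
  let ?S = "SUP n\<in>{1..}. MAX j\<in>{1..n}. Lp_norm M 8 (Z n j)"
  show thesis
  proof (rule that[of "enn2real ?S"])
    fix n j :: nat assume j: "j \<in> {1..n}"
    have "Lp_norm M 8 (Z n j) \<le> (MAX j\<in>{1..n}. Lp_norm M 8 (Z n j))" using j by (intro Max_ge) auto
    also have "\<dots> \<le> ?S" using j by (intro SUP_upper) auto
    also have "\<dots> = ennreal (enn2real ?S)" using fin by (simp add: less_top)
    finally show "Lp_norm M 8 (Z n j) \<le> ennreal (enn2real ?S)" .
  qed simp
qed

section \<open>Blocks of weights\<close>

lemma geometric_beats_linear: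
  fixes r :: real and m :: "nat \<Rightarrow> nat"
  assumes r: "0 < r" "r < 1" and m: "filterlim (\<lambda>n. real (m n) / ln (real n)) at_top sequentially"
  shows "(\<lambda>n. r ^ m n * real n) \<longlonglongrightarrow> 0"
proof (rule Lim_null_comparison)
  \<comment> \<open>With this constant, r^(c log n) is the inverse square of n.\<close>
  define c where "c = - 2 / ln r"
  have lr: "ln r < 0" using r by simp
  have "\<forall>\<^sub>F n in sequentially. c \<le> real (m n) / ln (real n)"
    using m by (simp add: filterlim_at_top)
  then show "\<forall>\<^sub>F n in sequentially. norm (r ^ m n * real n) \<le> inverse (real n)"
    using eventually_ge_at_top[of 2]
  proof eventually_elim
    case (elim n)
    have ln: "0 < ln (real n)" using elim by simp
    have "c * ln (real n) \<le> real (m n)" using elim(1) ln by (simp add: pos_le_divide_eq)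
    then have "real (m n) * ln r \<le> c * ln (real n) * ln r" using lr by (intro mult_right_mono_neg) auto
    also have "\<dots> = - 2 * ln (real n)" using lr by (simp add: c_def)
    finally have le: "real (m n) * ln r \<le> - 2 * ln (real n)" .
    have "r ^ m n = exp (real (m n) * ln r)" using r by (simp add: exp_of_nat_mult)
    also have "\<dots> \<le> exp (- 2 * ln (real n))" using le by simp
    also have "\<dots> = inverse (real n) ^ 2"
    proof -
      have "exp (- 2 * ln (real n)) = exp (- ln (real n)) ^ 2" by (simp flip: exp_of_nat_mult)
      also have "exp (- ln (real n)) = inverse (real n)" using elim by (simp add: exp_minus)
      finally show ?thesis .
    qed
    finally have "r ^ m n * real n \<le> inverse (real n) ^ 2 * real n" by (intro mult_right_mono) auto
    also have "\<dots> = inverse (real n)" using elim by (simp add: power2_eq_square)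
    finally show ?case using r by simp
  qed
  show "(\<lambda>n. inverse (real n)) \<longlonglongrightarrow> 0" by (rule lim_inverse_n)
qed

text \<open>Blocks are counted from 0 here; block i is cut off at n, where the row sums vanish anyway.\<close>

definition block :: "nat \<Rightarrow> nat \<Rightarrow> nat \<Rightarrow> nat \<Rightarrow> nat set" where
  "block n l m i = {k \<in> {1..n}. (l + m) * i < k \<and> k \<le> (l + m) * i + l}"

lemma block_separation:
  assumes "0 < i"
  shows "\<exists>a. (\<forall>i'<i. block n l m i' \<subseteq> {..a}) \<and> (\<forall>k\<in>block n l m i. a < k \<and> a + m \<le> k)"
proof (intro exI conjI allI impI ballI subsetI)
  let ?a = "(l + m) * i - m"
  obtain i0 where i0: "i = Suc i0" using assms by (cases i) auto
  have a: "?a = (l + m) * i0 + l" by (simp add: i0)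
  have am: "?a + m = (l + m) * i" by (simp add: i0)
  fix i' k assume "i' < i" "k \<in> block n l m i'"
  then have k: "k \<le> (l + m) * i' + l" and i': "i' \<le> i0" using i0 by (simp_all add: block_def)
  have "(l + m) * i' \<le> (l + m) * i0" using i' by (rule mult_le_mono2)
  then show "k \<in> {..?a}" using k unfolding atMost_iff a by linarith
next
  let ?a = "(l + m) * i - m"
  have am: "?a + m = (l + m) * i" using assms by (cases i) auto
  fix k assume "k \<in> block n l m i"
  then have "(l + m) * i < k" by (simp add: block_def)
  then show "?a < k" "?a + m \<le> k" using am by linarith+
qed

lemma sum_block_le_big_block:
  "(\<Sum>k\<in>block n (l n) (m n) i. (W_row W n k)\<^sup>2) \<le> big_block W l m n (Suc i)"
proof -
  let ?\<phi> = "\<lambda>t. (l n + m n) * i + t"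
  have "block n (l n) (m n) i \<subseteq> ?\<phi> ` {1..l n}"
  proof
    fix k assume k: "k \<in> block n (l n) (m n) i"
    then show "k \<in> ?\<phi> ` {1..l n}"
      by (intro image_eqI[where x = "k - (l n + m n) * i"]) (auto simp: block_def)
  qed
  then have "(\<Sum>k\<in>block n (l n) (m n) i. (W_row W n k)\<^sup>2) \<le> (\<Sum>k\<in>?\<phi> ` {1..l n}. (W_row W n k)\<^sup>2)"
    by (intro sum_mono2) auto
  also have "\<dots> = big_block W l m n (Suc i)"
    unfolding big_block_def by (subst sum.reindex) (auto simp: inj_on_def)
  finally show ?thesis .
qed

lemma num_blocks_cover:
  assumes "0 < l n"
  shows "n \<le> (l n + m n) * num_blocks l m n"
proof -
  have "real n / real (l n + m n) \<le> real (num_blocks l m n)"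
    unfolding num_blocks_def by (meson real_nat_ceiling_ge)
  then have "real n \<le> real (num_blocks l m n) * real (l n + m n)" using assms by (simp add: pos_divide_le_eq)
  then have "real n \<le> real ((l n + m n) * num_blocks l m n)" by (simp add: mult.commute)
  then show ?thesis by (simp only: of_nat_le_iff)
qed

text \<open>Write k - 1 in base l + m: the remainder decides whether k lies in a big or in a small block. The
  last small block may reach beyond n, hence only an inequality.\<close>

lemma sum_gaps_le_small_blocks:
  assumes l: "0 < l n"
  shows "(\<Sum>k\<in>{1..n} - (\<Union>i<num_blocks l m n. block n (l n) (m n) i). (W_row W n k)\<^sup>2)
     \<le> (\<Sum>j=1..num_blocks l m n. small_block W l m n j)"
proof -
  let ?s = "l n + m n" and ?J = "num_blocks l m n"
  let ?\<phi> = "\<lambda>(i, t). ?s * i + t"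
  let ?R = "{1..n} - (\<Union>i<?J. block n (l n) (m n) i)"
  let ?P = "{..<?J} \<times> {l n + 1..l n + m n}"
  have "?R \<subseteq> ?\<phi> ` ?P"
  proof
    fix k assume k: "k \<in> ?R"
    define i where "i = (k - 1) div ?s"
    define t where "t = (k - 1) mod ?s + 1"
    have kit: "k = ?s * i + t" using k by (simp add: i_def t_def)
    have t: "1 \<le> t" "t \<le> ?s" using l by (auto simp: t_def Suc_le_eq)
    have "k - 1 < ?s * ?J" using k num_blocks_cover[where l = l and n = n and m = m, OF l] by auto
    then have "i < ?J" unfolding i_def by (simp add: less_mult_imp_div_less mult.commute)
    moreover have "\<not> t \<le> l n"
    proof
      assume "t \<le> l n"
      then have "k \<in> block n (l n) (m n) i" using k t kit by (auto simp: block_def)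
      then show False using k \<open>i < ?J\<close> by auto
    qed
    ultimately show "k \<in> ?\<phi> ` ?P" using kit t by (intro image_eqI[where x = "(i, t)"]) auto
  qed
  then have "(\<Sum>k\<in>?R. (W_row W n k)\<^sup>2) \<le> (\<Sum>k\<in>?\<phi> ` ?P. (W_row W n k)\<^sup>2)" by (intro sum_mono2) auto
  also have "\<dots> \<le> (\<Sum>p\<in>?P. (W_row W n (?\<phi> p))\<^sup>2)"
    using sum_image_le[of ?P "\<lambda>k. (W_row W n k)\<^sup>2" ?\<phi>] by (simp add: comp_def)
  also have "\<dots> = (\<Sum>i<?J. \<Sum>t=l n + 1..l n + m n. (W_row W n (?s * i + t))\<^sup>2)"
    by (simp add: sum.cartesian_product split_def)
  also have "\<dots> = (\<Sum>j=1..?J. small_block W l m n j)"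
    by (simp add: small_block_def sum.atLeast1_atMost_eq)
  finally show ?thesis .
qed

lemma W_upper_nonneg: "0 \<le> W_upper W n" unfolding W_upper_def by (intro sum_nonneg) auto

lemma W_lower_nonneg: "0 \<le> W_lower W n" unfolding W_lower_def by (intro sum_nonneg) auto

text \<open>The smoothness condition, applied to a grid point and any other one, forces f to be nonnegative on the
  grid as soon as there are two grid points.\<close>

lemma W_Delta_nonneg:
  assumes n: "2 \<le> n"
    and W_smooth: "\<And>k j i h. k \<in> {1..n} \<Longrightarrow> j \<in> {1..n} \<Longrightarrow> i \<in> {1..n} \<Longrightarrow> h \<in> {1..n} \<Longrightarrow>
          \<bar>W n (real i / real n) (real h / real n) - W n (real k / real n) (real j / real n)\<bar>
            \<le> f n (real k / real n) (real j / real n) * norm ((real i, real h) - (real k, real j)) powr p"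
  shows "0 \<le> W_Delta W f n"
  unfolding W_Delta_def
proof (intro sum_nonneg mult_nonneg_nonneg)
  fix k j assume kj: "k \<in> {1..n}" "j \<in> {1..n}"
  \<comment> \<open>Any first index other than k serves.\<close>
  define i where "i = (if k = 1 then 2 else 1 :: nat)"
  have i: "i \<in> {1..n}" "i \<noteq> k" using n by (auto simp: i_def)
  have "norm ((real i, real j) - (real k, real j)) powr p > 0" using i by simp
  moreover have "0 \<le> f n (real k / real n) (real j / real n) * norm ((real i, real j) - (real k, real j)) powr p"
    using W_smooth[OF kj i(1) kj(2)] by (rule order_trans[OF abs_ge_zero])
  ultimately show "0 \<le> f n (real k / real n) (real j / real n)" by (simp add: zero_le_mult_iff)
qed auto

lemma W_lower_negligible:
  assumes ratio: "filterlim (\<lambda>n. W_upper W n / (W_lower W n + W_Delta W f n)) at_top sequentially"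
    and Delta: "\<And>n. 2 \<le> n \<Longrightarrow> 0 \<le> W_Delta W f n"
  shows "(\<lambda>n. W_lower W n / W_upper W n) \<longlonglongrightarrow> 0"
proof (rule Lim_null_comparison)
  let ?q = "\<lambda>n. W_upper W n / (W_lower W n + W_Delta W f n)"
  have "\<forall>\<^sub>F n in sequentially. 1 \<le> ?q n" using ratio by (simp add: filterlim_at_top)
  then show "\<forall>\<^sub>F n in sequentially. norm (W_lower W n / W_upper W n) \<le> inverse (?q n)"
    using eventually_ge_at_top[of 2]
  proof eventually_elim
    case (elim n)
    have up: "W_upper W n \<noteq> 0" using elim(1) by auto
    have "norm (W_lower W n / W_upper W n) = W_lower W n / W_upper W n"
      using W_lower_nonneg W_upper_nonneg by (simp add: divide_nonneg_nonneg)
    also have "\<dots> \<le> (W_lower W n + W_Delta W f n) / W_upper W n"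
      using Delta[OF elim(2)] W_upper_nonneg by (intro divide_right_mono) auto
    also have "\<dots> = inverse (?q n)" by (simp add: inverse_eq_divide)
    finally show ?case .
  qed
  show "(\<lambda>n. inverse (?q n)) \<longlonglongrightarrow> 0"
    using ratio by (rule tendsto_inverse_0_at_top)
qed

section \<open>The central limit theorem\<close>

lemma Lp_norm_cong:
  assumes "\<And>\<omega>. \<omega> \<in> space M \<Longrightarrow> Y \<omega> = Z \<omega>"
  shows "Lp_norm M p Y = Lp_norm M p Z"
proof -
  have "(\<integral>\<^sup>+ \<omega>. ennreal (\<bar>Y \<omega>\<bar> powr p) \<partial>M) = (\<integral>\<^sup>+ \<omega>. ennreal (\<bar>Z \<omega>\<bar> powr p) \<partial>M)"
    by (rule nn_integral_cong) (simp add: assms)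
  then show ?thesis by (simp add: Lp_norm_def)
qed

lemma weighted_wiener_kernel:
  fixes H :: "real \<Rightarrow> real \<Rightarrow> real" and L :: "real \<Rightarrow> real"
  assumes L_nz: "\<And>x. L x \<noteq> 0" and C: "0 \<le> C"
    and bnd: "\<And>x y. \<bar>H x y / (L x * L y)\<bar> \<le> C"
    and hol: "\<And>x x' y. \<bar>H x y / (L x * L y) - H x' y / (L x' * L y)\<bar> \<le> C * min 1 (\<bar>x - x'\<bar> powr \<eta>)"
  shows "\<bar>H x y\<bar> \<le> C * (1 + \<bar>L x\<bar>) * (1 + \<bar>L y\<bar>)"
    and "\<bar>H x y - H x' y\<bar> \<le> C * kernel_modulus L \<eta> x x' * (1 + \<bar>L y\<bar>)"
proof -
  define f where "f x y = H x y / (L x * L y)" for x y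
  have H: "H x y = L x * L y * f x y" for x y using L_nz by (simp add: f_def)
  have f: "\<bar>f x y\<bar> \<le> C" "\<bar>f x y - f x' y\<bar> \<le> C * min 1 (\<bar>x - x'\<bar> powr \<eta>)" for x x' y
    using bnd hol by (auto simp: f_def)
  have "\<bar>H x y\<bar> = \<bar>L x\<bar> * \<bar>L y\<bar> * \<bar>f x y\<bar>" by (simp add: H abs_mult)
  also have "\<dots> \<le> (1 + \<bar>L x\<bar>) * (1 + \<bar>L y\<bar>) * C" using f(1)[of x y] by (intro mult_mono) auto
  finally show "\<bar>H x y\<bar> \<le> C * (1 + \<bar>L x\<bar>) * (1 + \<bar>L y\<bar>)" by (simp add: mult_ac)
  have "H x y - H x' y = L y * ((L x - L x') * f x' y + L x * (f x y - f x' y))"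
    by (simp add: H algebra_simps)
  then have "\<bar>H x y - H x' y\<bar> = \<bar>L y\<bar> * \<bar>(L x - L x') * f x' y + L x * (f x y - f x' y)\<bar>" by (simp add: abs_mult)
  also have "\<dots> \<le> (1 + \<bar>L y\<bar>) * (C * kernel_modulus L \<eta> x x')"
  proof (rule mult_mono)
    have "\<bar>(L x - L x') * f x' y\<bar> \<le> \<bar>L x - L x'\<bar> * C" unfolding abs_mult by (intro mult_left_mono f) auto
    moreover have "\<bar>L x * (f x y - f x' y)\<bar> \<le> (1 + \<bar>L x\<bar>) * (C * min 1 (\<bar>x - x'\<bar> powr \<eta>))"
      unfolding abs_mult using f(2)[of x y x'] by (intro mult_mono) auto
    ultimately have "\<bar>(L x - L x') * f x' y + L x * (f x y - f x' y)\<bar>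
        \<le> \<bar>L x - L x'\<bar> * C + (1 + \<bar>L x\<bar>) * (C * min 1 (\<bar>x - x'\<bar> powr \<eta>))" by linarith
    also have "\<dots> = C * kernel_modulus L \<eta> x x'" by (simp add: kernel_modulus_def algebra_simps)
    finally show "\<bar>(L x - L x') * f x' y + L x * (f x y - f x' y)\<bar> \<le> C * kernel_modulus L \<eta> x x'" .
  qed auto
  finally show "\<bar>H x y - H x' y\<bar> \<le> C * kernel_modulus L \<eta> x x' * (1 + \<bar>L y\<bar>)" by (simp add: mult_ac)
qed

definition grid_weight :: "(nat \<Rightarrow> real \<Rightarrow> real \<Rightarrow> real) \<Rightarrow> nat \<Rightarrow> nat \<Rightarrow> nat \<Rightarrow> real" where
  "grid_weight W n k j = (if k \<in> {1..n} \<and> j \<in> {1..n} then W n (real k / real n) (real j / real n) else 0)"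

theorem corollary1:
  fixes M :: "'a measure"
    and eps eps' :: "int \<Rightarrow> 'a \<Rightarrow> real"
    and r :: nat
    and d :: "nat \<Rightarrow> real"
    and G :: "nat \<Rightarrow> real \<Rightarrow> (nat \<Rightarrow> real) \<Rightarrow> real"
    and X :: "nat \<Rightarrow> nat \<Rightarrow> 'a \<Rightarrow> real"
    and H :: "real \<Rightarrow> real \<Rightarrow> real"
    and W f :: "nat \<Rightarrow> real \<Rightarrow> real \<Rightarrow> real"
    and L L' :: "real \<Rightarrow> real"
    and l m :: "nat \<Rightarrow> nat"
    and \<eta> C c \<rho> p :: real
  assumes prob: "prob_space M"
    and innov: "iid_with_copy M eps eps'"
    and X: "piecewise_locally_stationary M eps r d G X"
    and H_borel: "(\<lambda>(x, y). H x y) \<in> borel_measurable borel"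
    and H_sym: "\<And>x y. H x y = H y x"
    and W_borel: "\<And>n. n \<ge> 1 \<Longrightarrow>
          (\<lambda>(x, y). W n x y) \<in> borel_measurable (restrict_space borel ({0..1} \<times> {0..1}))"
    and W_sym: "\<And>n x y. n \<ge> 1 \<Longrightarrow> x \<in> {0..1} \<Longrightarrow> y \<in> {0..1} \<Longrightarrow> W n x y = W n y x"
    \<comment> \<open>(1)\<close>
    and eta: "0 < \<eta>" "\<eta> \<le> 1"
    and L_nz: "\<And>x. L x \<noteq> 0"
    and H_wiener: "(\<lambda>t s. H t s / (L t * L s)) \<in> wiener_ring \<eta>"
    \<comment> \<open>(2)\<close>
    and L_deriv: "\<And>x. (L has_real_derivative L' x) (at x)"
    and L'_bound: "\<And>a b t. a \<le> t \<Longrightarrow> t \<le> b \<Longrightarrow> \<bar>L' t\<bar> \<le> C * (\<bar>L' a\<bar> + \<bar>L' b\<bar> + 1)"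
    and L_moment: "(SUP n\<in>{1..}. MAX j\<in>{1..n}. Lp_norm M 8 (\<lambda>\<omega>. L (X n j \<omega>))) < \<infinity>"
    and L'_moment: "(SUP n\<in>{1..}. MAX j\<in>{1..n}. Lp_norm M 8 (\<lambda>\<omega>. L' (X n j \<omega>))) < \<infinity>"
    \<comment> \<open>(3)\<close>
    and lm_pos: "\<And>n. n \<ge> 1 \<Longrightarrow> l n > 0" "\<And>n. n \<ge> 1 \<Longrightarrow> m n > 0"
    and m_log: "filterlim (\<lambda>n. real (m n) / ln (real n)) at_top sequentially"
    and l_n: "(\<lambda>n. real (l n) / real n) \<longlonglongrightarrow> 0"
    and m_l: "(\<lambda>n. real (m n) / real (l n)) \<longlonglongrightarrow> 0"
    and small_blocks: "(\<lambda>n. (\<Sum>j=1..num_blocks l m n. small_block W l m n j) / W_upper W n) \<longlonglongrightarrow> 0"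
    and big_blocks: "(\<lambda>n. (MAX j\<in>{1..num_blocks l m n}. big_block W l m n j) / W_upper W n) \<longlonglongrightarrow> 0"
    \<comment> \<open>(4)\<close>
    and c: "c > 0"
    and N_var: "\<forall>\<^sub>F n in sequentially. prob_space.variance M (N_stat M W H X n) / W_upper W n \<ge> c"
    \<comment> \<open>(5)\<close>
    and rho: "0 \<le> \<rho>" "\<rho> < 1"
    and dep: "\<exists>K::real. \<forall>\<^sub>F k in sequentially. dep_measure M eps eps' r d G k 8 \<le> ennreal (K * \<rho> ^ k)"
    \<comment> \<open>(6)\<close>
    and p: "p > 0"
    and W_smooth: "\<And>n k j i h. n \<ge> 1 \<Longrightarrow> k \<in> {1..n} \<Longrightarrow> j \<in> {1..n} \<Longrightarrow> i \<in> {1..n} \<Longrightarrow> h \<in> {1..n} \<Longrightarrow>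
          \<bar>W n (real i / real n) (real h / real n) - W n (real k / real n) (real j / real n)\<bar>
            \<le> f n (real k / real n) (real j / real n)
               * norm ((real i, real h) - (real k, real j)) powr p"
    \<comment> \<open>(7)\<close>
    and W_ratio: "filterlim (\<lambda>n. W_upper W n / (W_lower W n + W_Delta W f n)) at_top sequentially"
  shows "weak_conv_m
           (\<lambda>n. distr M borel
              (\<lambda>\<omega>. (V_stat W H X n \<omega> - prob_space.expectation M (V_stat W H X n))
                     / sqrt (prob_space.variance M (V_stat W H X n))))
           std_normal_distribution"
proof -
  interpret iid_copies M eps eps'
    using prob innov by (simp add: iid_copies_def iid_copies_axioms_def)
  note [measurable] = measurable_derivative[OF L_deriv]
  obtain F where F: "\<And>n k. F n k \<in> borel_measurable paths"
    and XF: "\<And>n k \<omega>. k \<in> {1..n} \<Longrightarrow> \<omega> \<in> space M \<Longrightarrow> X n k \<omega> = row (F n) k \<omega>"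
    and FG: "\<And>n k. k \<in> {1..n} \<Longrightarrow> \<exists>j\<le>r. real k / real n \<in> {d j<..d (Suc j)} \<and> F n k = G j (real k / real n)"
    and F0: "\<And>n k. k \<notin> {1..n} \<Longrightarrow> F n k = (\<lambda>_. 0)"
    by (rule piecewise_row_functionals[OF X]) blast
  have Gm: "G j t \<in> borel_measurable paths" if "j \<le> r" "t \<in> {d j<..d (Suc j)}" for j t
  proof -
    have 1: "(\<lambda>(t, x). G j t x) \<in> borel_measurable (restrict_space borel {d j<..d (Suc j)} \<Otimes>\<^sub>M paths)"
      using X that unfolding piecewise_locally_stationary_def by auto
    have 2: "(\<lambda>x. (t, x)) \<in> measurable paths (restrict_space borel {d j<..d (Suc j)} \<Otimes>\<^sub>M paths)"
      using that by (intro measurable_Pair1') (simp add: space_restrict_space)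
    show ?thesis using measurable_compose[OF 2 1] by simp
  qed
  obtain B q where q: "0 < q" "q < 1" and B: "0 \<le> B"
    and kf: "\<And>j t i. j \<le> r \<Longrightarrow> t \<in> {d j<..d (Suc j)} \<Longrightarrow>
      ky_fan M (\<lambda>\<omega>. G j t (past eps 0 \<omega>)) (\<lambda>\<omega>. G j t (past (eps(- int i := eps' (- int i))) 0 \<omega>)) \<le> B * q ^ i"
    by (rule dep_measure_ky_fan[OF Gm rho dep]) blast+
  obtain cL where cL: "0 \<le> cL" "\<And>n j. j \<in> {1..n} \<Longrightarrow> Lp_norm M 8 (\<lambda>\<omega>. L (X n j \<omega>)) \<le> ennreal cL"
    by (rule sup_max_Lp_norm_finite[OF L_moment]) blast
  obtain cL' where cL': "0 \<le> cL'" "\<And>n j. j \<in> {1..n} \<Longrightarrow> Lp_norm M 8 (\<lambda>\<omega>. L' (X n j \<omega>)) \<le> ennreal cL'"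
    by (rule sup_max_Lp_norm_finite[OF L'_moment]) blast
  \<comment> \<open>The values at 0 take care of the padding of a row by zeros outside 1, ..., n.\<close>
  define A where "A = cL ^ 8 + cL' ^ 8 + L 0 ^ 8 + L' 0 ^ 8"
  have A: "cL ^ 8 \<le> A" "cL' ^ 8 \<le> A" "L 0 ^ 8 \<le> A" "L' 0 ^ 8 \<le> A"
    by (simp_all add: A_def add_nonneg_nonneg)
  obtain C0 where C0: "0 \<le> C0" "\<And>x y. \<bar>H x y / (L x * L y)\<bar> \<le> C0"
    "\<And>x x' y. \<bar>H x y / (L x * L y) - H x' y / (L x' * L y)\<bar> \<le> C0 * min 1 (\<bar>x - x'\<bar> powr \<eta>)"
    by (rule wiener_ring_holder[OF H_wiener eta]) blast
  note H_bounds = weighted_wiener_kernel[OF L_nz C0]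
  let ?lw = "\<lambda>x. 1 + \<bar>L x\<bar>" and ?D = "kernel_modulus L \<eta>"
  obtain K \<theta> where sp_all: "\<And>F. (\<And>k. F k \<in> borel_measurable paths) \<Longrightarrow>
     (\<And>k i. ky_fan M (\<lambda>\<omega>. F k (past eps 0 \<omega>)) (\<lambda>\<omega>. F k (past (eps(- int i := eps' (- int i))) 0 \<omega>)) \<le> B * q ^ i) \<Longrightarrow>
     (\<And>k. integrable M (\<lambda>\<omega>. L (row F k \<omega>) ^ 8)) \<Longrightarrow> (\<And>k. (\<integral>\<omega>. L (row F k \<omega>) ^ 8 \<partial>M) \<le> A) \<Longrightarrow>
     (\<And>k. integrable M (\<lambda>\<omega>. L' (row F k \<omega>) ^ 8)) \<Longrightarrow> (\<And>k. (\<integral>\<omega>. L' (row F k \<omega>) ^ 8 \<partial>M) \<le> A) \<Longrightarrow>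
     spliced_process M (row F) (spliced_row F) ?lw ?D K \<theta>"
    by (rule spliced_process_row[OF L_deriv L'_bound eta q B, of A]) blast+
  have row_m: "row (F n) k \<in> borel_measurable M" for n k
    unfolding row_def[abs_def] by (rule measurable_compose[OF past_measurable F])
  have mom: "integrable M (\<lambda>\<omega>. g (row (F n) k \<omega>) ^ 8) \<and> (\<integral>\<omega>. g (row (F n) k \<omega>) ^ 8 \<partial>M) \<le> A"
    if g: "g \<in> borel_measurable borel" and cg: "0 \<le> cg" "cg ^ 8 \<le> A" "g 0 ^ 8 \<le> A"
      and le: "\<And>n j. j \<in> {1..n} \<Longrightarrow> Lp_norm M 8 (\<lambda>\<omega>. g (X n j \<omega>)) \<le> ennreal cg" for g :: "real \<Rightarrow> real" and cg n k
  proof (cases "k \<in> {1..n}")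
    case True
    have "Lp_norm M 8 (\<lambda>\<omega>. g (row (F n) k \<omega>)) = Lp_norm M 8 (\<lambda>\<omega>. g (X n k \<omega>))"
      by (rule Lp_norm_cong) (simp add: XF[OF True])
    then have "Lp_norm M 8 (\<lambda>\<omega>. g (row (F n) k \<omega>)) \<le> ennreal cg" using le[OF True] by simp
    from Lp_norm_8_le[OF measurable_compose[OF row_m g] this cg(1)] cg(2) show ?thesis by auto
  next
    case False
    then show ?thesis using cg(3) F0[OF False] by (simp add: row_def prob_space)
  qed
  have sp: "spliced_process M (row (F n)) (spliced_row (F n)) ?lw ?D K \<theta>" for n
  proof (rule sp_all)
    show "F n k \<in> borel_measurable paths" for k by (rule F)
    show "ky_fan M (\<lambda>\<omega>. F n k (past eps 0 \<omega>)) (\<lambda>\<omega>. F n k (past (eps(- int i := eps' (- int i))) 0 \<omega>)) \<le> B * q ^ i" for k i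
    proof (cases "k \<in> {1..n}")
      case True
      then obtain j where j: "j \<le> r" "real k / real n \<in> {d j<..d (Suc j)}" "F n k = G j (real k / real n)"
        using FG by blast
      then show ?thesis using kf[OF j(1,2)] by simp
    next
      case False
      then show ?thesis using B q by (simp add: F0 ky_fan_def)
    qed
  qed (use mom[OF measurable_derivative(1)[OF L_deriv] cL(1) A(1) A(3) cL(2)]
        mom[OF measurable_derivative(2)[OF L_deriv] cL'(1) A(2) A(4) cL'(2)] in auto)
  have H_meas: "(\<lambda>(x, y). H x y) \<in> borel_measurable (borel \<Otimes>\<^sub>M borel)"
    using H_borel by (simp add: borel_prod)
  have gw_sym: "grid_weight W n k j = grid_weight W n j k" for n k j
    by (auto simp: grid_weight_def intro!: W_sym)
  have br: "blocked_row M (row (F n)) (spliced_row (F n)) ?lw ?D K \<theta> H C0 (grid_weight W n) n (block n (l n) (m n)) (m n)" for n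
  proof -
    interpret S: spliced_process M "row (F n)" "spliced_row (F n)" ?lw ?D K \<theta> by (rule sp)
    have reg: "S.regular C0 H"
      unfolding S.regular_def using C0(1) H_meas H_bounds
    proof (intro conjI allI)
      fix x y y'
      show "\<bar>H x y - H x y'\<bar> \<le> C0 * ?lw x * ?D y y'"
        using H_bounds(2)[of y x y'] unfolding H_sym[of x] by (simp add: mult_ac)
    qed auto
    show ?thesis
      by unfold_locales (use reg H_sym gw_sym block_separation in \<open>auto simp: block_def\<close>)
  qed
  define C2 where "C2 = linear_family.C2 K \<theta>"
  define C4 where "C4 = linear_family.C4 K \<theta>"
  define c1 where "c1 = kernel_row.c1 K C0"
  define CE where "CE = kernel_row.CE K \<theta> C0"
  define CQ where "CQ = kernel_row.CQ K \<theta> C0"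
  let ?J = "num_blocks l m"
  let ?small = "\<lambda>n. \<Sum>j=1..?J n. small_block W l m n j" and ?big = "\<lambda>n. MAX j\<in>{1..?J n}. big_block W l m n j"
  define Z where "Z n \<omega> = (V_stat W H X n \<omega> - prob_space.expectation M (V_stat W H X n)) / sqrt (prob_space.variance M (V_stat W H X n))" for n \<omega>
  have Xm: "X n k \<in> borel_measurable M" if "k \<in> {1..n}" for n k
    by (rule iffD2[OF measurable_cong[OF XF[OF that]] row_m])
  have HX: "(\<lambda>\<omega>. H (X n k \<omega>) (X n j \<omega>)) \<in> borel_measurable M" if "k \<in> {1..n}" "j \<in> {1..n}" for n k j
    using measurable_compose[OF measurable_Pair[OF Xm[OF that(1)] Xm[OF that(2)]] H_meas] by simp
  have Zm: "Z n \<in> borel_measurable M" for n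
    unfolding Z_def[abs_def] V_stat_def
    by (intro borel_measurable_divide borel_measurable_diff borel_measurable_sum borel_measurable_times
         borel_measurable_const HX) auto
  have row_error: "norm (char (distr M borel (Z n)) u - char std_normal_distribution u)
      \<le> clt_error C2 C4 c1 CE K c u (?small n / W_upper W n + W_lower W n / W_upper W n)
          (?big n / W_upper W n + 1 / real n) (\<theta> ^ m n * real n)"
    if n: "1 \<le> n" and var: "c \<le> prob_space.variance M (N_stat M W H X n) / W_upper W n"
      and low: "CQ * (W_lower W n / W_upper W n) \<le> c" for n u
  proof -
    interpret R: blocked_row M "row (F n)" "spliced_row (F n)" ?lw ?D K \<theta> H C0 "grid_weight W n" n "block n (l n) (m n)" "m n" "?J n"
      by (rule br)
    have const_eqs: "R.lin.C2 = C2" "R.lin.C4 = C4" "R.c1 = c1" "R.CE = CE" "R.CQ = CQ"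
      by (simp_all add: C2_def C4_def c1_def CE_def CQ_def)
    have up: "0 < W_upper W n" using var c W_upper_nonneg[of W n] by (cases "W_upper W n = 0") auto
    have gw: "grid_weight W n k j = W n (real k / real n) (real j / real n)" if "k \<in> {1..n}" "j \<in> {1..n}" for k j
      using that by (simp add: grid_weight_def)
    have rowW: "R.rowW k = W_row W n k" for k
      by (auto simp: R.rowW_def W_row_def grid_weight_def intro!: sum.cong)
    have b: "W_upper W n = (\<Sum>k\<in>{1..n}. (R.rowW k)\<^sup>2)" by (simp add: rowW W_upper_def)
    have w2: "W_lower W n = (\<Sum>k\<in>{1..n}. \<Sum>j\<in>{1..n}. (grid_weight W n k j)\<^sup>2)"
      unfolding W_lower_def by (intro sum.cong refl) (simp add: gw)
    have Veq: "V_stat W H X n \<omega> = R.V \<omega>" if "\<omega> \<in> space M" for \<omega>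
      unfolding V_stat_def R.V_def by (intro sum.cong refl) (simp add: gw XF that)
    have VE: "prob_space.expectation M (V_stat W H X n) = (\<integral>\<omega>. R.V \<omega> \<partial>M)"
      by (rule Bochner_Integration.integral_cong) (auto simp: Veq)
    have VV: "prob_space.variance M (V_stat W H X n) = (\<integral>\<omega>. (R.Zc \<omega>)\<^sup>2 \<partial>M)"
      by (rule Bochner_Integration.integral_cong) (auto simp: Veq VE R.Zc_def)
    have Zeq: "Z n \<omega> = R.Zc \<omega> / sqrt (\<integral>\<omega>. (R.Zc \<omega>)\<^sup>2 \<partial>M)" if "\<omega> \<in> space M" for \<omega>
      unfolding Z_def VV unfolding VE Veq[OF that] R.Zc_def ..
    have HP: "H_proj M H X n j x = R.HP j x" if "j \<in> {1..n}" for j x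
      unfolding H_proj_def R.HP_def by (rule Bochner_Integration.integral_cong) (auto simp: XF[OF that])
    have Neq: "N_stat M W H X n \<omega> = R.lin.Lin {1..n} \<omega>" if \<omega>: "\<omega> \<in> space M" for \<omega>
      unfolding N_stat_def R.lin.Lin_def R.y_def
    proof (intro sum.cong refl)
      fix k j assume kj: "k \<in> {1..n}" "j \<in> {1..n}"
      have "(\<integral>\<omega>'. H_proj M H X n j (X n k \<omega>') \<partial>M) = R.m k j"
        unfolding R.m_def HP[OF kj(2)] by (rule Bochner_Integration.integral_cong) (auto simp: XF[OF kj(1)])
      then show "W n (real k / real n) (real j / real n) * (H_proj M H X n j (X n k \<omega>) - (\<integral>\<omega>'. H_proj M H X n j (X n k \<omega>') \<partial>M))
          = grid_weight W n k j * (R.HP j (row (F n) k \<omega>) - R.m k j)"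
        by (simp add: gw[OF kj] HP[OF kj(2)] XF[OF kj(1) \<omega>])
    qed
    have NE: "prob_space.expectation M (N_stat M W H X n) = 0"
    proof -
      have "prob_space.expectation M (N_stat M W H X n) = (\<integral>\<omega>. R.lin.Lin {1..n} \<omega> \<partial>M)"
        by (rule Bochner_Integration.integral_cong) (auto simp: Neq)
      then show ?thesis by (simp add: R.lin.Lin_mean)
    qed
    have NV: "prob_space.variance M (N_stat M W H X n) = (\<integral>\<omega>. (R.lin.Lin {1..n} \<omega>)\<^sup>2 \<partial>M)"
      by (rule Bochner_Integration.integral_cong) (auto simp: Neq NE)
    have s2: "c * W_upper W n \<le> (\<integral>\<omega>. (R.Zc \<omega>)\<^sup>2 \<partial>M)"
    proof -
      have 1: "c * W_upper W n \<le> (\<integral>\<omega>. (R.lin.Lin {1..n} \<omega>)\<^sup>2 \<partial>M)"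
        using var up unfolding NV by (simp add: pos_le_divide_eq)
      have "(\<integral>\<omega>. (R.Qc \<omega>)\<^sup>2 \<partial>M) \<le> CQ * W_lower W n"
        using R.Qc_second_moment(2) unfolding const_eqs w2 by simp
      also have "\<dots> \<le> c * W_upper W n" using low up by (simp add: pos_divide_le_eq)
      finally show ?thesis using R.variance_lower 1 by linarith
    qed
    have Jpos: "0 < ?J n"
    proof (rule ccontr)
      assume "\<not> 0 < ?J n"
      then show False using num_blocks_cover[of l n m] lm_pos(1)[OF n] n by simp
    qed
    have big: "(\<Sum>k\<in>block n (l n) (m n) i. (R.rowW k)\<^sup>2) \<le> ?big n" if "i < ?J n" for i
    proof -
      have "(\<Sum>k\<in>block n (l n) (m n) i. (R.rowW k)\<^sup>2) \<le> big_block W l m n (Suc i)"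
        unfolding rowW by (rule sum_block_le_big_block)
      also have "\<dots> \<le> ?big n" using that by (intro Max_ge) auto
      finally show ?thesis .
    qed
    have big0: "0 \<le> ?big n"
      using big[OF Jpos] sum_nonneg[of "block n (l n) (m n) 0" "\<lambda>k. (R.rowW k)\<^sup>2"] by auto
    \<comment> \<open>The second term is asymptotically negligible and keeps the bound positive even if all big blocks vanish.\<close>
    define \<alpha> where "\<alpha> = ?big n + W_upper W n / real n"
    have \<alpha>: "0 < \<alpha>" using big0 up n by (simp add: \<alpha>_def add_nonneg_pos)
    have \<alpha>b: "\<alpha> / W_upper W n = ?big n / W_upper W n + 1 / real n"
      using up by (simp add: \<alpha>_def add_divide_distrib)
    have big\<alpha>: "(\<Sum>k\<in>block n (l n) (m n) i. (R.rowW k)\<^sup>2) \<le> \<alpha>" if "i < ?J n" for i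
      using big[OF that] up by (simp add: \<alpha>_def add_increasing2)
    define x where "x = ((\<Sum>k\<in>{1..n} - R.U. (R.rowW k)\<^sup>2) + W_lower W n) / W_upper W n"
    have x: "0 \<le> x" "x \<le> ?small n / W_upper W n + W_lower W n / W_upper W n"
    proof -
      show "0 \<le> x" unfolding x_def using up W_lower_nonneg[of W n]
        by (intro divide_nonneg_pos add_nonneg_nonneg sum_nonneg) auto
      have "(\<Sum>k\<in>{1..n} - R.U. (R.rowW k)\<^sup>2) \<le> ?small n"
        unfolding rowW R.U_def by (rule sum_gaps_le_small_blocks[where l = l and n = n and m = m, OF lm_pos(1)[OF n]])
      then show "x \<le> ?small n / W_upper W n + W_lower W n / W_upper W n"
        unfolding x_def add_divide_distrib[symmetric] using up by (intro divide_right_mono) auto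
    qed
    have "char (distr M borel (Z n)) u = (\<integral>\<omega>. iexp (u * Z n \<omega>) \<partial>M)"
      unfolding char_def by (subst integral_distr) (auto simp: Zm)
    also have "\<dots> = (\<integral>\<omega>. iexp (u * (R.Zc \<omega> / sqrt (\<integral>\<omega>. (R.Zc \<omega>)\<^sup>2 \<partial>M))) \<partial>M)"
      by (rule Bochner_Integration.integral_cong) (simp_all only: Zeq)
    finally have "norm (char (distr M borel (Z n)) u - char std_normal_distribution u)
        = norm ((\<integral>\<omega>. iexp (u * (R.Zc \<omega> / sqrt (\<integral>\<omega>. (R.Zc \<omega>)\<^sup>2 \<partial>M))) \<partial>M) - complex_of_real (exp (- (u\<^sup>2 / 2))))"
      by (simp add: char_std_normal_distribution)
    also have "\<dots> \<le> clt_error C2 C4 c1 CE K c u x (\<alpha> / W_upper W n) (\<theta> ^ m n * real n)"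
      using R.chf_error_le[OF c up b s2 \<alpha> big\<alpha>, of u] unfolding const_eqs w2[symmetric] x_def .
    also have "\<dots> \<le> clt_error C2 C4 c1 CE K c u (?small n / W_upper W n + W_lower W n / W_upper W n) (\<alpha> / W_upper W n) (\<theta> ^ m n * real n)"
    proof (rule clt_error_mono[OF _ c x(2)])
      show "0 \<le> CE" using R.lin.C2_nonneg unfolding const_eqs(4)[symmetric] by (simp add: R.CE_def R.CQ_def)
    qed
    finally show ?thesis unfolding \<alpha>b .
  qed
  have low: "(\<lambda>n. W_lower W n / W_upper W n) \<longlonglongrightarrow> 0"
    by (rule W_lower_negligible[OF W_ratio W_Delta_nonneg[OF _ W_smooth]]) auto
  have th: "0 < \<theta>" "\<theta> < 1" using spliced_process.r[OF sp[of 0]] by auto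
  have "(\<lambda>n. char (distr M borel (Z n)) u) \<longlonglongrightarrow> char std_normal_distribution u" for u
  proof (rule LIM_zero_cancel, rule Lim_null_comparison)
    have "(\<lambda>n. CQ * (W_lower W n / W_upper W n)) \<longlonglongrightarrow> CQ * 0" by (intro tendsto_intros low)
    then have "\<forall>\<^sub>F n in sequentially. CQ * (W_lower W n / W_upper W n) < c"
      using c by (intro order_tendstoD(2)) auto
    then show "\<forall>\<^sub>F n in sequentially. norm (char (distr M borel (Z n)) u - char std_normal_distribution u)
      \<le> clt_error C2 C4 c1 CE K c u (?small n / W_upper W n + W_lower W n / W_upper W n)
          (?big n / W_upper W n + 1 / real n) (\<theta> ^ m n * real n)"
      using N_var eventually_ge_at_top[of 1] by eventually_elim (rule row_error; simp)
    have 1: "(\<lambda>n. ?small n / W_upper W n + W_lower W n / W_upper W n) \<longlonglongrightarrow> 0"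
      using tendsto_add[OF small_blocks low] by simp
    have 2: "(\<lambda>n. ?big n / W_upper W n + 1 / real n) \<longlonglongrightarrow> 0"
      using tendsto_add[OF big_blocks lim_1_over_n] by simp
    show "(\<lambda>n. clt_error C2 C4 c1 CE K c u (?small n / W_upper W n + W_lower W n / W_upper W n)
          (?big n / W_upper W n + 1 / real n) (\<theta> ^ m n * real n)) \<longlonglongrightarrow> 0"
      by (rule clt_error_tendsto_0[OF 1 2 geometric_beats_linear[OF th m_log]])
  qed
  then have "weak_conv_m (\<lambda>n. distr M borel (Z n)) std_normal_distribution"
    by (intro levy_continuity) (auto intro!: real_distribution_distr real_dist_normal_dist Zm)
  then show ?thesis by (simp only: Z_def[abs_def])
qed

end
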